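(* Let $n\geq 2$ and $t>0$. The bent group $\Lambda_t=\rho_t(\pi_1(\mathcal{M}_0))\subset \mathrm{SL}_{n+1}(\mathbb{R})$, obtained by bending the hyperbolic manifold $\mathcal{M}_0$ along the totally geodesic hypersurface $\mathcal{N}_0$, is not a lattice of $\mathrm{SL}_{n+1}(\mathbb{R})$.
   Context: Let $q(x_1,\dots,x_{n+1})=x_1^2+\cdots+x_n^2-x_{n+1}^2$ and let $\Omega_0\subset\mathbb{P}^n$ be the projection of $\{q<0\}$ (the projective model of hyperbolic space $\mathbb{H}^n$, an ellipsoid); $\mathrm{SO}_{n,1}(\mathbb{R})=\mathrm{SO}(q)$. $\Lambda_0$ is a torsion-free finite-index subgroup of $\mathrm{SL}_{n+1}(\mathbb{Z})\cap \mathrm{SO}(q)$ such that, with $H=\Omega_0\cap\{x_1=0\}$ and $\Delta_0=\mathrm{Stab}_{\Lambda_0}(H)$, the quotient $\mathcal{N}_0=H/\Delta_0$ is a finite-volume two-sided hypersurface which embeds (properly, totally geodesically) in the non-compact finite-volume hyperbolic manifold $\mathcal{M}_0=\Omega_0/\Lambda_0$. Let $\rho_0:\pi_1(\mathcal{M}_0)\to\Lambda_0\subset \mathrm{SL}_{n+1}(\mathbb{R})$ be the holonomy. Bending. Put $a_t=\mathrm{diag}(e^{nt},e^{-t},\dots,e^{-t})$, which commutes with $\rho_0(\pi_1(\mathcal{N}_0))=\Delta_0$. If $\mathcal{M}_0\setminus\mathcal{N}_0$ has two components $\mathcal{M}_g,\mathcal{M}_d$, then $\pi_1(\mathcal{M}_0)=\pi_1(\mathcal{M}_g)*_{\pi_1(\mathcal{N}_0)}\pi_1(\mathcal{M}_d)$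 and $\rho_t$ is the representation equal to $\rho_0$ on $\pi_1(\mathcal{M}_g)$ and to $a_t\rho_0(\cdot)a_t^{-1}$ on $\pi_1(\mathcal{M}_d)$. If $\mathcal{M}_0\setminus\mathcal{N}_0$ is connected, let $\mathcal{M}^\dagger$ be $\mathcal{M}_0$ cut along $\mathcal{N}_0$ (two boundary copies of $\mathcal{N}_0$); $\pi_1(\mathcal{M}_0)$ is an HNN extension of $\pi_1(\mathcal{M}^\dagger)$ with stable letter $\alpha$, where $\pi_1(\mathcal M^\dagger)$ is the stabilizer of a component $\mathcal{C}$ of $\Omega_0\setminus\bigcup_\gamma \gamma H$ and $\mathcal{C},\alpha\mathcal{C}$ are the two components bordering $H$; then $\rho_t=\rho_0$ on $\pi_1(\mathcal{M}^\dagger)$ and $\rho_t(\alpha)=a_t\rho_0(\alpha)$. In both cases $\Lambda_t=\rho_t(\pi_1(\mathcal{M}_0))$. *)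

theory Defs
  imports "HOL-Analysis.Analysis" "HOL-Algebra.Coset"
begin

text \<open>
  Vectors of \<open>\<real>\<^bsup>n+1\<^esup>\<close> are elements of \<open>real ^ 'n\<close> with \<open>CARD('n) = n + 1\<close>.  A finite linearly
  ordered index type is order isomorphic to \<open>{1..n+1}\<close>; its extreme elements are the indices
  of the coordinates \<open>x\<^sub>1\<close> and \<open>x\<^bsub>n+1\<^esub>\<close>.
\<close>

type_synonym 'n rvec = "real ^ 'n"
type_synonym 'n sqmat = "real ^ 'n ^ 'n"

definition ifirst :: "'n::{finite,linorder}" where
  "ifirst = Min UNIV"

definition ilast :: "'n::{finite,linorder}" where
  "ilast = Max UNIV"

definition qform :: "'n::{finite,linorder} rvec \<Rightarrow> real" where
  "qform x = (\<Sum>i\<in>UNIV - {ilast}. (x $ i)\<^sup>2) - (x $ ilast)\<^sup>2"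


subsection \<open>Matrix groups\<close>

definition SL :: "'n::finite sqmat monoid" where
  "SL = \<lparr>carrier = {A. det A = 1}, mult = (**), one = mat 1\<rparr>"

definition SO_q :: "'n::{finite,linorder} sqmat set" where
  "SO_q = {A. det A = 1 \<and> (\<forall>x. qform (A *v x) = qform x)}"

definition SL_int :: "'n::finite sqmat set" where
  "SL_int = {A. det A = 1 \<and> (\<forall>i j. A $ i $ j \<in> \<int>)}"

definition arithmetic_group :: "'n::{finite,linorder} sqmat monoid" where
  "arithmetic_group = SL\<lparr>carrier := SL_int \<inter> SO_q\<rparr>"

definition finite_index :: "'a set \<Rightarrow> ('a, 'b) monoid_scheme \<Rightarrow> bool" where
  "finite_index H G \<longleftrightarrow> subgroup H G \<and> finite (rcosets\<^bsub>G\<^esub> H)"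

definition torsion_free :: "('a, 'b) monoid_scheme \<Rightarrow> 'a set \<Rightarrow> bool" where
  "torsion_free G H \<longleftrightarrow>
     (\<forall>g\<in>H. \<forall>k::nat. k > 0 \<longrightarrow> g [^]\<^bsub>G\<^esub> k = \<one>\<^bsub>G\<^esub> \<longrightarrow> g = \<one>\<^bsub>G\<^esub>)"


subsection \<open>Lattices\<close>

definition quotient_topology :: "'a topology \<Rightarrow> ('a \<Rightarrow> 'b) \<Rightarrow> 'b topology" where
  "quotient_topology X f =
     topology (\<lambda>U. U \<subseteq> f ` topspace X \<and> openin X {x \<in> topspace X. f x \<in> U})"

lemma openin_quotient_topology:
  "openin (quotient_topology X f) U \<longleftrightarrow>
     U \<subseteq> f ` topspace X \<and> openin X {x \<in> topspace X. f x \<in> U}"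
proof -
  have "istopology (\<lambda>U. U \<subseteq> f ` topspace X \<and> openin X {x \<in> topspace X. f x \<in> U})"
  proof (unfold istopology_def, intro conjI allI impI)
    fix S T
    assume "S \<subseteq> f ` topspace X \<and> openin X {x \<in> topspace X. f x \<in> S}"
      and "T \<subseteq> f ` topspace X \<and> openin X {x \<in> topspace X. f x \<in> T}"
    moreover have "{x \<in> topspace X. f x \<in> S \<inter> T} =
        {x \<in> topspace X. f x \<in> S} \<inter> {x \<in> topspace X. f x \<in> T}" by auto
    ultimately show "S \<inter> T \<subseteq> f ` topspace X" "openin X {x \<in> topspace X. f x \<in> S \<inter> T}"
      by (auto simp: openin_Int)
  next
    fix K
    assume K: "\<forall>S\<in>K. S \<subseteq> f ` topspace X \<and> openin X {x \<in> topspace X. f x \<in> S}"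
    then show "\<Union>K \<subseteq> f ` topspace X" by blast
    have "{x \<in> topspace X. f x \<in> \<Union>K} = (\<Union>S\<in>K. {x \<in> topspace X. f x \<in> S})" by auto
    with K show "openin X {x \<in> topspace X. f x \<in> \<Union>K}" by auto
  qed
  then show ?thesis
    by (simp add: quotient_topology_def topology_inverse')
qed

lemma topspace_quotient_topology: "topspace (quotient_topology X f) = f ` topspace X"
proof -
  have "{x \<in> topspace X. f x \<in> f ` topspace X} = topspace X" by auto
  then have "openin (quotient_topology X f) (f ` topspace X)"
    by (simp add: openin_quotient_topology)
  moreover have "topspace (quotient_topology X f) \<subseteq> f ` topspace X"
    using openin_quotient_topology[of X f "topspace (quotient_topology X f)"] by simp
  ultimately show ?thesis
    by (simp add: openin_subset subset_antisym)
qed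

lemma quotient_map_quotient_topology: "quotient_map X (quotient_topology X f) f"
  by (simp add: quotient_map_def openin_quotient_topology topspace_quotient_topology)

definition SL_mod :: "'n::finite sqmat set \<Rightarrow> 'n sqmat set topology" where
  "SL_mod \<Gamma> = quotient_topology (top_of_set (carrier SL)) (\<lambda>g. g <#\<^bsub>SL\<^esub> \<Gamma>)"

definition lattice_in_SL :: "'n::finite sqmat set \<Rightarrow> bool" where
  "lattice_in_SL \<Gamma> \<longleftrightarrow>
     subgroup \<Gamma> SL \<and>
     top_of_set \<Gamma> = discrete_topology \<Gamma> \<and>
     (\<exists>\<nu>. sets \<nu> = sigma_sets (topspace (SL_mod \<Gamma>)) {U. openin (SL_mod \<Gamma>) U} \<and>
          emeasure \<nu> (space \<nu>) \<noteq> 0 \<and> emeasure \<nu> (space \<nu>) \<noteq> \<infinity> \<and>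
          (\<forall>g\<in>carrier SL. \<forall>E\<in>sets \<nu>. emeasure \<nu> ((\<lambda>c. g <#\<^bsub>SL\<^esub> c) ` E) = emeasure \<nu> E))"


subsection \<open>The projective model and its quotients\<close>

text \<open>Points of \<open>\<P>\<^sup>n\<close> are the lines \<open>span {x}\<close> with \<open>x \<noteq> 0\<close>.\<close>

definition proj_space :: "'n::finite rvec set topology" where
  "proj_space = quotient_topology (top_of_set (- {0})) (\<lambda>x. span {x})"

definition act :: "'n::finite sqmat \<Rightarrow> 'n rvec set \<Rightarrow> 'n rvec set" where
  "act A L = (\<lambda>x. A *v x) ` L"

definition Omega0 :: "'n::{finite,linorder} rvec set set" where
  "Omega0 = (\<lambda>x. span {x}) ` {x. qform x < 0}"

definition Hyp :: "'n::{finite,linorder} rvec set set" where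
  "Hyp = {L \<in> Omega0. \<forall>x\<in>L. x $ ifirst = 0}"

definition stab :: "'n::finite sqmat set \<Rightarrow> 'n rvec set set \<Rightarrow> 'n sqmat set" where
  "stab \<Lambda> S = {A \<in> \<Lambda>. act A ` S = S}"

definition orb :: "'n::finite sqmat set \<Rightarrow> 'n rvec set \<Rightarrow> 'n rvec set set" where
  "orb \<Lambda> L = (\<lambda>A. act A L) ` \<Lambda>"

definition orbit_space ::
  "'n::finite sqmat set \<Rightarrow> 'n rvec set set \<Rightarrow> 'n rvec set set topology" where
  "orbit_space \<Lambda> S = quotient_topology (subtopology proj_space S) (orb \<Lambda>)"

definition M0 :: "'n::{finite,linorder} sqmat set \<Rightarrow> 'n rvec set set topology" where
  "M0 \<Lambda> = orbit_space \<Lambda> Omega0"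

definition N0 :: "'n::{finite,linorder} sqmat set \<Rightarrow> 'n rvec set set topology" where
  "N0 \<Lambda> = orbit_space (stab \<Lambda> Hyp) Hyp"

definition N0_incl ::
  "'n::finite sqmat set \<Rightarrow> 'n rvec set set \<Rightarrow> 'n rvec set set" where
  "N0_incl \<Lambda> c = (\<Union>L\<in>c. orb \<Lambda> L)"

definition N0_image :: "'n::{finite,linorder} sqmat set \<Rightarrow> 'n rvec set set set" where
  "N0_image \<Lambda> = N0_incl \<Lambda> ` topspace (N0 \<Lambda>)"

definition N0_properly_embedded :: "'n::{finite,linorder} sqmat set \<Rightarrow> bool" where
  "N0_properly_embedded \<Lambda> \<longleftrightarrow>
     embedding_map (N0 \<Lambda>) (M0 \<Lambda>) (N0_incl \<Lambda>) \<and> proper_map (N0 \<Lambda>) (M0 \<Lambda>) (N0_incl \<Lambda>)"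

text \<open>Two-sided: the hypersurface has a product neighbourhood.\<close>

definition N0_two_sided :: "'n::{finite,linorder} sqmat set \<Rightarrow> bool" where
  "N0_two_sided \<Lambda> \<longleftrightarrow>
     (\<exists>\<phi>. let X = prod_topology (N0 \<Lambda>) (top_of_set {-1<..<1::real}) in
        embedding_map X (M0 \<Lambda>) \<phi> \<and> openin (M0 \<Lambda>) (\<phi> ` topspace X) \<and>
        (\<forall>c\<in>topspace (N0 \<Lambda>). \<phi> (c, 0) = N0_incl \<Lambda> c))"


subsection \<open>Hyperbolic volume\<close>

text \<open>
  For \<open>I \<subseteq> UNIV - {ilast}\<close> the totally geodesic subspace of \<open>\<Omega>\<^sub>0\<close> on which the coordinates
  outside \<open>I \<union> {ilast}\<close> vanish is, in the affine chart \<open>x\<^bsub>n+1\<^esub> = 1\<close>, the unit ball of \<open>\<real>\<^sup>I\<close>.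
  The Klein metric on a unit ball of dimension \<open>m\<close> has volume density
  \<open>(1 - |y|\<^sup>2)\<close> to the power \<open>-(m+1)/2\<close>.
\<close>

definition klein_ball :: "'n::finite set \<Rightarrow> ('n \<Rightarrow> real) set" where
  "klein_ball I = {y \<in> PiE I (\<lambda>_. UNIV). (\<Sum>i\<in>I. (y i)\<^sup>2) < 1}"

definition klein_point :: "'n::{finite,linorder} set \<Rightarrow> ('n \<Rightarrow> real) \<Rightarrow> 'n rvec set" where
  "klein_point I y = span {\<chi> i. if i = ilast then 1 else if i \<in> I then y i else 0}"

definition klein_volume :: "'n::finite set \<Rightarrow> ('n \<Rightarrow> real) measure" where
  "klein_volume I = density (PiM I (\<lambda>_. lborel))
     (\<lambda>y. ennreal (if y \<in> klein_ball I
        then (1 - (\<Sum>i\<in>I. (y i)\<^sup>2)) powr (- (real (card I) + 1) / 2) else 0))"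

text \<open>
  The volume of the quotient of the above subspace by a group \<open>\<Lambda>\<close> preserving it is the volume
  of any measurable set containing exactly one point of each orbit.
\<close>

definition finite_covolume ::
  "'n::{finite,linorder} set \<Rightarrow> 'n sqmat set \<Rightarrow> bool" where
  "finite_covolume I \<Lambda> \<longleftrightarrow>
     (\<exists>F \<in> sets (klein_volume I). F \<subseteq> klein_ball I \<and>
        (\<forall>y\<in>klein_ball I. \<exists>!z. z \<in> F \<and> klein_point I z \<in> orb \<Lambda> (klein_point I y)) \<and>
        emeasure (klein_volume I) F < \<infinity>)"

definition M0_finite_volume :: "'n::{finite,linorder} sqmat set \<Rightarrow> bool" where
  "M0_finite_volume \<Lambda> \<longleftrightarrow> finite_covolume (UNIV - {ilast}) \<Lambda>"

definition N0_finite_volume :: "'n::{finite,linorder} sqmat set \<Rightarrow> bool" where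
  "N0_finite_volume \<Lambda> \<longleftrightarrow> finite_covolume (UNIV - {ifirst, ilast}) (stab \<Lambda> Hyp)"


subsection \<open>Fundamental group and holonomy\<close>

definition loops_at :: "'a topology \<Rightarrow> 'a \<Rightarrow> (real \<Rightarrow> 'a) set" where
  "loops_at X x = {f. pathin X f \<and> f 0 = x \<and> f 1 = x}"

definition loop_class :: "'a topology \<Rightarrow> 'a \<Rightarrow> (real \<Rightarrow> 'a) \<Rightarrow> (real \<Rightarrow> 'a) set" where
  "loop_class X x f = {g \<in> loops_at X x.
     homotopic_with (\<lambda>h. h 0 = x \<and> h 1 = x) (top_of_set {0..1}) X f g}"

definition loop_join :: "(real \<Rightarrow> 'a) \<Rightarrow> (real \<Rightarrow> 'a) \<Rightarrow> real \<Rightarrow> 'a" where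
  "loop_join f g = (\<lambda>s. if s \<le> 1/2 then f (2 * s) else g (2 * s - 1))"

definition fundamental_group :: "'a topology \<Rightarrow> 'a \<Rightarrow> (real \<Rightarrow> 'a) set monoid" where
  "fundamental_group X x =
     \<lparr>carrier = loop_class X x ` loops_at X x,
      mult = (\<lambda>c d. \<Union>f\<in>c. \<Union>g\<in>d. loop_class X x (loop_join f g)),
      one = loop_class X x (\<lambda>_. x)\<rparr>"

text \<open>Image in \<open>\<pi>\<^sub>1(X, x)\<close> of the fundamental group of a subspace \<open>S\<close> containing \<open>x\<close>.\<close>

definition pi1_image :: "'a topology \<Rightarrow> 'a \<Rightarrow> 'a set \<Rightarrow> (real \<Rightarrow> 'a) set set" where
  "pi1_image X x S = {c \<in> carrier (fundamental_group X x). \<exists>f\<in>c. f ` {0..1} \<subseteq> S}"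

definition pi1_M0 ::
  "'n::{finite,linorder} sqmat set \<Rightarrow> 'n rvec set \<Rightarrow> (real \<Rightarrow> 'n rvec set set) set monoid"
  where "pi1_M0 \<Lambda> p = fundamental_group (M0 \<Lambda>) (orb \<Lambda> p)"

text \<open>
  The holonomy of the class of a loop based at the orbit of \<open>p\<close>: the element of \<open>\<Lambda>\<close> mapping
  \<open>p\<close> to the endpoint of the lift starting at \<open>p\<close>.
\<close>

definition holonomy ::
  "'n::{finite,linorder} sqmat set \<Rightarrow> 'n rvec set \<Rightarrow>
     (real \<Rightarrow> 'n rvec set set) set \<Rightarrow> 'n sqmat" where
  "holonomy \<Lambda> p c = (THE A. A \<in> \<Lambda> \<and>
     (\<exists>f\<in>c. \<exists>l. pathin (subtopology proj_space Omega0) l \<and>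
        l 0 = p \<and> (\<forall>s\<in>{0..1}. orb \<Lambda> (l s) = f s) \<and> l 1 = act A p))"


subsection \<open>Bending\<close>

definition bending_matrix :: "nat \<Rightarrow> real \<Rightarrow> 'n::{finite,linorder} sqmat" where
  "bending_matrix n t = (\<chi> i j. if i \<noteq> j then 0
     else if i = ifirst then exp (real n * t) else exp (- t))"

definition complement_N0 ::
  "'n::{finite,linorder} sqmat set \<Rightarrow> 'n rvec set set topology" where
  "complement_N0 \<Lambda> = subtopology (M0 \<Lambda>) (topspace (M0 \<Lambda>) - N0_image \<Lambda>)"

definition separating_bending ::
  "nat \<Rightarrow> real \<Rightarrow> 'n::{finite,linorder} sqmat set \<Rightarrow> 'n rvec set \<Rightarrow>
     ((real \<Rightarrow> 'n rvec set set) set \<Rightarrow> 'n sqmat) \<Rightarrow> bool" where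
  "separating_bending n t \<Lambda> p \<rho> \<longleftrightarrow>
     (\<exists>Mg Md. Mg \<noteq> Md \<and> connected_components_of (complement_N0 \<Lambda>) = {Mg, Md} \<and>
        (\<forall>c \<in> pi1_image (M0 \<Lambda>) (orb \<Lambda> p) (Mg \<union> N0_image \<Lambda>). \<rho> c = holonomy \<Lambda> p c) \<and>
        (\<forall>c \<in> pi1_image (M0 \<Lambda>) (orb \<Lambda> p) (Md \<union> N0_image \<Lambda>).
           \<rho> c = bending_matrix n t ** holonomy \<Lambda> p c ** matrix_inv (bending_matrix n t)))"

definition components_of_tiling ::
  "'n::{finite,linorder} sqmat set \<Rightarrow> 'n rvec set set set" where
  "components_of_tiling \<Lambda> =
     connected_components_of (subtopology proj_space (Omega0 - (\<Union>A\<in>\<Lambda>. act A ` Hyp)))"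

definition borders_Hyp :: "'n::{finite,linorder} rvec set set \<Rightarrow> bool" where
  "borders_Hyp C \<longleftrightarrow> Hyp \<subseteq> (subtopology proj_space Omega0) closure_of C"

definition nonseparating_bending ::
  "nat \<Rightarrow> real \<Rightarrow> 'n::{finite,linorder} sqmat set \<Rightarrow> 'n rvec set \<Rightarrow>
     ((real \<Rightarrow> 'n rvec set set) set \<Rightarrow> 'n sqmat) \<Rightarrow> bool" where
  "nonseparating_bending n t \<Lambda> p \<rho> \<longleftrightarrow>
     connected_space (complement_N0 \<Lambda>) \<and>
     (\<exists>C \<alpha>. C \<in> components_of_tiling \<Lambda> \<and> \<alpha> \<in> carrier (pi1_M0 \<Lambda> p) \<and>
        act (holonomy \<Lambda> p \<alpha>) ` C \<noteq> C \<and>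
        borders_Hyp C \<and> borders_Hyp (act (holonomy \<Lambda> p \<alpha>) ` C) \<and>
        (\<forall>c \<in> carrier (pi1_M0 \<Lambda> p). act (holonomy \<Lambda> p c) ` C = C \<longrightarrow> \<rho> c = holonomy \<Lambda> p c) \<and>
        \<rho> \<alpha> = bending_matrix n t ** holonomy \<Lambda> p \<alpha>)"

definition bent_representation ::
  "nat \<Rightarrow> real \<Rightarrow> 'n::{finite,linorder} sqmat set \<Rightarrow> 'n rvec set \<Rightarrow>
     ((real \<Rightarrow> 'n rvec set set) set \<Rightarrow> 'n sqmat) \<Rightarrow> bool" where
  "bent_representation n t \<Lambda> p \<rho> \<longleftrightarrow>
     \<rho> \<in> hom (pi1_M0 \<Lambda> p) SL \<and>
     (separating_bending n t \<Lambda> p \<rho> \<or> nonseparating_bending n t \<Lambda> p \<rho>)"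

end

(* The bent group preserves a sign: for vectors x, x', y in the future light cone over the wall
   H = {x_1 = 0}, the products <y, M x> <y, M x'> in the Lorentz form are nonnegative for every
   bent matrix M.  This is shown along the geodesic from p to gamma p, by pushing the functional
   <y, .> across the successive translates of H that it crosses: they are disjoint, hence nested,
   and a bend scales such a wall and its normal by positive factors.  A lattice cannot preserve
   such a sign, because by Selberg's recurrence argument it contains matrices which, up to scaling,
   are arbitrarily close to the projection to any prescribed coordinate axis. *)

theory Submission
  imports Defs
begin

section \<open>Recurrence for lattices\<close>

text \<open>The bent representation is prescribed only on the pieces of a splitting, while the sign
  has to be controlled for every group element. The bridge is a factorization r (A^{-1} B) = a
  (A^{-1} B) b with a, b positive diagonal, valid whenever the walls of A and B coincide or border a
  common tile; both kinds of bending yield it. The element \<gamma> is then reached through the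
  consecutive walls met by the segment from p to \<gamma> p. A bound on the cone over the current
  wall alone is not inductive, since the cone over the next wall sticks out of the hyperplane of the
  current one. The value on the forward normal is therefore carried along, and nestedness serves to
  make the normal coefficients nonnegative. The vectors finally tested are e_{n+1} + e_k/2 and
  e_{n+1} - e_k/2 with k neither the first nor the last index, which is where n \<ge> 2 enters: both
  lie over the wall, but the projection to the axis k sends them to opposite rays.\<close>

lemma SL_simps [simp]:
  "A \<in> carrier SL \<longleftrightarrow> det A = 1" "A \<otimes>\<^bsub>SL\<^esub> B = A ** B" "\<one>\<^bsub>SL\<^esub> = mat 1"
  by (simp_all add: SL_def)

lemma SL_matrix_inv:
  fixes A :: "'n::finite sqmat"
  assumes "det A = 1"
  shows "A ** matrix_inv A = mat 1" "matrix_inv A ** A = mat 1" "det (matrix_inv A) = 1"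
proof -
  have "invertible A" using assms by (simp add: invertible_det_nz)
  then show 1: "A ** matrix_inv A = mat 1" and "matrix_inv A ** A = mat 1"
    using someI_ex[of "\<lambda>B. A ** B = mat 1 \<and> B ** A = mat 1"]
    unfolding invertible_def matrix_inv_def by blast+
  have "det A * det (matrix_inv A) = 1" using 1 by (metis det_mul det_I)
  with assms show "det (matrix_inv A) = 1" by simp
qed

lemma group_SL: "group (SL :: 'n::finite sqmat monoid)"
proof (rule groupI)
  fix x :: "'n sqmat" assume "x \<in> carrier SL"
  then show "\<exists>y\<in>carrier SL. y \<otimes>\<^bsub>SL\<^esub> x = \<one>\<^bsub>SL\<^esub>"
    by (intro bexI[of _ "matrix_inv x"]) (auto simp: SL_matrix_inv)
qed (auto simp: det_mul matrix_mul_assoc)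

lemma continuous_on_matrix_mul [continuous_intros]:
  fixes f g :: "'a::topological_space \<Rightarrow> 'n::finite sqmat"
  assumes "continuous_on S f" "continuous_on S g"
  shows "continuous_on S (\<lambda>x. f x ** g x)"
  unfolding matrix_matrix_mult_def
  by (intro continuous_on_vec_lambda continuous_on_sum continuous_on_mult
      continuous_on_component assms)

lemma continuous_on_matrix_vec [continuous_intros]:
  fixes f :: "'a::topological_space \<Rightarrow> 'n::finite sqmat"
  assumes "continuous_on S f" "continuous_on S g"
  shows "continuous_on S (\<lambda>x. f x *v g x)"
  unfolding matrix_vector_mult_def
  by (intro continuous_on_vec_lambda continuous_on_sum continuous_on_mult
      continuous_on_component assms)

text \<open>Selberg's lemma: the translates \<open>g\<^sup>i U \<Gamma>\<close> have equal positive measure in \<open>G/\<Gamma>\<close>, so two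
  of them meet.\<close>

lemma lattice_recurrence:
  fixes \<Gamma> :: "'n::finite sqmat set"
  assumes lat: "lattice_in_SL \<Gamma>" and U: "openin (top_of_set (carrier SL)) U" "mat 1 \<in> U"
    and g: "det g = 1"
  obtains k u v \<gamma> where "k > 0" "u \<in> U" "v \<in> U" "\<gamma> \<in> \<Gamma>" "u ** \<gamma> = (g [^]\<^bsub>SL\<^esub> (k::nat)) ** v"
proof -
  interpret G: group "SL :: 'n sqmat monoid" by (rule group_SL)
  let ?X = "SL_mod \<Gamma>" and ?pi = "\<lambda>g. g <#\<^bsub>SL\<^esub> \<Gamma>"
  have sub: "subgroup \<Gamma> SL" using lat by (simp add: lattice_in_SL_def)
  obtain \<nu> where sets: "sets \<nu> = sigma_sets (topspace ?X) {U. openin ?X U}"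
    and nz: "emeasure \<nu> (space \<nu>) \<noteq> 0" and fin: "emeasure \<nu> (space \<nu>) \<noteq> \<infinity>"
    and inv: "\<And>g E. g \<in> carrier SL \<Longrightarrow> E \<in> sets \<nu> \<Longrightarrow> emeasure \<nu> ((\<lambda>c. g <#\<^bsub>SL\<^esub> c) ` E) = emeasure \<nu> E"
    using lat by (auto simp: lattice_in_SL_def)
  have top: "topspace ?X = ?pi ` carrier SL"
    by (simp add: SL_mod_def topspace_quotient_topology)
  \<comment> \<open>Only \<open>sets \<nu>\<close> is prescribed for the invariant measure; its
    space is recovered by comparison with the generated sigma-algebra.\<close>
  have "sets \<nu> = sets (sigma (topspace ?X) {U. openin ?X U})"
    unfolding sets by (subst sets_measure_of) (auto dest: openin_subset)
  then have "space \<nu> = space (sigma (topspace ?X) {U. openin ?X U})"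
    by (rule sets_eq_imp_space_eq)
  then have space: "space \<nu> = topspace ?X"
    by (simp add: space_measure_of_conv)
  have lself: "x \<in> ?pi x" for x
    using subgroup.one_closed[OF sub] by (force simp: l_coset_def)
  have opn: "?pi ` W \<in> sets \<nu>" if W: "openin (top_of_set (carrier SL)) W" for W
  proof -
    have Wsub: "W \<subseteq> carrier SL" using openin_imp_subset[OF W] .
    \<comment> \<open>The saturation of W is a union of right translates of W by elements of
      \<Gamma>, so the projection to the quotient is an open map.\<close>
    have eq: "{x \<in> carrier SL. ?pi x \<in> ?pi ` W} = (\<Union>\<gamma>\<in>\<Gamma>. {x \<in> carrier SL. x ** \<gamma> \<in> W})"
    proof (intro subset_antisym subsetI)
      fix x assume "x \<in> {x \<in> carrier SL. ?pi x \<in> ?pi ` W}"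
      then obtain w where w: "w \<in> W" "?pi x = ?pi w" and x: "x \<in> carrier SL" by auto
      have "w \<in> ?pi x" using w lself by simp
      then obtain \<gamma> where "\<gamma> \<in> \<Gamma>" "w = x ** \<gamma>" by (auto simp: l_coset_def)
      with w x show "x \<in> (\<Union>\<gamma>\<in>\<Gamma>. {x \<in> carrier SL. x ** \<gamma> \<in> W})" by auto
    next
      fix x assume "x \<in> (\<Union>\<gamma>\<in>\<Gamma>. {x \<in> carrier SL. x ** \<gamma> \<in> W})"
      then obtain \<gamma> where "\<gamma> \<in> \<Gamma>" "x \<in> carrier SL" "x ** \<gamma> \<in> W" by auto
      moreover have "x ** \<gamma> \<in> ?pi x" using \<open>\<gamma> \<in> \<Gamma>\<close> by (auto simp: l_coset_def)
      then have "?pi x = ?pi (x ** \<gamma>)"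
        using sub \<open>x \<in> carrier SL\<close> G.l_repr_independence by blast
      ultimately show "x \<in> {x \<in> carrier SL. ?pi x \<in> ?pi ` W}" by auto
    qed
    have "openin (top_of_set (carrier SL)) {x \<in> carrier SL. x ** \<gamma> \<in> W}" if "\<gamma> \<in> \<Gamma>" for \<gamma>
    proof -
      have "det \<gamma> = 1" using sub that subgroup.mem_carrier by fastforce
      have "continuous_map (top_of_set (carrier SL)) (top_of_set (carrier SL)) (\<lambda>x. x ** \<gamma>)"
        using \<open>det \<gamma> = 1\<close> by (auto simp: det_mul intro!: continuous_intros)
      from openin_continuous_map_preimage[OF this W] show ?thesis by simp
    qed
    then have "openin (top_of_set (carrier SL)) {x \<in> carrier SL. ?pi x \<in> ?pi ` W}"
      unfolding eq by blast
    then have "openin ?X (?pi ` W)"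
      using Wsub by (auto simp: SL_mod_def openin_quotient_topology)
    then show ?thesis unfolding sets by (auto intro: sigma_sets.Basic)
  qed
  have trans: "(\<lambda>c. h <#\<^bsub>SL\<^esub> c) ` ?pi ` W = ?pi ` ((\<lambda>w. h ** w) ` W)"
    if h: "h \<in> carrier SL" and W: "W \<subseteq> carrier SL" for h W
  proof -
    have "h <#\<^bsub>SL\<^esub> ?pi w = ?pi (h ** w)" if "w \<in> W" for w
      using G.lcos_m_assoc[of \<Gamma> h w] subgroup.subset[OF sub] that h W by auto
    then show ?thesis by (force simp: image_image)
  qed
  have opt: "openin (top_of_set (carrier SL)) ((\<lambda>w. h ** w) ` U)" if h: "h \<in> carrier SL" for h
  proof -
    have "det (matrix_inv h) = 1" using SL_matrix_inv h by simp
    then have "continuous_map (top_of_set (carrier SL)) (top_of_set (carrier SL)) (\<lambda>x. matrix_inv h ** x)"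
      by (auto simp: det_mul intro!: continuous_intros)
    from openin_continuous_map_preimage[OF this U(1)]
    have "openin (top_of_set (carrier SL)) {x \<in> carrier SL. matrix_inv h ** x \<in> U}" by simp
    moreover have "{x \<in> carrier SL. matrix_inv h ** x \<in> U} = (\<lambda>w. h ** w) ` U" (is "?l = ?r")
    proof (intro subset_antisym subsetI)
      fix x assume "x \<in> ?l"
      moreover have "x = h ** (matrix_inv h ** x)"
        using h by (simp add: matrix_mul_assoc SL_matrix_inv)
      ultimately show "x \<in> ?r" by blast
    next
      fix x assume "x \<in> ?r"
      then obtain w where "w \<in> U" "x = h ** w" by auto
      moreover have "matrix_inv h ** (h ** w) = w"
        using h by (simp add: matrix_mul_assoc SL_matrix_inv)
      moreover have "det w = 1" using openin_imp_subset[OF U(1)] \<open>w \<in> U\<close> by auto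
      ultimately show "x \<in> ?l" using h by (simp add: det_mul)
    qed
    ultimately show ?thesis by simp
  qed
  have Usub: "U \<subseteq> carrier SL" using openin_imp_subset[OF U(1)] .
  have meas: "emeasure \<nu> (?pi ` ((\<lambda>w. h ** w) ` U)) = emeasure \<nu> (?pi ` U)" if "h \<in> carrier SL" for h
    using inv[OF that opn[OF U(1)]] trans[OF that Usub] by simp
  have pos: "emeasure \<nu> (?pi ` U) \<noteq> 0"
  proof
    assume 0: "emeasure \<nu> (?pi ` U) = 0"
    \<comment> \<open>By Lindelof countably many translates of U cover the group, so a null image of
      U would make the whole quotient null.\<close>
    obtain F where F: "F \<subseteq> (\<lambda>h. (\<lambda>w. h ** w) ` U) ` carrier SL" "countable F"
      "\<Union>F = \<Union>((\<lambda>h. (\<lambda>w. h ** w) ` U) ` carrier SL)"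
      by (rule Lindelof_openin[of "(\<lambda>h. (\<lambda>w. h ** w) ` U) ` carrier SL" "carrier SL"])
        (use opt in auto)
    have "carrier SL \<subseteq> \<Union>F"
    proof
      fix x :: "'n sqmat" assume "x \<in> carrier SL"
      moreover have "x \<in> (\<lambda>w. x ** w) ` U"
        using U(2) by (intro image_eqI[of _ _ "mat 1"]) auto
      ultimately show "x \<in> \<Union>F" unfolding F(3) by blast
    qed
    then have "space \<nu> \<subseteq> (\<Union>V\<in>F. ?pi ` V)" unfolding space top by blast
    moreover have "(\<Union>V\<in>F. ?pi ` V) \<in> null_sets \<nu>"
    proof (rule null_sets_UN')
      fix V assume "V \<in> F"
      then obtain h where "h \<in> carrier SL" "V = (\<lambda>w. h ** w) ` U" using F(1) by auto
      then show "?pi ` V \<in> null_sets \<nu>" using meas[of h] 0 opn[OF opt[of h]] by auto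
    qed (use F in auto)
    ultimately have "emeasure \<nu> (space \<nu>) = 0"
      by (metis emeasure_mono le_zero_eq null_setsD1 null_setsD2)
    with nz show False by simp
  qed
  have gp: "g [^]\<^bsub>SL\<^esub> (i::nat) \<in> carrier SL" for i using G.nat_pow_closed g by simp
  define E where "E i = ?pi ` ((\<lambda>w. (g [^]\<^bsub>SL\<^esub> (i::nat)) ** w) ` U)" for i
  have "\<not> disjoint_family E"
  proof
    assume "disjoint_family E"
    moreover have "range E \<subseteq> sets \<nu>" using opn[OF opt[OF gp]] by (auto simp: E_def)
    ultimately have "(\<Sum>i. emeasure \<nu> (E i)) = emeasure \<nu> (\<Union>i. E i)"
      by (intro suminf_emeasure)
    moreover have "\<dots> \<le> emeasure \<nu> (space \<nu>)" by (rule emeasure_space)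
    moreover have "emeasure \<nu> (E i) = emeasure \<nu> (?pi ` U)" for i
      unfolding E_def by (rule meas[OF gp])
    ultimately have nt: "(\<Sum>i::nat. emeasure \<nu> (?pi ` U)) \<noteq> \<infinity>"
      using fin by (auto simp: top_unique)
    have "emeasure \<nu> (?pi ` U) \<noteq> \<infinity>"
      using fin emeasure_space[of \<nu> "?pi ` U"] by (auto simp: top_unique)
    then obtain r where r: "r \<ge> 0" "emeasure \<nu> (?pi ` U) = ennreal r"
      by (cases "emeasure \<nu> (?pi ` U)") auto
    then have "summable (\<lambda>i::nat. r)"
      using nt by (intro summable_suminf_not_top) auto
    then have "(\<lambda>i::nat. r) \<longlonglongrightarrow> 0" by (rule summable_LIMSEQ_zero)
    then show False using pos r by (simp add: LIMSEQ_const_iff)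
  qed
  then obtain i j where ij: "i < j" "E i \<inter> E j \<noteq> {}"
    unfolding disjoint_family_on_def by (metis Int_commute linorder_neqE_nat)
  then obtain u v where uv: "u \<in> U" "v \<in> U"
    "?pi ((g [^]\<^bsub>SL\<^esub> i) ** u) = ?pi ((g [^]\<^bsub>SL\<^esub> j) ** v)"
    by (auto simp: E_def)
  from lself[of "(g [^]\<^bsub>SL\<^esub> j) ** v"] obtain \<gamma> where \<gamma>: "\<gamma> \<in> \<Gamma>" "(g [^]\<^bsub>SL\<^esub> j) ** v = ((g [^]\<^bsub>SL\<^esub> i) ** u) ** \<gamma>"
    unfolding uv(3)[symmetric] by (auto simp: l_coset_def)
  have jj: "g [^]\<^bsub>SL\<^esub> j = (g [^]\<^bsub>SL\<^esub> i) ** (g [^]\<^bsub>SL\<^esub> (j - i))"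
    using G.nat_pow_mult[of g i "j - i"] g ij by simp
  have "matrix_inv (g [^]\<^bsub>SL\<^esub> i) ** (((g [^]\<^bsub>SL\<^esub> i) ** (g [^]\<^bsub>SL\<^esub> (j - i))) ** v)
      = matrix_inv (g [^]\<^bsub>SL\<^esub> i) ** (((g [^]\<^bsub>SL\<^esub> i) ** u) ** \<gamma>)"
    using \<gamma>(2) jj by simp
  then have "(g [^]\<^bsub>SL\<^esub> (j - i)) ** v = u ** \<gamma>"
    using SL_matrix_inv(2)[of "g [^]\<^bsub>SL\<^esub> i"] gp[of i] by (simp add: matrix_mul_assoc)
  with that[of "j - i" u v \<gamma>] uv \<gamma> ij show thesis by simp
qed

section \<open>The Lorentz form\<close>

text \<open>The polarization of \<open>qform\<close>: subtracting the last product twice from the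
  Euclidean inner product reverses its sign.\<close>

definition bil :: "'n::{finite,linorder} rvec \<Rightarrow> 'n rvec \<Rightarrow> real" where
  "bil x y = x \<bullet> y - 2 * (x $ ilast * y $ ilast)"

definition spatial :: "'n::{finite,linorder} rvec \<Rightarrow> 'n rvec" where
  "spatial x = x - (x $ ilast) *\<^sub>R axis ilast 1"

lemma bil_simps:
  "bil (x + y) z = bil x z + bil y z" "bil z (x + y) = bil z x + bil z y"
  "bil (x - y) z = bil x z - bil y z" "bil z (x - y) = bil z x - bil z y"
  "bil (r *\<^sub>R x) z = r * bil x z" "bil z (r *\<^sub>R x) = r * bil z x"
  "bil (- x) z = - bil x z" "bil z (- x) = - bil z x" "bil 0 z = 0" "bil z 0 = 0"
  by (simp_all add: bil_def algebra_simps)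

lemma bil_commute: "bil x y = bil y x"
  by (simp add: bil_def inner_commute mult.commute)

lemma qform_eq_bil: "qform x = bil x x"
proof -
  have "x \<bullet> x = (\<Sum>i\<in>UNIV. (x $ i)\<^sup>2)"
    by (simp add: inner_vec_def power2_eq_square)
  also have "\<dots> = (x $ ilast)\<^sup>2 + (\<Sum>i\<in>UNIV - {ilast}. (x $ i)\<^sup>2)"
    by (rule sum.remove) auto
  finally show ?thesis by (simp add: qform_def bil_def power2_eq_square)
qed

lemma inner_spatial: "spatial x \<bullet> spatial y = x \<bullet> y - x $ ilast * y $ ilast"
  by (simp add: spatial_def inner_diff_left inner_diff_right inner_axis inner_axis'
      inner_axis_axis algebra_simps)

lemma bil_spatial: "bil x y = spatial x \<bullet> spatial y - x $ ilast * y $ ilast"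
  by (simp add: inner_spatial bil_def)

lemma qform_spatial: "qform x = (norm (spatial x))\<^sup>2 - (x $ ilast)\<^sup>2"
  unfolding power2_norm_eq_inner by (simp add: qform_eq_bil bil_spatial power2_eq_square)

lemma spatial_eq_0: "spatial x = 0 \<Longrightarrow> x = (x $ ilast) *\<^sub>R axis ilast 1"
  by (simp add: spatial_def)

lemma qform_scaleR: "qform (r *\<^sub>R x) = r\<^sup>2 * qform x"
  by (simp add: qform_eq_bil bil_simps power2_eq_square)

lemma bil_axis: "i \<noteq> ilast \<Longrightarrow> bil (axis i 1) x = x $ i"
  by (simp add: bil_def inner_axis') (simp add: axis_def)

lemma SO_q_bil:
  assumes "A \<in> SO_q"
  shows "bil (A *v x) (A *v y) = bil x y"
proof -
  have q: "qform (A *v z) = qform z" for z using assms by (simp add: SO_q_def)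
  have "bil (A *v (x + y)) (A *v (x + y)) = bil (x + y) (x + y)"
    using q[of "x + y"] by (simp add: qform_eq_bil)
  then show ?thesis
    using q[of x] q[of y]
    by (simp add: qform_eq_bil bil_simps matrix_vector_right_distrib bil_commute[of y x]
        bil_commute[of "A *v y" "A *v x"])
qed

lemma SO_q_qform: "A \<in> SO_q \<Longrightarrow> qform (A *v x) = qform x"
  by (simp add: SO_q_def)

section \<open>The closed future cone and the Klein ball\<close>

definition fut :: "'n::{finite,linorder} rvec set" where
  "fut = {z. qform z \<le> 0 \<and> z $ ilast \<ge> 0}"

lemma spatial_le_fut: "z \<in> fut \<Longrightarrow> norm (spatial z) \<le> z $ ilast"
  by (rule power2_le_imp_le) (auto simp: fut_def qform_spatial)

lemma futI: "norm (spatial z) \<le> z $ ilast \<Longrightarrow> z \<in> fut"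
  using power_mono[of "norm (spatial z)" "z $ ilast" 2] order_trans[OF norm_ge_zero, of "spatial z" "z $ ilast"]
  by (simp add: fut_def qform_spatial)

lemma fut_iff: "z \<in> fut \<longleftrightarrow> norm (spatial z) \<le> z $ ilast"
  using futI spatial_le_fut by blast

lemma spatial_add: "spatial (x + y) = spatial x + spatial y"
  and spatial_scaleR: "spatial (r *\<^sub>R x) = r *\<^sub>R spatial x"
  by (simp_all add: spatial_def algebra_simps)

lemma fut_add: "x \<in> fut \<Longrightarrow> y \<in> fut \<Longrightarrow> x + y \<in> fut"
  using norm_triangle_ineq[of "spatial x" "spatial y"] by (simp add: fut_iff spatial_add)

lemma fut_scaleR: "x \<in> fut \<Longrightarrow> r \<ge> 0 \<Longrightarrow> r *\<^sub>R x \<in> fut"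
  by (simp add: fut_iff spatial_scaleR mult_left_mono)

text \<open>Cauchy-Schwarz for the spatial parts, whose norms are bounded by the last
  coordinates.\<close>

lemma bil_fut_nonpos:
  assumes "x \<in> fut" "y \<in> fut"
  shows "bil x y \<le> 0"
proof -
  have "spatial x \<bullet> spatial y \<le> norm (spatial x) * norm (spatial y)" by (rule norm_cauchy_schwarz)
  also have "\<dots> \<le> x $ ilast * y $ ilast"
    using assms by (intro mult_mono) (auto simp: fut_iff intro: order_trans[OF norm_ge_zero])
  finally show ?thesis by (simp add: bil_spatial)
qed

text \<open>The affine chart of hyperbolic space. Each line of \<open>Omega0\<close> is represented
  by one vector of a convex set, so segments, straight-line homotopies and continuity can be handled
  in a vector space.\<close>

definition kk :: "'n::{finite,linorder} rvec set" where
  "kk = {x. x $ ilast = 1 \<and> qform x < 0}"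

lemma kk_iff: "x \<in> kk \<longleftrightarrow> x $ ilast = 1 \<and> norm (spatial x) < 1"
  by (auto simp: kk_def qform_spatial abs_square_less_1)

lemma kk_subset_fut: "kk \<subseteq> fut"
  by (auto simp: kk_iff fut_iff)

lemma convex_kk: "convex (kk :: 'n::{finite,linorder} rvec set)"
proof (rule convexI)
  fix x y :: "'n rvec" and u v :: real
  assume *: "x \<in> kk" "y \<in> kk" "0 \<le> u" "0 \<le> v" "u + v = 1"
  have "norm (spatial (u *\<^sub>R x + v *\<^sub>R y)) \<le> u * norm (spatial x) + v * norm (spatial y)"
    using norm_triangle_ineq[of "u *\<^sub>R spatial x" "v *\<^sub>R spatial y"] *
    by (simp add: spatial_add spatial_scaleR)
  also have "\<dots> < 1"
    using * by (intro convex_bound_lt) (auto simp: kk_iff)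
  finally show "u *\<^sub>R x + v *\<^sub>R y \<in> kk" using * by (simp add: kk_iff)
qed

lemma bil_kk_fut_neg:
  assumes "x \<in> kk" "y \<in> fut" "y \<noteq> 0"
  shows "bil x y < 0"
proof -
  have "y $ ilast \<noteq> 0"
  proof
    assume "y $ ilast = 0"
    moreover from this have "spatial y = 0" using assms by (simp add: fut_iff)
    ultimately show False using spatial_eq_0[of y] assms by simp
  qed
  then have pos: "y $ ilast > 0" using assms by (simp add: fut_def)
  have "spatial x \<bullet> spatial y \<le> norm (spatial x) * norm (spatial y)" by (rule norm_cauchy_schwarz)
  also have "\<dots> \<le> norm (spatial x) * y $ ilast"
    using assms by (intro mult_left_mono) (auto simp: fut_iff)
  also have "\<dots> < 1 * y $ ilast"
    using assms pos by (intro mult_strict_right_mono) (auto simp: kk_iff)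
  finally show ?thesis using assms by (simp add: bil_spatial kk_iff)
qed

text \<open>If z were not spacelike, z or -z would be a nonzero future vector, and its pairing with
  x would be strictly negative.\<close>

lemma kk_orthogonal:
  assumes "x \<in> kk" "bil x z = 0" "z \<noteq> 0"
  shows "qform z > 0"
proof (rule ccontr)
  assume "\<not> qform z > 0"
  then have "z \<in> fut \<or> - z \<in> fut"
    by (auto simp: fut_def qform_eq_bil bil_simps)
  then show False using bil_kk_fut_neg[OF assms(1), of z] bil_kk_fut_neg[OF assms(1), of "- z"] assms
    by (auto simp: bil_simps)
qed

text \<open>\<open>mform x\<close> is a positive definite form depending equivariantly on the timelike vector \<open>x\<close>.\<close>

definition mform :: "'n::{finite,linorder} rvec \<Rightarrow> 'n rvec \<Rightarrow> real" where
  "mform x z = - qform x * qform z + 2 * (bil x z)\<^sup>2"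

lemma mform_SO_q: "A \<in> SO_q \<Longrightarrow> mform (A *v x) (A *v z) = mform x z"
  by (simp add: mform_def SO_q_bil SO_q_qform)

lemma mform_scaleR: "mform (r *\<^sub>R x) z = r\<^sup>2 * mform x z" "mform x (r *\<^sub>R z) = r\<^sup>2 * mform x z"
  by (simp_all add: mform_def qform_scaleR bil_simps power_mult_distrib algebra_simps)

lemma mform_pos:
  assumes "x \<in> kk" "z \<noteq> 0"
  shows "mform x z > 0"
proof -
  have qx: "qform x < 0" using assms by (simp add: kk_def)
  \<comment> \<open>Split off the component along x. The part w is spacelike or zero, and
    \<open>mform x z\<close> becomes -q(x) q(w) + (bil x z)^2, a sum of nonnegative terms that do
    not both vanish.\<close>
  define w where "w = z - (bil x z / qform x) *\<^sub>R x"
  have w: "bil x w = 0" using qx by (simp add: w_def bil_simps qform_eq_bil)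
  have z: "z = w + (bil x z / qform x) *\<^sub>R x" by (simp add: w_def)
  have "qform z = qform w + (bil x z / qform x)\<^sup>2 * qform x"
    using w by (subst z) (simp add: qform_eq_bil bil_simps bil_commute[of w x] power2_eq_square)
  then have m: "mform x z = - qform x * qform w + (bil x z)\<^sup>2"
    using qx by (simp add: mform_def field_simps power2_eq_square)
  show ?thesis
  proof (cases "w = 0")
    case True
    then have "bil x z \<noteq> 0" using z assms by auto
    then show ?thesis using True m by (simp add: qform_eq_bil bil_simps)
  next
    case False
    then have "qform w > 0" using kk_orthogonal[OF assms(1) w] by simp
    then have "- qform x * qform w > 0" using qx by (simp add: mult_neg_pos)
    then show ?thesis unfolding m by (smt (verit) zero_le_power2)
  qed
qed

lemma continuous_on_qform [continuous_intros]:
  "continuous_on S f \<Longrightarrow> continuous_on S (\<lambda>x. qform (f x))"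
  unfolding qform_eq_bil bil_def by (intro continuous_intros)

lemma continuous_on_bil [continuous_intros]:
  "continuous_on S f \<Longrightarrow> continuous_on S g \<Longrightarrow> continuous_on S (\<lambda>x. bil (f x) (g x))"
  unfolding bil_def by (intro continuous_intros)

section \<open>The projective action on the affine chart\<close>

text \<open>The projective action read in the chart. The divisor may be negative, because elements
  of \<open>SO_q\<close> can exchange the two sheets of the cone.\<close>

definition pact :: "'n::{finite,linorder} sqmat \<Rightarrow> 'n rvec \<Rightarrow> 'n rvec" where
  "pact A x = (1 / (A *v x) $ ilast) *\<^sub>R (A *v x)"

lemma SO_q_last_nonzero:
  assumes "A \<in> SO_q" "x \<in> kk"
  shows "(A *v x) $ ilast \<noteq> 0"
proof
  assume "(A *v x) $ ilast = 0"
  then have "qform (A *v x) \<ge> 0" by (simp add: qform_spatial)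
  then show False using assms by (simp add: SO_q_qform kk_def)
qed

lemma mult_pact:
  "A \<in> SO_q \<Longrightarrow> x \<in> kk \<Longrightarrow> A *v x = ((A *v x) $ ilast) *\<^sub>R pact A x"
  by (simp add: pact_def SO_q_last_nonzero)

lemma pact_in_kk [simp]:
  assumes "A \<in> SO_q" "x \<in> kk"
  shows "pact A x \<in> kk"
  using SO_q_last_nonzero[OF assms] assms
  by (simp add: kk_def pact_def qform_scaleR SO_q_qform mult_pos_neg)

lemma pact_one [simp]: "x \<in> kk \<Longrightarrow> pact (mat 1) x = x"
  by (simp add: pact_def kk_def)

lemma pact_scaleR: "r \<noteq> 0 \<Longrightarrow> pact A (r *\<^sub>R x) = pact A x"
  by (simp add: pact_def matrix_vector_mult_scaleR)

lemma pact_mult: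
  assumes "B \<in> SO_q" "x \<in> kk"
  shows "pact A (pact B x) = pact (A ** B) x"
proof -
  have "pact A (pact B x) = pact A (B *v x)"
    unfolding pact_def[of B] using SO_q_last_nonzero[OF assms] by (subst pact_scaleR) auto
  then show ?thesis by (simp add: pact_def matrix_vector_mul_assoc)
qed

lemma continuous_on_pact: "A \<in> SO_q \<Longrightarrow> continuous_on kk (pact A)"
  unfolding pact_def by (intro continuous_intros) (auto dest: SO_q_last_nonzero)

lemma span_eq_iff_kk:
  assumes "x \<in> kk" "y \<in> kk"
  shows "span {x} = span {y} \<longleftrightarrow> x = y"
proof
  assume "span {x} = span {y}"
  then have "x \<in> span {y}" by (metis span_base insertI1)
  then obtain k where "x = k *\<^sub>R y" by (auto simp: span_singleton)
  then show "x = y" using assms by (auto simp: kk_def)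
qed simp

lemma act_span: "act A (span {x}) = span {A *v x}"
  by (auto simp: act_def span_singleton image_image matrix_vector_mult_scaleR)

lemma span_scaleR: "r \<noteq> 0 \<Longrightarrow> span {r *\<^sub>R x} = span {x :: 'a::real_vector}"
proof -
  assume r: "r \<noteq> 0"
  show ?thesis
  proof (intro subset_antisym span_minimal subspace_span)
    show "{r *\<^sub>R x} \<subseteq> span {x}" by (simp add: span_base span_scale)
    have "(1 / r) *\<^sub>R (r *\<^sub>R x) \<in> span {r *\<^sub>R x}" by (intro span_scale span_base) simp
    then show "{x} \<subseteq> span {r *\<^sub>R x}" using r by simp
  qed
qed

lemma act_span_pact:
  "A \<in> SO_q \<Longrightarrow> x \<in> kk \<Longrightarrow> act A (span {x}) = span {pact A x}"
  unfolding act_span pact_def by (simp add: span_scaleR SO_q_last_nonzero)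

lemma Omega0_eq: "(Omega0 :: 'n::{finite,linorder} rvec set set) = (\<lambda>x. span {x}) ` kk"
proof (intro subset_antisym subsetI)
  fix L :: "'n rvec set" assume "L \<in> Omega0"
  then obtain x where x: "L = span {x}" "qform x < 0" by (auto simp: Omega0_def)
  then have "x $ ilast \<noteq> 0" by (auto simp: qform_spatial)
  then have "(1 / x $ ilast) *\<^sub>R x \<in> kk" "L = span {(1 / x $ ilast) *\<^sub>R x}"
    using x by (auto simp: kk_def qform_scaleR span_scaleR mult_pos_neg)
  then show "L \<in> (\<lambda>x. span {x}) ` kk" by blast
qed (auto simp: Omega0_def kk_def)

section \<open>Integral matrices and proper discontinuity\<close>

lemma bounded_integer_matrices_finite:
  "finite {A :: 'n::finite sqmat. (\<forall>i j. A $ i $ j \<in> \<int>) \<and> (\<forall>i j. \<bar>A $ i $ j\<bar> \<le> r)}"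
proof -
  let ?I = "{k :: real. k \<in> \<int> \<and> \<bar>k\<bar> \<le> r}"
  let ?F = "\<lambda>f :: 'n \<Rightarrow> 'n \<Rightarrow> real. (\<chi> i j. f i j) :: 'n sqmat"
  have "finite ?I" by (rule finite_abs_int_segment)
  then have "finite (PiE UNIV (\<lambda>i::'n. PiE UNIV (\<lambda>j::'n. ?I)))"
    by (intro finite_PiE) auto
  then have "finite (?F ` (PiE UNIV (\<lambda>i::'n. PiE UNIV (\<lambda>j::'n. ?I))))" by blast
  moreover have "{A :: 'n sqmat. (\<forall>i j. A $ i $ j \<in> \<int>) \<and> (\<forall>i j. \<bar>A $ i $ j\<bar> \<le> r)}
      \<subseteq> ?F ` (PiE UNIV (\<lambda>i::'n. PiE UNIV (\<lambda>j::'n. ?I)))"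
  proof
    fix A :: "'n sqmat" assume "A \<in> {A. (\<forall>i j. A $ i $ j \<in> \<int>) \<and> (\<forall>i j. \<bar>A $ i $ j\<bar> \<le> r)}"
    then show "A \<in> ?F ` (PiE UNIV (\<lambda>i::'n. PiE UNIV (\<lambda>j::'n. ?I)))"
      by (intro image_eqI[of _ _ "\<lambda>i j. A $ i $ j"]) (auto simp: vec_eq_iff)
  qed
  ultimately show ?thesis by (rule finite_subset[rotated])
qed

text \<open>On the compact K the forms \<open>mform x\<close> are uniformly comparable to the
  squared Euclidean norm. Equivariance compares the form at x with the form at its image, both in K,
  which bounds the operator norm of A; integrality then leaves finitely many matrices.\<close>

lemma finite_return:
  fixes K :: "'n::{finite,linorder} rvec set"
  assumes K: "compact K" "K \<subseteq> kk" "K \<noteq> {}"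
  shows "finite {A \<in> SL_int \<inter> SO_q. \<exists>x\<in>K. pact A x \<in> K}"
proof -
  let ?S = "sphere (0 :: 'n rvec) 1"
  have cont: "continuous_on (K \<times> ?S) (\<lambda>p. mform (fst p) (snd p))"
    unfolding mform_def by (intro continuous_intros)
  have comp: "compact (K \<times> ?S)" by (intro compact_Times K compact_sphere)
  have "?S \<noteq> {}" by (metis empty_iff norm_axis_1 mem_sphere_0)
  then have ne: "K \<times> ?S \<noteq> {}" using K by auto
  obtain p where p: "p \<in> K \<times> ?S" "\<And>r. r \<in> K \<times> ?S \<Longrightarrow> mform (fst p) (snd p) \<le> mform (fst r) (snd r)"
    using continuous_attains_inf[OF comp ne cont] by blast
  obtain p' where p': "p' \<in> K \<times> ?S" "\<And>r. r \<in> K \<times> ?S \<Longrightarrow> mform (fst p') (snd p') \<ge> mform (fst r) (snd r)"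
    using continuous_attains_sup[OF comp ne cont] by blast
  define c C where "c = mform (fst p) (snd p)" and "C = mform (fst p') (snd p')"
  have c: "c > 0" unfolding c_def using p K by (intro mform_pos) auto
  have hom: "mform x z = (norm z)\<^sup>2 * mform x ((1 / norm z) *\<^sub>R z)" if "z \<noteq> 0" for x z :: "'n rvec"
    using that by (simp add: mform_scaleR power_divide)
  have lo: "c * (norm z)\<^sup>2 \<le> mform x z" if "x \<in> K" for x z
  proof (cases "z = 0")
    case False
    then show ?thesis
      using p(2)[of "(x, (1 / norm z) *\<^sub>R z)"] that hom[of z x]
      by (simp add: c_def mult.commute mult_left_mono)
  qed (simp add: mform_def bil_simps qform_eq_bil)
  have hi: "mform x z \<le> C * (norm z)\<^sup>2" if "x \<in> K" for x z
  proof (cases "z = 0")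
    case False
    then show ?thesis
      using p'(2)[of "(x, (1 / norm z) *\<^sub>R z)"] that hom[of z x]
      by (simp add: C_def mult.commute mult_left_mono)
  qed (simp add: mform_def bil_simps qform_eq_bil)
  have cq: "continuous_on K qform" by (intro continuous_intros)
  obtain a where a: "a \<in> K" "\<And>y. y \<in> K \<Longrightarrow> qform a \<le> qform y"
    using continuous_attains_inf[OF K(1,3) cq] by blast
  obtain b where b: "b \<in> K" "\<And>y. y \<in> K \<Longrightarrow> qform y \<le> qform b"
    using continuous_attains_sup[OF K(1,3) cq] by blast
  have neg: "qform a < 0" "qform b < 0" using a b K by (auto simp: kk_def)
  \<comment> \<open>For k the last coordinate of A x, invariance gives q(x) = k^2 q(pact A x). So
    k^2 is a quotient of two values of q on K, and m is a lower bound for such quotients.\<close>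
  define m where "m = qform b / qform a"
  have m: "m > 0" using neg by (simp add: m_def divide_neg_neg)
  define R where "R = sqrt (C / (c * m))"
  have bound: "norm (A *v z) \<le> R * norm z" if A: "A \<in> SO_q" "x \<in> K" "pact A x \<in> K" for A x z
  proof -
    define k where "k = (A *v x) $ ilast"
    have kk: "A *v x = k *\<^sub>R pact A x" unfolding k_def using A K by (intro mult_pact) auto
    have "qform x = k\<^sup>2 * qform (pact A x)"
      using SO_q_qform[OF A(1), of x] by (simp add: kk qform_scaleR)
    moreover have "k\<^sup>2 * qform a \<le> k\<^sup>2 * qform (pact A x)"
      using a(2)[OF A(3)] by (intro mult_left_mono) auto
    ultimately have "k\<^sup>2 * qform a \<le> qform b" using b(2)[OF A(2)] by simp
    then have k: "m \<le> k\<^sup>2" using neg by (simp add: m_def neg_divide_le_eq)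
    have "m * (c * (norm (A *v z))\<^sup>2) \<le> k\<^sup>2 * mform (pact A x) (A *v z)"
      using k lo[OF A(3)] c m by (intro mult_mono) auto
    also have "\<dots> = mform x z" using mform_SO_q[OF A(1), of x z] by (simp add: kk mform_scaleR)
    also have "\<dots> \<le> C * (norm z)\<^sup>2" by (rule hi[OF A(2)])
    finally have "(norm (A *v z))\<^sup>2 \<le> C / (c * m) * (norm z)\<^sup>2"
      using c m by (simp add: field_simps)
    then have "sqrt ((norm (A *v z))\<^sup>2) \<le> sqrt (C / (c * m) * (norm z)\<^sup>2)" by (rule real_sqrt_le_mono)
    then show ?thesis unfolding R_def real_sqrt_mult[of _ "(norm z)\<^sup>2"] by simp
  qed
  have "{A \<in> SL_int \<inter> SO_q. \<exists>x\<in>K. pact A x \<in> K} \<subseteq>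
      {A :: 'n sqmat. (\<forall>i j. A $ i $ j \<in> \<int>) \<and> (\<forall>i j. \<bar>A $ i $ j\<bar> \<le> R)}"
  proof safe
    fix A :: "'n sqmat" and i j x assume A: "A \<in> SL_int" "A \<in> SO_q" "x \<in> K" "pact A x \<in> K"
    show "A $ i $ j \<in> \<int>" using A by (simp add: SL_int_def)
    have "\<bar>A $ i $ j\<bar> = \<bar>(A *v axis j 1) $ i\<bar>"
      by (simp add: matrix_vector_mult_basis column_def)
    also have "\<dots> \<le> norm (A *v axis j 1)" by (rule component_le_norm_cart)
    also have "\<dots> \<le> R" using bound[OF A(2,3,4), of "axis j 1"] by (simp add: norm_axis_1)
    finally show "\<bar>A $ i $ j\<bar> \<le> R" .
  qed
  then show ?thesis by (rule finite_subset) (rule bounded_integer_matrices_finite)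
qed

section \<open>Discrete groups and the quotient map\<close>

locale hyp_group =
  fixes \<Lambda> :: "'n::{finite,linorder} sqmat set"
  assumes sub: "\<Lambda> \<subseteq> SL_int \<inter> SO_q"
    and one: "mat 1 \<in> \<Lambda>"
    and mult: "A \<in> \<Lambda> \<Longrightarrow> B \<in> \<Lambda> \<Longrightarrow> A ** B \<in> \<Lambda>"
    and inv: "A \<in> \<Lambda> \<Longrightarrow> matrix_inv A \<in> \<Lambda>"
    and tors: "torsion_free SL \<Lambda>"
begin

lemma SO: "A \<in> \<Lambda> \<Longrightarrow> A \<in> SO_q"
  and detA: "A \<in> \<Lambda> \<Longrightarrow> det A = 1"
  using sub by (auto simp: SL_int_def)

lemma inv_right: "A \<in> \<Lambda> \<Longrightarrow> A ** matrix_inv A = mat 1"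
  and inv_left: "A \<in> \<Lambda> \<Longrightarrow> matrix_inv A ** A = mat 1"
  by (simp_all add: SL_matrix_inv detA)

lemma inv_right_v: "A \<in> \<Lambda> \<Longrightarrow> A *v (matrix_inv A *v x) = x"
  and inv_left_v: "A \<in> \<Lambda> \<Longrightarrow> matrix_inv A *v (A *v x) = x"
  by (simp_all add: matrix_vector_mul_assoc inv_right inv_left)

lemma pact_inv_right: "A \<in> \<Lambda> \<Longrightarrow> x \<in> kk \<Longrightarrow> pact A (pact (matrix_inv A) x) = x"
  and pact_inv_left: "A \<in> \<Lambda> \<Longrightarrow> x \<in> kk \<Longrightarrow> pact (matrix_inv A) (pact A x) = x"
  by (simp_all add: pact_mult inv_right inv_left inv SO)

text \<open>All powers of A fix x, and \<open>finite_return\<close> for the one-point set leaves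
  only finitely many of them. Hence two powers coincide, A has finite order, and torsion-freeness
  applies.\<close>

lemma free:
  assumes "A \<in> \<Lambda>" "x \<in> kk" "pact A x = x"
  shows "A = mat 1"
proof -
  interpret G: group "SL :: 'n sqmat monoid" by (rule group_SL)
  define p where "p k = A [^]\<^bsub>SL\<^esub> (k::nat)" for k
  have p: "p k \<in> \<Lambda> \<and> pact (p k) x = x" for k
  proof (induction k)
    case 0
    then show ?case using one assms by (simp add: p_def)
  next
    case (Suc k)
    have "p (Suc k) = p k ** A" by (simp add: p_def)
    moreover have "pact (p k ** A) x = pact (p k) (pact A x)"
      using pact_mult[of A x "p k"] assms SO by simp
    ultimately show ?case using Suc assms mult by simp
  qed
  have "finite {A \<in> SL_int \<inter> SO_q. \<exists>y\<in>{x}. pact A y \<in> {x}}"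
    using assms by (intro finite_return) auto
  moreover have "range p \<subseteq> {A \<in> SL_int \<inter> SO_q. \<exists>y\<in>{x}. pact A y \<in> {x}}"
    using p sub by auto
  ultimately have "finite (range p)" by (rule finite_subset[rotated])
  then have "\<not> inj p" using finite_imageD[of p UNIV] by auto
  then obtain i j where ij: "i < j" "p i = p j"
    by (metis injI linorder_neqE_nat)
  have car: "A \<in> carrier SL" using assms detA by simp
  have "p j = p i \<otimes>\<^bsub>SL\<^esub> p (j - i)"
    unfolding p_def using G.nat_pow_mult[OF car, of i "j - i"] ij by simp
  then have "p (j - i) = \<one>\<^bsub>SL\<^esub>"
    using ij(2) G.nat_pow_closed[OF car] unfolding p_def
    by (metis G.l_cancel_one')
  then have "A = \<one>\<^bsub>SL\<^esub>"
    using tors assms(1) ij unfolding torsion_free_def p_def by (metis zero_less_diff)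
  then show ?thesis by simp
qed

lemma pact_eq_imp:
  assumes "A \<in> \<Lambda>" "B \<in> \<Lambda>" "x \<in> kk" "pact A x = pact B x"
  shows "A = B"
proof -
  have "pact (matrix_inv B ** A) x = x"
    using assms by (metis SO pact_mult pact_inv_left)
  then have "matrix_inv B ** A = mat 1" using free mult inv assms by blast
  then have "B ** (matrix_inv B ** A) = B" by simp
  then show ?thesis using inv_right assms by (simp add: matrix_mul_assoc)
qed

lemma open_pact_image:
  assumes "A \<in> \<Lambda>" "openin (top_of_set kk) U"
  shows "openin (top_of_set kk) (pact A ` U)"
proof -
  have "continuous_map (top_of_set kk) (top_of_set kk) (pact (matrix_inv A))"
    using continuous_on_pact[of "matrix_inv A"] assms inv SO by auto
  from openin_continuous_map_preimage[OF this assms(2)]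
  have "openin (top_of_set kk) {x \<in> kk. pact (matrix_inv A) x \<in> U}" by simp
  moreover have "{x \<in> kk. pact (matrix_inv A) x \<in> U} = pact A ` U"
  proof (intro subset_antisym subsetI)
    fix x assume "x \<in> {x \<in> kk. pact (matrix_inv A) x \<in> U}"
    then show "x \<in> pact A ` U"
      using pact_inv_right[OF assms(1)] by (metis (mono_tags, lifting) image_eqI mem_Collect_eq)
  next
    fix x assume "x \<in> pact A ` U"
    then obtain u where "u \<in> U" "x = pact A u" by auto
    moreover have "u \<in> kk" using \<open>u \<in> U\<close> openin_imp_subset[OF assms(2)] by auto
    ultimately show "x \<in> {x \<in> kk. pact (matrix_inv A) x \<in> U}"
      using assms SO pact_inv_left by auto
  qed
  ultimately show ?thesis by simp
qed

text \<open>Only finitely many nontrivial elements return to a small compact ball around x. Each of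
  them moves x by freeness, so the ball can be shrunk to a neighbourhood disjoint from its
  images.\<close>

lemma wandering:
  assumes "x \<in> kk"
  obtains U where "openin (top_of_set kk) U" "x \<in> U"
    "\<And>A u. A \<in> \<Lambda> \<Longrightarrow> u \<in> U \<Longrightarrow> pact A u \<in> U \<Longrightarrow> A = mat 1"
proof -
  have norm_lt: "norm (spatial x) < 1" using assms by (simp add: kk_iff)
  \<comment> \<open>Half the distance to the boundary sphere, so that the closed ball of radius r in
    the chart stays inside \<open>kk\<close>.\<close>
  define r where "r = (1 - norm (spatial x)) / 2"
  define K where "K = cball x r \<inter> {y. y $ ilast = 1}"
  have r: "r > 0" using norm_lt by (simp add: r_def)
  have Kkk: "K \<subseteq> kk"
  proof
    fix y assume y: "y \<in> K"
    have "spatial y = spatial x + (y - x)"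
      using y assms by (simp add: spatial_def K_def kk_def)
    then have "norm (spatial y) \<le> norm (spatial x) + norm (y - x)"
      by (metis norm_triangle_ineq)
    also have "\<dots> \<le> norm (spatial x) + r"
      using y by (simp add: K_def dist_norm norm_minus_commute)
    also have "\<dots> < 1" using norm_lt by (simp add: r_def field_simps)
    finally show "y \<in> kk" using y by (simp add: kk_iff K_def)
  qed
  have "closed {y :: 'n rvec. y $ ilast = 1}"
    by (intro closed_Collect_eq continuous_intros)
  then have comp: "compact K" unfolding K_def by (intro compact_Int_closed compact_cball)
  have xK: "x \<in> K" using r assms by (simp add: K_def kk_def)
  define S where "S = {A \<in> \<Lambda>. A \<noteq> mat 1 \<and> (\<exists>y\<in>K. pact A y \<in> K)}"
  have "finite {A \<in> SL_int \<inter> SO_q. \<exists>y\<in>K. pact A y \<in> K}"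
    using xK by (intro finite_return comp Kkk) auto
  then have finS: "finite S"
    by (rule finite_subset[rotated]) (use sub in \<open>auto simp: S_def\<close>)
  have "\<exists>V. openin (top_of_set kk) V \<and> x \<in> V \<and> (\<forall>v\<in>V. pact A v \<notin> V)" if A: "A \<in> S" for A
  proof -
    have A': "A \<in> \<Lambda>" "A \<noteq> mat 1" using A by (auto simp: S_def)
    then have "pact A x \<noteq> x" using free assms by blast
    then obtain V W where VW: "open V" "open W" "pact A x \<in> V" "x \<in> W" "V \<inter> W = {}"
      using hausdorff by metis
    have "continuous_map (top_of_set kk) (top_of_set kk) (pact A)"
      using continuous_on_pact[OF SO[OF A'(1)]] SO A' by auto
    from openin_continuous_map_preimage[OF this, of "kk \<inter> V"]
    have "openin (top_of_set kk) {y \<in> kk. pact A y \<in> kk \<inter> V}" using VW by (simp add: openin_open_Int)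
    \<comment> \<open>The neighbourhood consists of the points of W that A carries into the disjoint
      set V.\<close>
    then have "openin (top_of_set kk) ({y \<in> kk. pact A y \<in> kk \<inter> V} \<inter> (kk \<inter> W))"
      using VW by (intro openin_Int openin_open_Int)
    then show ?thesis
      using VW assms SO A' by (intro exI[of _ "{y \<in> kk. pact A y \<in> kk \<inter> V} \<inter> (kk \<inter> W)"]) auto
  qed
  then obtain V where V: "\<And>A. A \<in> S \<Longrightarrow> openin (top_of_set kk) (V A) \<and> x \<in> V A \<and> (\<forall>v\<in>V A. pact A v \<notin> V A)"
    by metis
  define U where "U = (kk \<inter> ball x r) \<inter> \<Inter>(V ` S)"
  have "openin (top_of_set kk) U"
  proof (cases "S = {}")
    case True
    then show ?thesis by (simp add: U_def openin_open_Int)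
  next
    case False
    then have "openin (top_of_set kk) (\<Inter>(V ` S))"
      using finS V by (intro openin_Inter) auto
    then show ?thesis unfolding U_def by (intro openin_Int openin_open_Int open_ball)
  qed
  moreover have "x \<in> U" using V assms r by (auto simp: U_def)
  moreover have "A = mat 1" if "A \<in> \<Lambda>" "u \<in> U" "pact A u \<in> U" for A u
  proof (rule ccontr)
    assume "A \<noteq> mat 1"
    have "U \<subseteq> K" by (auto simp: U_def K_def kk_def)
    then have "A \<in> S" using that \<open>A \<noteq> mat 1\<close> by (auto simp: S_def)
    then show False using V[of A] that by (auto simp: U_def)
  qed
  ultimately show thesis using that by blast
qed

section \<open>The orbit map from the chart to the quotient\<close>

definition P :: "'n rvec \<Rightarrow> 'n rvec set set" where
  "P x = orb \<Lambda> (span {x})"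

lemma P_eq_iff:
  assumes "x \<in> kk" "y \<in> kk"
  shows "P x = P y \<longleftrightarrow> (\<exists>A\<in>\<Lambda>. y = pact A x)"
proof
  assume eq: "P x = P y"
  have "span {y} \<in> P y"
    unfolding P_def orb_def using one act_span[of "mat 1" y] by (force intro: rev_image_eqI)
  then have "span {y} \<in> P x" using eq by simp
  then obtain A where A: "A \<in> \<Lambda>" "span {y} = act A (span {x})"
    unfolding P_def orb_def by auto
  then have "span {y} = span {pact A x}" using act_span_pact[of A x] assms SO[of A] by simp
  then have "y = pact A x" using span_eq_iff_kk[of y "pact A x"] assms A SO by simp
  then show "\<exists>A\<in>\<Lambda>. y = pact A x" using A by blast
next
  assume "\<exists>A\<in>\<Lambda>. y = pact A x"
  then obtain A where A: "A \<in> \<Lambda>" "y = pact A x" by blast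
  have P: "P z = {span {B *v z} | B. B \<in> \<Lambda>}" for z
    by (auto simp: P_def orb_def act_span)
  have y: "span {B *v y} = span {(B ** A) *v x}" for B
    unfolding A(2) pact_def using SO_q_last_nonzero[of A x] A assms SO
    by (simp add: matrix_vector_mult_scaleR span_scaleR matrix_vector_mul_assoc)
  have "{span {B *v y} | B. B \<in> \<Lambda>} \<subseteq> {span {B *v x} | B. B \<in> \<Lambda>}"
    using y mult A by blast
  moreover have "span {B *v x} = span {(B ** matrix_inv A) *v y}" for B
    unfolding y by (simp add: matrix_mul_assoc[symmetric] inv_left A)
  then have "{span {B *v x} | B. B \<in> \<Lambda>} \<subseteq> {span {B *v y} | B. B \<in> \<Lambda>}"
    using mult A inv by blast
  ultimately show "P x = P y" unfolding P by blast
qed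

lemma P_pact: "A \<in> \<Lambda> \<Longrightarrow> x \<in> kk \<Longrightarrow> P (pact A x) = P x"
  using P_eq_iff[of x "pact A x"] SO by (metis pact_in_kk)

end

text \<open>The inverse is continuous because scaling the last coordinate to 1 is continuous on the
  open saturated cone q < 0 and constant on lines, so it descends through the quotient map that
  defines \<open>proj_space\<close>.\<close>

lemma span_homeomorphic:
  "homeomorphic_map (top_of_set kk) (subtopology proj_space Omega0) (\<lambda>x :: 'n::{finite,linorder} rvec. span {x})"
proof -
  let ?s = "\<lambda>x :: 'n rvec. span {x}"
  have q: "quotient_map (top_of_set (- {0})) proj_space ?s"
    unfolding proj_space_def by (rule quotient_map_quotient_topology)
  define N where "N = {x :: 'n rvec. qform x < 0}"
  have oN: "open N" unfolding N_def by (intro open_Collect_less continuous_intros)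
  have N0: "0 \<notin> N" by (simp add: N_def qform_eq_bil bil_simps)
  have sat: "{x \<in> - {0}. ?s x \<in> Omega0} = N"
  proof (intro subset_antisym subsetI)
    fix x assume x: "x \<in> {x \<in> - {0}. ?s x \<in> Omega0}"
    then obtain y where y: "qform y < 0" "span {x} = span {y}" by (auto simp: Omega0_def)
    then have "x \<in> span {y}" by (metis span_base insertI1)
    then obtain k where "x = k *\<^sub>R y" by (auto simp: span_singleton)
    then show "x \<in> N" using x y by (auto simp: N_def qform_scaleR mult_pos_neg)
  qed (use N0 in \<open>auto simp: N_def Omega0_def\<close>)
  have "Omega0 = ?s ` N" by (auto simp: Omega0_def N_def)
  moreover have "N \<subseteq> - {0}" using N0 by auto
  ultimately have Osub: "Omega0 \<subseteq> topspace (proj_space :: 'n rvec set topology)"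
    unfolding proj_space_def topspace_quotient_topology topspace_euclidean_subtopology by (metis image_mono)
  have "openin (top_of_set (- {0})) N"
    using oN N0 by (metis Int_absorb1 \<open>N \<subseteq> - {0}\<close> openin_open)
  then have "openin proj_space (Omega0 :: 'n rvec set set)"
    using Osub unfolding proj_space_def openin_quotient_topology topspace_quotient_topology
    by (simp only: sat topspace_euclidean_subtopology)
  then have q2: "quotient_map (subtopology (top_of_set (- {0})) N) (subtopology proj_space Omega0) ?s"
    by (intro quotient_map_restriction[OF q]) (simp_all only: sat topspace_euclidean_subtopology simp_thms)
  have "subtopology (top_of_set (- {0 :: 'n rvec})) N = top_of_set N"
  proof -
    have "(- {0}) \<inter> N = N" using N0 by auto
    then show ?thesis by (simp add: subtopology_subtopology)
  qed
  then have q3: "quotient_map (top_of_set N) (subtopology proj_space Omega0) ?s" using q2 by simp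
  define s where "s L = (THE x. x \<in> kk \<and> span {x} = L)" for L :: "'n rvec set"
  have s: "s (span {x}) = x" if "x \<in> kk" for x
    unfolding s_def using that span_eq_iff_kk by (intro the_equality) auto
  have sN: "s (span {x}) = (1 / x $ ilast) *\<^sub>R x" if "x \<in> N" for x
  proof -
    have "x $ ilast \<noteq> 0" using that by (auto simp: N_def qform_spatial)
    then have "(1 / x $ ilast) *\<^sub>R x \<in> kk" "span {x} = span {(1 / x $ ilast) *\<^sub>R x}"
      using that by (auto simp: kk_def N_def qform_scaleR span_scaleR mult_pos_neg)
    then show ?thesis using s by simp
  qed
  have "continuous_on N (\<lambda>x. (1 / x $ ilast) *\<^sub>R x)"
    by (intro continuous_intros) (auto simp: N_def qform_spatial)
  moreover have "(1 / x $ ilast) *\<^sub>R x \<in> kk" if "x \<in> N" for x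
  proof -
    have "x $ ilast \<noteq> 0" using that by (auto simp: N_def qform_spatial)
    then show ?thesis using that by (auto simp: kk_def N_def qform_scaleR mult_pos_neg)
  qed
  ultimately have "continuous_map (top_of_set N) (top_of_set kk) (\<lambda>x. (1 / x $ ilast) *\<^sub>R x)" by auto
  then have "continuous_map (top_of_set N) (top_of_set kk) (s \<circ> ?s)"
    by (rule continuous_map_eq) (simp add: sN)
  then have cs: "continuous_map (subtopology proj_space Omega0) (top_of_set kk) s"
    using continuous_compose_quotient_map[OF q3] by blast
  have "kk \<subseteq> N" by (auto simp: kk_def N_def)
  then have "continuous_map (top_of_set kk) (subtopology proj_space Omega0) ?s"
    using quotient_imp_continuous_map[OF q3] continuous_map_from_subtopology_mono by blast
  then have "homeomorphic_maps (top_of_set kk) (subtopology proj_space Omega0) ?s s"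
    unfolding homeomorphic_maps_def using cs s by (auto simp: Omega0_eq)
  then show ?thesis using homeomorphic_map_maps by blast
qed

context hyp_group begin

lemma P_quotient: "quotient_map (top_of_set kk) (M0 \<Lambda>) P"
proof -
  have "quotient_map (subtopology proj_space Omega0) (M0 \<Lambda>) (orb \<Lambda>)"
    unfolding M0_def orbit_space_def by (rule quotient_map_quotient_topology)
  then have "quotient_map (top_of_set kk) (M0 \<Lambda>) (orb \<Lambda> \<circ> (\<lambda>x. span {x}))"
    using quotient_map_compose span_homeomorphic[unfolded homeomorphic_map_def] by blast
  then show ?thesis by (simp add: P_def[abs_def] comp_def)
qed

lemma P_continuous: "continuous_map (top_of_set kk) (M0 \<Lambda>) P"
  using P_quotient quotient_imp_continuous_map by blast

lemma topspace_M0: "topspace (M0 \<Lambda>) = P ` kk"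
  using P_quotient quotient_imp_surjective_map by fastforce

text \<open>The preimage of the image of U is the union of the translates of U, each of which is
  open.\<close>

lemma P_open:
  assumes "openin (top_of_set kk) U"
  shows "openin (M0 \<Lambda>) (P ` U)"
proof -
  have Ukk: "U \<subseteq> kk" using openin_imp_subset[OF assms] .
  have "{x \<in> kk. P x \<in> P ` U} = (\<Union>A\<in>\<Lambda>. pact A ` U)"
  proof (intro subset_antisym subsetI)
    fix x assume "x \<in> {x \<in> kk. P x \<in> P ` U}"
    then obtain u where u: "x \<in> kk" "u \<in> U" "P u = P x" by auto
    then obtain A where "A \<in> \<Lambda>" "x = pact A u" using P_eq_iff[of u x] Ukk by blast
    then show "x \<in> (\<Union>A\<in>\<Lambda>. pact A ` U)" using u by blast
  next
    fix x assume "x \<in> (\<Union>A\<in>\<Lambda>. pact A ` U)"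
    then obtain A u where u: "A \<in> \<Lambda>" "u \<in> U" "x = pact A u" by blast
    then have "u \<in> kk" using Ukk by blast
    then show "x \<in> {x \<in> kk. P x \<in> P ` U}" using u SO P_pact by auto
  qed
  then have "openin (top_of_set kk) {x \<in> topspace (top_of_set kk). P x \<in> P ` U}"
    using open_pact_image assms by auto
  moreover have "P ` U \<subseteq> topspace (M0 \<Lambda>)" using topspace_M0 Ukk by auto
  ultimately show ?thesis using P_quotient unfolding quotient_map_def by blast
qed

end

section \<open>Lifting and the fundamental group\<close>

context hyp_group begin

text \<open>The library only knows covering spaces of spaces whose type carries a topology; the pullback
  of the covering \<open>P\<close> along a map into \<open>M0 \<Lambda>\<close> is such a space.\<close>

lemma pullback_covering_space:
  fixes h :: "'b::real_normed_vector \<Rightarrow> 'n rvec set set"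
  assumes h: "continuous_map (top_of_set Q) (M0 \<Lambda>) h"
  defines "E \<equiv> {z. fst z \<in> Q \<and> snd z \<in> kk \<and> P (snd z) = h (fst z)}"
  shows "covering_space E fst Q"
proof
  show "continuous_on E fst" by (intro continuous_intros)
  have hQ: "h q \<in> P ` kk" if "q \<in> Q" for q
    using h that topspace_M0 by (auto simp: continuous_map_def)
  show "fst ` E = Q"
  proof (intro subset_antisym subsetI)
    fix q assume q: "q \<in> Q"
    then obtain x where "x \<in> kk" "h q = P x" using hQ by blast
    then show "q \<in> fst ` E" using q by (force simp: E_def image_iff)
  qed (auto simp: E_def)
  fix q0 assume q0: "q0 \<in> Q"
  then obtain x0 where x0: "x0 \<in> kk" "h q0 = P x0" using hQ by blast
  obtain U where U: "openin (top_of_set kk) U" "x0 \<in> U"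
    and wand: "\<And>A u. A \<in> \<Lambda> \<Longrightarrow> u \<in> U \<Longrightarrow> pact A u \<in> U \<Longrightarrow> A = mat 1"
    using wandering[OF x0(1)] by metis
  have Ukk: "U \<subseteq> kk" using openin_imp_subset[OF U(1)] .
  have oV: "openin (M0 \<Lambda>) (P ` U)" using P_open U by blast
  have inj: "inj_on P U"
  proof (rule inj_onI)
    fix x y assume xy: "x \<in> U" "y \<in> U" "P x = P y"
    then obtain A where "A \<in> \<Lambda>" "y = pact A x" using P_eq_iff[of x y] Ukk by blast
    then show "x = y" using wand[of A x] xy Ukk by auto
  qed
  have "homeomorphic_map (top_of_set U) (subtopology (M0 \<Lambda>) (P ` U)) P"
  proof (rule bijective_open_imp_homeomorphic_map)
    show "continuous_map (top_of_set U) (subtopology (M0 \<Lambda>) (P ` U)) P"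
      using P_continuous continuous_map_from_subtopology_mono Ukk
      by (auto simp: continuous_map_in_subtopology)
    show "open_map (top_of_set U) (subtopology (M0 \<Lambda>) (P ` U)) P"
      unfolding open_map_def
    proof (intro allI impI)
      fix W assume W: "openin (top_of_set U) W"
      then have "openin (top_of_set kk) W" using U openin_trans by blast
      then have "openin (M0 \<Lambda>) (P ` W)" by (rule P_open)
      moreover have "P ` W \<subseteq> P ` U" using openin_imp_subset[OF W] by blast
      ultimately show "openin (subtopology (M0 \<Lambda>) (P ` U)) (P ` W)"
        unfolding openin_subtopology by blast
    qed
  qed (use inj oV openin_subset in \<open>auto simp: topspace_subtopology_subset\<close>)
  then obtain g where g: "homeomorphic_maps (top_of_set U) (subtopology (M0 \<Lambda>) (P ` U)) P g"
    using homeomorphic_map_maps by blast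
  define T where "T = {q \<in> Q. h q \<in> P ` U}"
  have oT: "openin (top_of_set Q) T"
    using openin_continuous_map_preimage[OF h oV] by (simp add: T_def)
  \<comment> \<open>One sheet for each group element; wandering of U together with freeness makes
    the sheets disjoint.\<close>
  define S where "S A = {z \<in> E. fst z \<in> T \<and> snd z \<in> pact A ` U}" for A
  have "\<Union>(S ` \<Lambda>) = E \<inter> fst -` T"
  proof (intro subset_antisym subsetI)
    fix z assume "z \<in> E \<inter> fst -` T"
    then obtain u where u: "z \<in> E" "fst z \<in> T" "u \<in> U" "P u = P (snd z)" by (force simp: E_def T_def)
    then obtain A where "A \<in> \<Lambda>" "snd z = pact A u"
      using P_eq_iff[of u "snd z"] Ukk by (auto simp: E_def)
    then show "z \<in> \<Union>(S ` \<Lambda>)" using u by (auto simp: S_def)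
  qed (auto simp: S_def)
  moreover have "openin (top_of_set E) (S A)" if A: "A \<in> \<Lambda>" for A
  proof -
    have c: "continuous_map (top_of_set E) (top_of_set Q) fst" "continuous_map (top_of_set E) (top_of_set kk) snd"
      by (auto simp: E_def intro!: continuous_intros)
    have "openin (top_of_set E) {z \<in> E. fst z \<in> T}"
      using openin_continuous_map_preimage[OF c(1) oT] by simp
    moreover have "openin (top_of_set E) {z \<in> E. snd z \<in> pact A ` U}"
      using openin_continuous_map_preimage[OF c(2) open_pact_image[OF A U(1)]] by simp
    ultimately have "openin (top_of_set E) ({z \<in> E. fst z \<in> T} \<inter> {z \<in> E. snd z \<in> pact A ` U})" by blast
    moreover have "{z \<in> E. fst z \<in> T} \<inter> {z \<in> E. snd z \<in> pact A ` U} = S A" by (auto simp: S_def)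
    ultimately show ?thesis by simp
  qed
  moreover have "pairwise disjnt (S ` \<Lambda>)"
  proof -
    have "A = B" if AB: "A \<in> \<Lambda>" "B \<in> \<Lambda>" "z \<in> S A" "z \<in> S B" for A B z
    proof -
      obtain u v where uv: "u \<in> U" "v \<in> U" "pact A u = pact B v" using AB by (auto simp: S_def)
      have kk: "u \<in> kk" "v \<in> kk" using uv Ukk by auto
      then have "pact (matrix_inv B ** A) u = v"
        using uv AB by (metis SO pact_mult pact_inv_left)
      then have "matrix_inv B ** A = mat 1" using wand[of "matrix_inv B ** A" u] uv AB mult inv by auto
      then have "pact A u = pact B u"
        using AB by (metis inv_right matrix_mul_assoc matrix_mul_lid matrix_mul_rid)
      then show "A = B" using pact_eq_imp AB kk by blast
    qed
    then show ?thesis by (auto simp: pairwise_def disjnt_def)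
  qed
  moreover have "\<exists>k. homeomorphism (S A) T fst k" if A: "A \<in> \<Lambda>" for A
  proof -
    \<comment> \<open>The inverse of the projection on the sheet of A: the local inverse g of the
      orbit map on U, followed by A.\<close>
    define k where "k q = (q, pact A (g (h q)))" for q
    have gU: "g y \<in> U" "P (g y) = y" if "y \<in> P ` U" for y
      using g that openin_subset[OF oV] by (auto simp: homeomorphic_maps_def continuous_map_def)
    have gP: "g (P u) = u" if "u \<in> U" for u
      using g that by (auto simp: homeomorphic_maps_def)
    have "continuous_map (top_of_set T) (subtopology (M0 \<Lambda>) (P ` U)) h"
      using continuous_map_from_subtopology_mono[OF h] by (auto simp: T_def continuous_map_in_subtopology)
    then have "continuous_map (top_of_set T) (top_of_set U) (g \<circ> h)"
      using g continuous_map_compose by (auto simp: homeomorphic_maps_def simp del: continuous_map_subtopology_eu)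
    then have "continuous_on T (g \<circ> h)" "(g \<circ> h) ` T \<subseteq> kk" using Ukk by auto
    then have "continuous_on T (\<lambda>q. pact A (g (h q)))"
      using continuous_on_compose2[OF continuous_on_pact[OF SO[OF A]], of T "g \<circ> h"] by (simp add: comp_def)
    then have ck: "continuous_on T k" unfolding k_def by (intro continuous_intros)
    have kS: "k q \<in> S A" if "q \<in> T" for q
    proof -
      have "h q \<in> P ` U" "q \<in> Q" using that by (auto simp: T_def)
      moreover have "g (h q) \<in> kk" using gU(1)[of "h q"] Ukk calculation by auto
      ultimately show ?thesis
        using that gU[of "h q"] A by (auto simp: k_def S_def E_def P_pact SO)
    qed
    have kf: "k (fst z) = z" if "z \<in> S A" for z
    proof -
      have "snd z \<in> pact A ` U" using that by (simp add: S_def)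
      then obtain u where u: "u \<in> U" "snd z = pact A u" by blast
      have "h (fst z) = P (snd z)" using that by (auto simp: S_def E_def)
      also have "\<dots> = P u" using u A Ukk P_pact by auto
      finally have "g (h (fst z)) = u" using gP u by simp
      then show ?thesis using u by (simp add: k_def prod_eq_iff)
    qed
    have "fst ` S A = T"
    proof (intro subset_antisym subsetI)
      fix q assume "q \<in> T"
      then show "q \<in> fst ` S A" using kS[of q] by (intro image_eqI[of _ _ "k q"]) (auto simp: k_def)
    qed (auto simp: S_def)
    moreover have "k ` T = S A"
    proof (intro subset_antisym subsetI)
      fix z assume "z \<in> S A"
      then show "z \<in> k ` T" using kf[of z] by (intro image_eqI[of _ _ "fst z"]) (auto simp: S_def)
    qed (use kS in auto)
    ultimately have "homeomorphism (S A) T fst k"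
      using ck kf by (auto simp: homeomorphism_def k_def intro!: continuous_intros)
    then show ?thesis by blast
  qed
  ultimately show "\<exists>T. q0 \<in> T \<and> openin (top_of_set Q) T \<and>
           (\<exists>v. \<Union>v = E \<inter> fst -` T \<and> (\<forall>u\<in>v. openin (top_of_set E) u) \<and>
           pairwise disjnt v \<and> (\<forall>u\<in>v. \<exists>q. homeomorphism u T fst q))"
    using oT q0 x0 U by (intro exI[of _ T] conjI exI[of _ "S ` \<Lambda>"]) (auto simp: T_def)
qed

text \<open>A convex set is simply connected and locally path connected, so its identity map lifts
  to the pullback covering; the second component of that section is the lift of h.\<close>

lemma lift_exists:
  fixes h :: "'b::real_normed_vector \<Rightarrow> 'n rvec set set"
  assumes h: "continuous_map (top_of_set Q) (M0 \<Lambda>) h" and Q: "convex Q" "a \<in> Q"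
    and x: "x \<in> kk" "P x = h a"
  obtains l where "continuous_on Q l" "l ` Q \<subseteq> kk" "l a = x" "\<And>q. q \<in> Q \<Longrightarrow> P (l q) = h q"
proof -
  define E where "E = {z. fst z \<in> Q \<and> snd z \<in> kk \<and> P (snd z) = h (fst z)}"
  have cov: "covering_space E fst Q" unfolding E_def by (rule pullback_covering_space[OF h])
  obtain g where g: "continuous_on Q g" "g \<in> Q \<rightarrow> E" "g a = (a, x)" "\<And>q. q \<in> Q \<Longrightarrow> fst (g q) = q"
  proof (rule covering_space_lift_strong[OF cov, of "(a, x)" a Q "\<lambda>q. q"])
    show "simply_connected Q" using Q by (simp add: convex_imp_simply_connected)
    show "locally path_connected Q" using Q by (simp add: convex_imp_locally_path_connected)
  qed (use Q x in \<open>auto simp: E_def\<close>)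
  show thesis
  proof (rule that[of "\<lambda>q. snd (g q)"])
    show "continuous_on Q (\<lambda>q. snd (g q))" using g by (intro continuous_intros)
    show "P (snd (g q)) = h q" if "q \<in> Q" for q
      using g that by (auto simp: E_def Pi_iff)
  qed (use g in \<open>auto simp: E_def Pi_iff\<close>)
qed

text \<open>The set of agreement is closed. It is also open, since two points of a wandering
  neighbourhood with the same orbit are equal.\<close>

lemma lift_unique:
  fixes l l' :: "'b::topological_space \<Rightarrow> 'n rvec"
  assumes T: "connected T" and l: "continuous_on T l" "l ` T \<subseteq> kk"
    and l': "continuous_on T l'" "l' ` T \<subseteq> kk"
    and eq: "\<And>x. x \<in> T \<Longrightarrow> P (l x) = P (l' x)" and a: "a \<in> T" "l a = l' a" and x: "x \<in> T"
  shows "l x = l' x"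
proof -
  let ?S = "{y \<in> T. l y - l' y = 0}"
  have "closedin (top_of_set T) ?S"
    using l l' by (intro continuous_closedin_preimage_constant continuous_intros)
  moreover have "openin (top_of_set T) ?S"
  proof (subst openin_subopen, intro ballI)
    fix y assume y: "y \<in> ?S"
    then have ly: "l y \<in> kk" using l by auto
    obtain U where U: "openin (top_of_set kk) U" "l y \<in> U"
      and wand: "\<And>A u. A \<in> \<Lambda> \<Longrightarrow> u \<in> U \<Longrightarrow> pact A u \<in> U \<Longrightarrow> A = mat 1"
      using wandering[OF ly] by metis
    have Ukk: "U \<subseteq> kk" using openin_imp_subset[OF U(1)] .
    have "openin (top_of_set T) (T \<inter> l -` U)" "openin (top_of_set T) (T \<inter> l' -` U)"
      using l l' U(1) by (auto intro: continuous_openin_preimage)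
    then have "openin (top_of_set T) ((T \<inter> l -` U) \<inter> (T \<inter> l' -` U))" by blast
    moreover have "(T \<inter> l -` U) \<inter> (T \<inter> l' -` U) \<subseteq> ?S"
    proof
      fix z assume z: "z \<in> (T \<inter> l -` U) \<inter> (T \<inter> l' -` U)"
      then obtain A where "A \<in> \<Lambda>" "l' z = pact A (l z)"
        using eq[of z] P_eq_iff[of "l z" "l' z"] Ukk by blast
      then show "z \<in> ?S" using wand[of A "l z"] z Ukk by auto
    qed
    ultimately show "\<exists>V. openin (top_of_set T) V \<and> y \<in> V \<and> V \<subseteq> ?S"
      using y U by (intro exI[of _ "(T \<inter> l -` U) \<inter> (T \<inter> l' -` U)"]) auto
  qed
  ultimately have "?S = {} \<or> ?S = T" using T by (auto simp: connected_clopen)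
  then show ?thesis using a x by auto
qed

section \<open>Homotopy classes of loops and elements of the group\<close>

definition cls :: "'n rvec \<Rightarrow> 'n sqmat \<Rightarrow> (real \<Rightarrow> 'n rvec set set) set" where
  "cls p A = {f \<in> loops_at (M0 \<Lambda>) (P p). \<exists>l. pathin (top_of_set kk) l \<and> l 0 = p \<and> l 1 = pact A p \<and>
     (\<forall>s\<in>{0..1}. P (l s) = f s)}"

lemma loop_in_cls:
  assumes p: "p \<in> kk" and f: "f \<in> loops_at (M0 \<Lambda>) (P p)"
  obtains A where "A \<in> \<Lambda>" "f \<in> cls p A"
proof -
  have "continuous_map (top_of_set {0..1}) (M0 \<Lambda>) f" "P p = f 0"
    using f by (auto simp: loops_at_def pathin_def)
  then obtain l where l: "continuous_on {0..1} l" "l ` {0..1} \<subseteq> kk" "l 0 = p"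
    "\<And>q. q \<in> {0..1} \<Longrightarrow> P (l q) = f q"
    using lift_exists[of "{0..1}" f 0 p] p by auto
  have "P p = P (l 1)" using f l(4)[of 1] by (simp add: loops_at_def)
  moreover have "l 1 \<in> kk" using l by auto
  ultimately obtain A where A: "A \<in> \<Lambda>" "l 1 = pact A p" using P_eq_iff p by blast
  have "f \<in> cls p A"
    using f l A by (auto simp: cls_def pathin_canon_iff path_def intro!: exI[of _ l])
  then show thesis using that A by blast
qed

lemma projected_path_in_cls:
  assumes p: "p \<in> kk" and A: "A \<in> \<Lambda>"
    and l: "pathin (top_of_set kk) l" "l 0 = p" "l 1 = pact A p"
  shows "(\<lambda>s. P (l s)) \<in> cls p A"
proof -
  have "pathin (M0 \<Lambda>) (P \<circ> l)" using pathin_compose[OF l(1) P_continuous] .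
  then show ?thesis using l A p P_pact by (auto simp: cls_def loops_at_def comp_def)
qed

lemma cls_nonempty:
  assumes "p \<in> kk" "A \<in> \<Lambda>"
  shows "cls p A \<noteq> {}"
proof -
  have "pathin (top_of_set kk) (linepath p (pact A p))"
    using assms SO convex_kk closed_segment_subset[of p kk "pact A p"]
    by (auto simp: pathin_canon_iff path_image_def[symmetric] image_subset_iff_funcset[symmetric])
  from projected_path_in_cls[OF assms this] show ?thesis
    by (auto simp: linepath_def)
qed

lemma cls_inj:
  assumes p: "p \<in> kk" and AB: "A \<in> \<Lambda>" "B \<in> \<Lambda>" and f: "f \<in> cls p A" "f \<in> cls p B"
  shows "A = B"
proof -
  obtain l where l: "pathin (top_of_set kk) l" "l 0 = p" "l 1 = pact A p" "\<And>s. s \<in> {0..1} \<Longrightarrow> P (l s) = f s"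
    using f(1) by (auto simp: cls_def)
  obtain m where m: "pathin (top_of_set kk) m" "m 0 = p" "m 1 = pact B p" "\<And>s. s \<in> {0..1} \<Longrightarrow> P (m s) = f s"
    using f(2) by (auto simp: cls_def)
  have "l 1 = m 1"
    by (rule lift_unique[of "{0..1}" l m 0 1])
      (use l m in \<open>auto simp: pathin_canon_iff path_def Pi_iff\<close>)
  then show ?thesis using pact_eq_imp[OF AB p] l m by simp
qed

text \<open>The homotopy is lifted to the square. The two edges along which the base point is fixed
  project to a constant, so uniqueness of lifts makes the lifted edges constant and the endpoint
  \<open>pact A p\<close> does not move.\<close>

lemma loop_class_subset_cls:
  assumes p: "p \<in> kk" and A: "A \<in> \<Lambda>" and f: "f \<in> cls p A" and g: "g \<in> loop_class (M0 \<Lambda>) (P p) f"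
  shows "g \<in> cls p A"
proof -
  let ?I = "{0..1::real}"
  obtain l where l: "pathin (top_of_set kk) l" "l 0 = p" "l 1 = pact A p" "\<And>s. s \<in> ?I \<Longrightarrow> P (l s) = f s"
    using f by (auto simp: cls_def)
  have gl: "g \<in> loops_at (M0 \<Lambda>) (P p)" using g by (simp add: loop_class_def)
  obtain h where h: "continuous_map (prod_topology (top_of_set ?I) (top_of_set ?I)) (M0 \<Lambda>) h"
    "\<And>x. h (0, x) = f x" "\<And>x. h (1, x) = g x" "\<And>t. t \<in> ?I \<Longrightarrow> h (t, 0) = P p" "\<And>t. t \<in> ?I \<Longrightarrow> h (t, 1) = P p"
    using g by (auto simp: loop_class_def homotopic_with_def)
  have hc: "continuous_map (top_of_set (?I \<times> ?I)) (M0 \<Lambda>) h"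
    using h(1) by (simp add: subtopology_Times flip: euclidean_product_topology)
  obtain k where k: "continuous_on (?I \<times> ?I) k" "k ` (?I \<times> ?I) \<subseteq> kk" "k (0, 0) = p"
    "\<And>q. q \<in> ?I \<times> ?I \<Longrightarrow> P (k q) = h q"
    by (rule lift_exists[OF hc, of "(0, 0)" p]) (use p h(4)[of 0] in \<open>auto intro: convex_Times\<close>)
  have c0: "continuous_on ?I (\<lambda>s. k (t, s))" "continuous_on ?I (\<lambda>s. k (s, t))" if "t \<in> ?I" for t
    by (rule continuous_on_compose2[OF k(1)]; use that in \<open>auto intro!: continuous_intros\<close>)+
  have "k (0, 1) = l 1"
    by (rule lift_unique[of ?I "\<lambda>s. k (0, s)" l 0 1])
      (use l k h(2) c0[of 0] in \<open>auto simp: pathin_canon_iff path_def Pi_iff image_subset_iff\<close>)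
  moreover have "k (1, 0) = p"
    by (rule lift_unique[of ?I "\<lambda>t. k (t, 0)" "\<lambda>t. p" 0 1])
      (use p k h(4) c0[of 0] in \<open>auto simp: image_subset_iff\<close>)
  moreover have "k (1, 1) = k (0, 1)"
    by (rule lift_unique[of ?I "\<lambda>t. k (t, 1)" "\<lambda>t. k (0, 1)" 0 1])
      (use p k h(5) c0[of 1] in \<open>auto simp: image_subset_iff\<close>)
  moreover have "pathin (top_of_set kk) (\<lambda>s. k (1, s))"
    using c0[of 1] k(2) by (auto simp: pathin_canon_iff path_def)
  ultimately show ?thesis
    using gl l(3) k(4) h(3) unfolding cls_def by (auto intro!: exI[of _ "\<lambda>s. k (1, s)"])
qed

text \<open>Two lifts with the same endpoints are joined by the straight-line homotopy in the convex
  chart, which is then projected.\<close>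

lemma cls_subset_loop_class:
  assumes p: "p \<in> kk" and A: "A \<in> \<Lambda>" and f: "f \<in> cls p A" and g: "g \<in> cls p A"
  shows "g \<in> loop_class (M0 \<Lambda>) (P p) f"
proof -
  let ?I = "{0..1::real}"
  obtain l where l: "pathin (top_of_set kk) l" "l 0 = p" "l 1 = pact A p" "\<And>s. s \<in> ?I \<Longrightarrow> P (l s) = f s"
    using f by (auto simp: cls_def)
  obtain m where m: "pathin (top_of_set kk) m" "m 0 = p" "m 1 = pact A p" "\<And>s. s \<in> ?I \<Longrightarrow> P (m s) = g s"
    using g by (auto simp: cls_def)
  have gl: "g \<in> loops_at (M0 \<Lambda>) (P p)" and fl: "f \<in> loops_at (M0 \<Lambda>) (P p)"
    using g f by (simp_all add: cls_def)
  define k where "k z = (1 - fst z) *\<^sub>R l (snd z) + fst z *\<^sub>R m (snd z)" for z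
  have cl: "continuous_on ?I l" "continuous_on ?I m" "l ` ?I \<subseteq> kk" "m ` ?I \<subseteq> kk"
    using l m by (auto simp: pathin_canon_iff path_def)
  have ck: "continuous_on (?I \<times> ?I) k" unfolding k_def
    by (intro continuous_intros continuous_on_compose2[OF cl(1)] continuous_on_compose2[OF cl(2)]) auto
  have kk: "k z \<in> kk" if "z \<in> ?I \<times> ?I" for z
    unfolding k_def using that cl by (intro convexD_alt[OF convex_kk]) auto
  \<comment> \<open>\<open>homotopic_with\<close> prescribes the homotopy at times 0 and 1 for every
    real argument, also outside the unit interval, where f and g need not be the projected lifts.
    The end values are therefore set by hand.\<close>
  define h where "h z = (if fst z = 0 then f (snd z) else if fst z = 1 then g (snd z) else P (k z))" for z
  have hk: "h z = P (k z)" if "z \<in> ?I \<times> ?I" for z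
    using that l(4) m(4) by (auto simp: h_def k_def)
  have "continuous_map (top_of_set (?I \<times> ?I)) (M0 \<Lambda>) (P \<circ> k)"
    using ck kk by (intro continuous_map_compose[OF _ P_continuous]) auto
  then have "continuous_map (top_of_set (?I \<times> ?I)) (M0 \<Lambda>) h"
    by (rule continuous_map_eq) (simp add: hk)
  then have hc: "continuous_map (prod_topology (top_of_set ?I) (top_of_set ?I)) (M0 \<Lambda>) h"
    by (simp add: subtopology_Times flip: euclidean_product_topology)
  have "h (t, 0) = P p" if "t \<in> ?I" for t
    using that l m by (simp add: hk k_def algebra_simps)
  moreover have "h (t, 1) = P p" if "t \<in> ?I" for t
  proof -
    have "k (t, 1) = pact A p" using l m by (simp add: k_def algebra_simps)
    then show ?thesis using that hk P_pact A p by simp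
  qed
  ultimately have "homotopic_with (\<lambda>h. h 0 = P p \<and> h 1 = P p) (top_of_set ?I) (M0 \<Lambda>) f g"
    unfolding homotopic_with_def using hc by (intro exI[of _ h]) (auto simp: h_def)
  then show ?thesis using gl by (simp add: loop_class_def)
qed

lemma loop_class_eq:
  "p \<in> kk \<Longrightarrow> A \<in> \<Lambda> \<Longrightarrow> f \<in> cls p A \<Longrightarrow> loop_class (M0 \<Lambda>) (P p) f = cls p A"
  using loop_class_subset_cls cls_subset_loop_class by blast

lemma carrier_pi1:
  assumes "p \<in> kk"
  shows "carrier (pi1_M0 \<Lambda> (span {p})) = cls p ` \<Lambda>"
proof -
  have "loop_class (M0 \<Lambda>) (P p) ` loops_at (M0 \<Lambda>) (P p) = cls p ` \<Lambda>"
  proof (intro subset_antisym subsetI)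
    fix c assume "c \<in> loop_class (M0 \<Lambda>) (P p) ` loops_at (M0 \<Lambda>) (P p)"
    then obtain f where f: "f \<in> loops_at (M0 \<Lambda>) (P p)" "c = loop_class (M0 \<Lambda>) (P p) f" by blast
    then show "c \<in> cls p ` \<Lambda>"
      using loop_in_cls[OF assms f(1)] loop_class_eq[OF assms] by (metis imageI)
  next
    fix c assume "c \<in> cls p ` \<Lambda>"
    then obtain A where A: "A \<in> \<Lambda>" "c = cls p A" by blast
    then obtain f where "f \<in> cls p A" using cls_nonempty assms by blast
    moreover from this have "f \<in> loops_at (M0 \<Lambda>) (P p)" by (simp add: cls_def)
    ultimately show "c \<in> loop_class (M0 \<Lambda>) (P p) ` loops_at (M0 \<Lambda>) (P p)"
      using loop_class_eq[OF assms A(1)] A by blast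
  qed
  then show ?thesis by (simp add: pi1_M0_def fundamental_group_def P_def)
qed

text \<open>The lift of a join follows the first lift and then the A-translate of the second one, so
  it ends at A (B p). This fixes the order of the factors in the multiplicativity of the
  holonomy.\<close>

lemma loop_join_cls:
  assumes p: "p \<in> kk" and A: "A \<in> \<Lambda>" and B: "B \<in> \<Lambda>" and f: "f \<in> cls p A" and g: "g \<in> cls p B"
  shows "loop_join f g \<in> cls p (A ** B)"
proof -
  let ?I = "{0..1::real}"
  obtain l where l: "pathin (top_of_set kk) l" "l 0 = p" "l 1 = pact A p" "\<And>s. s \<in> ?I \<Longrightarrow> P (l s) = f s"
    using f by (auto simp: cls_def)
  obtain m where m: "pathin (top_of_set kk) m" "m 0 = p" "m 1 = pact B p" "\<And>s. s \<in> ?I \<Longrightarrow> P (m s) = g s"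
    using g by (auto simp: cls_def)
  have mk: "m s \<in> kk" if "s \<in> ?I" for s using m that by (auto simp: pathin_canon_iff)
  have "pathin (top_of_set kk) (pact A \<circ> m)"
    using pathin_compose[OF m(1), of "top_of_set kk" "pact A"] continuous_on_pact SO[OF A] by auto
  moreover have "pathfinish l = pathstart (pact A \<circ> m)"
    using l m by (simp add: pathfinish_def pathstart_def)
  moreover from this have "path_image (l +++ (pact A \<circ> m)) = path_image l \<union> path_image (pact A \<circ> m)"
    by (rule path_image_join)
  ultimately have n: "pathin (top_of_set kk) (l +++ (pact A \<circ> m))"
    using l(1) by (auto simp: pathin_canon_iff path_image_def simp flip: image_subset_iff_funcset)
  have e: "(l +++ (pact A \<circ> m)) 0 = p" "(l +++ (pact A \<circ> m)) 1 = pact (A ** B) p"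
    using l m B p SO by (auto simp: joinpaths_def pact_mult)
  have Pn: "P ((l +++ (pact A \<circ> m)) s) = loop_join f g s" if "s \<in> ?I" for s
    using that l(4)[of "2 * s"] m(4)[of "2 * s - 1"] mk[of "2 * s - 1"] P_pact A
    by (auto simp: joinpaths_def loop_join_def)
  have "(\<lambda>s. P ((l +++ (pact A \<circ> m)) s)) \<in> cls p (A ** B)"
    by (rule projected_path_in_cls[OF p mult[OF A B] n e])
  then have L: "(\<lambda>s. P ((l +++ (pact A \<circ> m)) s)) \<in> loops_at (M0 \<Lambda>) (P p)" by (simp add: cls_def)
  then have "pathin (M0 \<Lambda>) (\<lambda>s. P ((l +++ (pact A \<circ> m)) s))" by (simp add: loops_at_def)
  then have "pathin (M0 \<Lambda>) (loop_join f g)"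
    unfolding pathin_def by (rule continuous_map_eq) (simp add: Pn)
  moreover have "loop_join f g 0 = P p" "loop_join f g 1 = P p"
    using Pn[of 0] Pn[of 1] L by (simp_all add: loops_at_def)
  ultimately have "loop_join f g \<in> loops_at (M0 \<Lambda>) (P p)" by (simp add: loops_at_def)
  then show ?thesis using n e Pn by (auto simp: cls_def)
qed

lemma mult_pi1:
  assumes p: "p \<in> kk" and A: "A \<in> \<Lambda>" and B: "B \<in> \<Lambda>"
  shows "cls p A \<otimes>\<^bsub>pi1_M0 \<Lambda> (span {p})\<^esub> cls p B = cls p (A ** B)"
proof -
  have "(\<Union>f\<in>cls p A. \<Union>g\<in>cls p B. loop_class (M0 \<Lambda>) (P p) (loop_join f g)) = cls p (A ** B)"
    using loop_class_eq[OF p mult[OF A B] loop_join_cls[OF p A B]] cls_nonempty[OF p A] cls_nonempty[OF p B]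
    by auto
  then show ?thesis by (simp add: pi1_M0_def fundamental_group_def P_def)
qed

lemma holonomy_cls:
  assumes p: "p \<in> kk" and A: "A \<in> \<Lambda>"
  shows "holonomy \<Lambda> (span {p}) (cls p A) = A"
proof -
  let ?I = "{0..1::real}" and ?X = "subtopology proj_space Omega0 :: 'n rvec set topology"
  obtain s where s: "homeomorphic_maps (top_of_set kk) ?X (\<lambda>x. span {x}) s"
    using span_homeomorphic homeomorphic_map_maps by blast
  then have s': "s (span {x}) = x" if "x \<in> kk" for x
    using that by (auto simp: homeomorphic_maps_def)
  have cont: "continuous_map (top_of_set kk) ?X (\<lambda>x. span {x})" "continuous_map ?X (top_of_set kk) s"
    using s by (auto simp: homeomorphic_maps_def)
  show ?thesis unfolding holonomy_def
  proof (rule the_equality)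
    obtain f where f: "f \<in> cls p A" using cls_nonempty[OF p A] by blast
    then obtain l where l: "pathin (top_of_set kk) l" "l 0 = p" "l 1 = pact A p" "\<And>s. s \<in> ?I \<Longrightarrow> P (l s) = f s"
      by (auto simp: cls_def)
    have "pathin ?X ((\<lambda>x. span {x}) \<circ> l)" using pathin_compose[OF l(1) cont(1)] .
    then show "A \<in> \<Lambda> \<and> (\<exists>f\<in>cls p A. \<exists>l. pathin ?X l \<and> l 0 = span {p} \<and>
        (\<forall>s\<in>?I. orb \<Lambda> (l s) = f s) \<and> l 1 = act A (span {p}))"
      using f l A p SO[OF A]
      by (intro conjI bexI[of _ f] exI[of _ "(\<lambda>x. span {x}) \<circ> l"])
        (auto simp: P_def act_span_pact)
  next
    fix B assume "B \<in> \<Lambda> \<and> (\<exists>f\<in>cls p A. \<exists>l. pathin ?X l \<and> l 0 = span {p} \<and>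
        (\<forall>s\<in>?I. orb \<Lambda> (l s) = f s) \<and> l 1 = act B (span {p}))"
    then obtain f l where B: "B \<in> \<Lambda>" and f: "f \<in> cls p A" and l: "pathin ?X l" "l 0 = span {p}"
      "\<And>s. s \<in> ?I \<Longrightarrow> orb \<Lambda> (l s) = f s" "l 1 = act B (span {p})" by blast
    have "pathin (top_of_set kk) (s \<circ> l)" using pathin_compose[OF l(1) cont(2)] .
    moreover have "(s \<circ> l) 0 = p" "(s \<circ> l) 1 = pact B p"
      using l s' p SO[OF B] by (auto simp: act_span_pact)
    moreover have "P ((s \<circ> l) t) = f t" if "t \<in> ?I" for t
    proof -
      have "l t \<in> topspace ?X" using path_image_subset_topspace[OF l(1)] that by auto
      then have "span {s (l t)} = l t" using s by (auto simp: homeomorphic_maps_def)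
      then show ?thesis using l(3)[OF that] by (simp add: P_def)
    qed
    ultimately have "f \<in> cls p B" using f unfolding cls_def by blast
    then show "B = A" using cls_inj p A B f by blast
  qed
qed

end

section \<open>Walls and tiles\<close>

definition hh :: "'n::{finite,linorder} rvec set" where
  "hh = {x \<in> kk. x $ ifirst = 0}"

lemma Hyp_eq: "(Hyp :: 'n::{finite,linorder} rvec set set) = (\<lambda>x. span {x}) ` hh"
proof (intro subset_antisym subsetI)
  fix L :: "'n rvec set" assume "L \<in> Hyp"
  then obtain x where "x \<in> kk" "L = span {x}" "\<forall>y\<in>L. y $ ifirst = 0"
    by (auto simp: Hyp_def Omega0_eq)
  then show "L \<in> (\<lambda>x. span {x}) ` hh" by (auto simp: hh_def intro: span_base)
qed (auto simp: Hyp_def Omega0_eq hh_def span_singleton)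

locale tiling = hyp_group \<Lambda> for \<Lambda> :: "'n::{finite,linorder} sqmat set" +
  assumes embedded: "N0_properly_embedded \<Lambda>"
begin

lemma hh_in_kk: "x \<in> hh \<Longrightarrow> x \<in> kk" for x :: "'n rvec"
  by (simp add: hh_def)

definition wall :: "'n sqmat \<Rightarrow> 'n rvec set" where
  "wall A = pact A ` hh"

definition walls :: "'n rvec set" where
  "walls = (\<Union>A\<in>\<Lambda>. wall A)"

abbreviation \<Delta> :: "'n sqmat set" where
  "\<Delta> \<equiv> stab \<Lambda> Hyp"

lemma wall_kk: "A \<in> \<Lambda> \<Longrightarrow> wall A \<subseteq> kk"
  by (auto simp: wall_def SO dest: hh_in_kk)

lemma in_wall_iff:
  assumes "A \<in> \<Lambda>" "x \<in> kk"
  shows "x \<in> wall A \<longleftrightarrow> pact (matrix_inv A) x \<in> hh"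
proof
  assume "x \<in> wall A"
  then show "pact (matrix_inv A) x \<in> hh"
    using assms pact_inv_left hh_in_kk by (auto simp: wall_def)
next
  assume "pact (matrix_inv A) x \<in> hh"
  then show "x \<in> wall A"
    unfolding wall_def using assms pact_inv_right by (metis image_eqI)
qed

lemma in_wall_iff_linear:
  assumes "A \<in> \<Lambda>" "x \<in> kk"
  shows "x \<in> wall A \<longleftrightarrow> (matrix_inv A *v x) $ ifirst = 0"
  using in_wall_iff[OF assms] SO_q_last_nonzero[OF SO[OF inv[OF assms(1)]] assms(2)]
    pact_in_kk[OF SO[OF inv[OF assms(1)]] assms(2)]
  by (simp add: hh_def pact_def)

lemma wall_one: "wall (mat 1) = hh"
  by (force simp: wall_def hh_in_kk)

lemma walls_kk: "walls \<subseteq> kk"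
  using wall_kk by (auto simp: walls_def)

lemma pact_walls: "A \<in> \<Lambda> \<Longrightarrow> x \<in> walls \<Longrightarrow> pact A x \<in> walls"
proof -
  assume A: "A \<in> \<Lambda>" and "x \<in> walls"
  then obtain B y where "B \<in> \<Lambda>" "y \<in> hh" "x = pact B y" by (auto simp: walls_def wall_def)
  then have "pact A x = pact (A ** B) y" "A ** B \<in> \<Lambda>"
    using A pact_mult[of B y A] SO mult by (auto dest: hh_in_kk)
  then show "pact A x \<in> walls" using \<open>y \<in> hh\<close> by (auto simp: walls_def wall_def)
qed

lemma pact_walls_iff: "A \<in> \<Lambda> \<Longrightarrow> x \<in> kk \<Longrightarrow> pact A x \<in> walls \<longleftrightarrow> x \<in> walls"
  using pact_walls inv pact_inv_left by metis

lemma stab_hh: "D \<in> \<Delta> \<Longrightarrow> D \<in> \<Lambda>" "D \<in> \<Delta> \<Longrightarrow> pact D ` hh = hh"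
proof -
  assume D: "D \<in> \<Delta>"
  then show DL: "D \<in> \<Lambda>" by (simp add: stab_def)
  have "(\<lambda>x. span {x}) ` (pact D ` hh) = (\<lambda>x. span {x}) ` hh"
    using D act_span_pact[OF SO[OF DL]] hh_in_kk by (simp add: stab_def Hyp_eq image_image cong: image_cong)
  moreover have "inj_on (\<lambda>x :: 'n rvec. span {x}) kk" by (auto intro!: inj_onI simp: span_eq_iff_kk)
  ultimately show "pact D ` hh = hh"
    using SO[OF DL] hh_in_kk by (subst (asm) inj_on_image_eq_iff[where C = kk]) auto
qed

lemma one_stab: "mat 1 \<in> \<Delta>"
proof -
  have "act (mat 1) L = L" for L :: "'n rvec set" by (simp add: act_def)
  then show ?thesis using one by (simp add: stab_def)
qed

section \<open>Embeddedness of the hypersurface and the arrangement of the walls\<close>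

definition Q :: "'n rvec \<Rightarrow> 'n rvec set set" where
  "Q x = orb \<Delta> (span {x})"

lemma hh_homeo: "homeomorphic_map (top_of_set hh) (subtopology proj_space Hyp) (\<lambda>x :: 'n rvec. span {x})"
proof -
  have "homeomorphic_map (subtopology (top_of_set kk) hh) (subtopology (subtopology proj_space Omega0) Hyp)
      (\<lambda>x :: 'n rvec. span {x})"
  proof (rule homeomorphic_map_subtopologies[OF span_homeomorphic])
    have "topspace (subtopology proj_space Omega0) = (\<lambda>x :: 'n rvec. span {x}) ` kk"
      using homeomorphic_imp_surjective_map[OF span_homeomorphic] by (metis topspace_euclidean_subtopology)
    then show "(\<lambda>x :: 'n rvec. span {x}) ` (topspace (top_of_set kk) \<inter> hh)
        = topspace (subtopology proj_space Omega0) \<inter> Hyp"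
      using hh_in_kk by (auto simp: Hyp_eq)
  qed
  moreover have "kk \<inter> hh = (hh :: 'n rvec set)" "Omega0 \<inter> Hyp = (Hyp :: 'n rvec set set)"
    using hh_in_kk by (auto simp: Hyp_def)
  ultimately show ?thesis by (simp add: subtopology_subtopology)
qed

lemma Q_quotient: "quotient_map (top_of_set hh) (N0 \<Lambda>) Q"
proof -
  have "quotient_map (subtopology proj_space Hyp) (N0 \<Lambda>) (orb \<Delta>)"
    unfolding N0_def orbit_space_def by (rule quotient_map_quotient_topology)
  then have "quotient_map (top_of_set hh) (N0 \<Lambda>) (orb \<Delta> \<circ> (\<lambda>x. span {x}))"
    using quotient_map_compose hh_homeo[unfolded homeomorphic_map_def] by blast
  then show ?thesis by (simp add: Q_def[abs_def] comp_def)
qed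

lemma topspace_N0: "topspace (N0 \<Lambda>) = Q ` hh"
  using Q_quotient quotient_imp_surjective_map by fastforce

lemma incl_Q:
  assumes "x \<in> hh"
  shows "N0_incl \<Lambda> (Q x) = P x"
proof -
  have "orb \<Lambda> (act D (span {x})) = P x" if "D \<in> \<Delta>" for D
    using that stab_hh(1)[OF that] act_span_pact[of D x] SO P_pact[of D x] assms hh_in_kk
    by (metis P_def)
  then show ?thesis
    using one_stab by (auto simp: N0_incl_def Q_def orb_def[of "\<Delta>"])
qed

lemma N0_image_eq: "N0_image \<Lambda> = P ` hh"
  using incl_Q by (auto simp: N0_image_def topspace_N0 image_image)

lemma Q_eq_iff:
  assumes "x \<in> hh" "y \<in> hh"
  shows "Q x = Q y \<longleftrightarrow> P x = P y"
proof
  assume "P x = P y"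
  then have "N0_incl \<Lambda> (Q x) = N0_incl \<Lambda> (Q y)" using incl_Q assms by simp
  moreover have "inj_on (N0_incl \<Lambda>) (topspace (N0 \<Lambda>))"
    using embedded by (auto simp: N0_properly_embedded_def embedding_map_def homeomorphic_map_def)
  ultimately show "Q x = Q y" using assms by (auto simp: topspace_N0 inj_on_def)
qed (use incl_Q assms in metis)

text \<open>Here injectivity of the embedding enters: points of \<open>hh\<close> in one orbit of
  \<Lambda> are already in one orbit of the stabilizer, and freeness then identifies A with the
  stabilizing element.\<close>

lemma return_in_stab:
  assumes x: "x \<in> hh" and A: "A \<in> \<Lambda>" and Ax: "pact A x \<in> hh"
  shows "A \<in> \<Delta>"
proof -
  have "Q x = Q (pact A x)" using Q_eq_iff[OF x Ax] P_pact A x hh_in_kk by metis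
  moreover have "span {pact A x} \<in> Q (pact A x)"
    unfolding Q_def orb_def using one_stab act_span[of "mat 1" "pact A x"] by (force intro: rev_image_eqI)
  ultimately have "span {pact A x} \<in> orb \<Delta> (span {x})" by (simp add: Q_def)
  then obtain D where D: "D \<in> \<Delta>" "span {pact A x} = act D (span {x})" by (auto simp: orb_def)
  then have "span {pact A x} = span {pact D x}"
    using act_span_pact[of D x] stab_hh(1) SO x hh_in_kk by metis
  then have "pact A x = pact D x"
    using span_eq_iff_kk[of "pact A x" "pact D x"] stab_hh(1)[OF D(1)] SO A x hh_in_kk by auto
  then show ?thesis using pact_eq_imp[of A D x] A stab_hh(1)[OF D(1)] x hh_in_kk D by metis
qed

text \<open>A common point gives a point of \<open>hh\<close> that A^{-1} B returns to
  \<open>hh\<close>. So distinct translates of the hyperplane are disjoint.\<close>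

lemma walls_meet:
  assumes A: "A \<in> \<Lambda>" "B \<in> \<Lambda>" and x: "x \<in> wall A" "x \<in> wall B"
  shows "matrix_inv A ** B \<in> \<Delta>" "wall A = wall B"
proof -
  obtain a b where ab: "a \<in> hh" "b \<in> hh" "x = pact A a" "x = pact B b"
    using x by (auto simp: wall_def)
  have kk: "a \<in> kk" "b \<in> kk" using ab hh_in_kk by auto
  have "pact (matrix_inv A ** B) b = pact (matrix_inv A) x"
    unfolding ab(4) using kk A by (intro pact_mult[symmetric] SO)
  also have "\<dots> = a" unfolding ab(3) using kk A by (intro pact_inv_left)
  finally show D: "matrix_inv A ** B \<in> \<Delta>"
    using return_in_stab[of b "matrix_inv A ** B"] ab A mult inv by auto
  have "pact A (pact (matrix_inv A ** B) z) = pact B z" if "z \<in> hh" for z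
    using pact_mult[of "matrix_inv A ** B" z A] stab_hh(1)[OF D] SO that hh_in_kk A
    by (simp add: matrix_mul_assoc inv_right)
  then have "pact B ` hh = pact A ` (pact (matrix_inv A ** B) ` hh)"
    by (force simp: image_image)
  then show "wall A = wall B" using stab_hh(2)[OF D] by (simp add: wall_def)
qed

lemma walls_eq: "walls = {x \<in> kk. P x \<in> N0_image \<Lambda>}"
proof (intro subset_antisym subsetI)
  fix x assume x: "x \<in> walls"
  then obtain A y where "A \<in> \<Lambda>" "y \<in> hh" "x = pact A y" by (auto simp: walls_def wall_def)
  then show "x \<in> {x \<in> kk. P x \<in> N0_image \<Lambda>}"
    using P_pact hh_in_kk walls_kk x by (auto simp: N0_image_eq)
next
  fix x assume x: "x \<in> {x \<in> kk. P x \<in> N0_image \<Lambda>}"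
  then obtain y where "y \<in> hh" "P y = P x" "x \<in> kk" by (auto simp: N0_image_eq)
  then obtain A where "A \<in> \<Lambda>" "x = pact A y" using P_eq_iff[of y x] hh_in_kk by blast
  then show "x \<in> walls" using \<open>y \<in> hh\<close> by (auto simp: walls_def wall_def)
qed

text \<open>Properness makes the image of the hypersurface closed, and the walls are its
  preimage.\<close>

lemma closed_walls: "closedin (top_of_set kk) walls"
proof -
  have "closed_map (N0 \<Lambda>) (M0 \<Lambda>) (N0_incl \<Lambda>)"
    using embedded by (simp add: N0_properly_embedded_def proper_map_def)
  then have "closedin (M0 \<Lambda>) (N0_image \<Lambda>)"
    by (simp add: closed_map_def N0_image_def)
  from closedin_continuous_map_preimage[OF P_continuous this] show ?thesis
    by (simp add: walls_eq)
qed

text \<open>The embedding is a homeomorphism onto its image, so the image of U \<inter>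
  \<open>hh\<close> is cut out of the image of \<open>hh\<close> by an open set V of the quotient. A
  wall point of U lying over V is thus a translate of a point of U \<inter> \<open>hh\<close>, and
  since U is wandering the translation is trivial.\<close>

lemma locally_one_wall:
  assumes u: "u \<in> hh"
  obtains W where "openin (top_of_set kk) W" "convex W" "u \<in> W" "W \<inter> walls \<subseteq> hh"
proof -
  have uk: "u \<in> kk" using u hh_in_kk by blast
  obtain U where U: "openin (top_of_set kk) U" "u \<in> U"
    and wand: "\<And>A u. A \<in> \<Lambda> \<Longrightarrow> u \<in> U \<Longrightarrow> pact A u \<in> U \<Longrightarrow> A = mat 1"
    using wandering[OF uk] by metis
  have Ukk: "U \<subseteq> kk" using openin_imp_subset[OF U(1)] .
  have hk: "hh \<subseteq> (kk :: 'n rvec set)" using hh_in_kk by auto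
  \<comment> \<open>Openness in the hypersurface is tested in \<open>hh\<close>, where the saturated
    set is the trace of the translates of U under the stabilizer.\<close>
  have eq: "{x \<in> hh. Q x \<in> Q ` (U \<inter> hh)} = hh \<inter> (\<Union>D\<in>\<Delta>. pact D ` U)"
  proof (intro subset_antisym subsetI)
    fix x assume "x \<in> {x \<in> hh. Q x \<in> Q ` (U \<inter> hh)}"
    then obtain y where y: "x \<in> hh" "y \<in> U" "y \<in> hh" "P y = P x" using Q_eq_iff by auto
    then obtain A where A: "A \<in> \<Lambda>" "x = pact A y" using P_eq_iff[of y x] hh_in_kk by blast
    then have "A \<in> \<Delta>" using return_in_stab y by blast
    then show "x \<in> hh \<inter> (\<Union>D\<in>\<Delta>. pact D ` U)" using y A by blast
  next
    fix x assume "x \<in> hh \<inter> (\<Union>D\<in>\<Delta>. pact D ` U)"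
    then obtain D y where D: "x \<in> hh" "D \<in> \<Delta>" "y \<in> U" "x = pact D y" by blast
    then obtain h where h: "h \<in> hh" "x = pact D h" using stab_hh(2) by blast
    have DL: "D \<in> \<Lambda>" using D stab_hh by blast
    have "y = h" using pact_inv_left[OF DL] D h Ukk hh_in_kk by (metis subsetD)
    moreover have "P y = P x" using D P_pact[OF DL] Ukk by auto
    ultimately show "x \<in> {x \<in> hh. Q x \<in> Q ` (U \<inter> hh)}"
      using D h Q_eq_iff[of x y] by auto
  qed
  have oQ: "openin (N0 \<Lambda>) (Q ` (U \<inter> hh))"
  proof -
    have "openin (top_of_set kk) (\<Union>D\<in>\<Delta>. pact D ` U)"
      using open_pact_image U stab_hh(1) by blast
    then obtain X where X: "open X" "(\<Union>D\<in>\<Delta>. pact D ` U) = kk \<inter> X"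
      unfolding openin_open by blast
    have "hh \<inter> (\<Union>D\<in>\<Delta>. pact D ` U) = hh \<inter> X" unfolding X(2) using hk by blast
    then have "openin (top_of_set hh) {x \<in> hh. Q x \<in> Q ` (U \<inter> hh)}"
      unfolding eq using openin_open_Int[OF X(1), of hh] by simp
    moreover have "Q ` (U \<inter> hh) \<subseteq> topspace (N0 \<Lambda>)" using topspace_N0 by auto
    ultimately show "openin (N0 \<Lambda>) (Q ` (U \<inter> hh))"
      using Q_quotient unfolding quotient_map_def topspace_euclidean_subtopology by blast
  qed
  have "openin (subtopology (M0 \<Lambda>) (N0_incl \<Lambda> ` topspace (N0 \<Lambda>))) (N0_incl \<Lambda> ` Q ` (U \<inter> hh))"
    using oQ embedded homeomorphic_imp_open_map
    unfolding N0_properly_embedded_def embedding_map_def open_map_def by blast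
  moreover have "N0_incl \<Lambda> ` Q ` (U \<inter> hh) = P ` (U \<inter> hh)" using incl_Q by (auto simp: image_image)
  ultimately obtain V where V: "openin (M0 \<Lambda>) V" "P ` (U \<inter> hh) = V \<inter> P ` hh"
    using N0_image_eq by (auto simp: openin_subtopology N0_image_def)
  have "openin (top_of_set kk) ({x \<in> kk. P x \<in> V} \<inter> U)"
    using openin_continuous_map_preimage[OF P_continuous V(1)] U by auto
  moreover have "u \<in> {x \<in> kk. P x \<in> V} \<inter> U" using u uk U V by blast
  ultimately obtain r where r: "r > 0" "ball u r \<inter> kk \<subseteq> {x \<in> kk. P x \<in> V} \<inter> U"
    unfolding openin_contains_ball by blast
  show thesis
  proof (rule that[of "ball u r \<inter> kk"])
    show "openin (top_of_set kk) (ball u r \<inter> kk)" by (metis Int_commute openin_open_Int open_ball)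
    show "convex (ball u r \<inter> kk)" by (intro convex_Int convex_ball convex_kk)
    show "u \<in> ball u r \<inter> kk" using r uk by simp
    show "ball u r \<inter> kk \<inter> walls \<subseteq> hh"
    proof
      fix x assume x: "x \<in> ball u r \<inter> kk \<inter> walls"
      then have xx: "x \<in> U" "P x \<in> V" using r by auto
      moreover have "P x \<in> P ` hh" using x by (simp add: walls_eq N0_image_eq)
      ultimately have "P x \<in> P ` (U \<inter> hh)" using V by blast
      then obtain y where y: "y \<in> U" "y \<in> hh" "P y = P x" by auto
      then obtain A where "A \<in> \<Lambda>" "x = pact A y" using P_eq_iff[of y x] hh_in_kk Ukk xx by blast
      then show "x \<in> hh" using wand[of A y] y xx Ukk hh_in_kk by auto
    qed
  qed
qed

section \<open>Tiles: components of the complement of the walls\<close>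

definition tile :: "'n rvec \<Rightarrow> 'n rvec set" where
  "tile x = connected_component_of_set (top_of_set (kk - walls)) x"

lemma mem_tile_iff:
  assumes "x \<in> kk - walls"
  shows "y \<in> tile x \<longleftrightarrow> y \<in> kk - walls \<and> tile y = tile x"
  using assms connected_component_of_equiv[of "top_of_set (kk - walls)" x y]
  by (auto simp: tile_def Collect_inj)

lemma tile_eqI:
  assumes "connected X" "X \<subseteq> kk - walls" "x \<in> X" "y \<in> X"
  shows "tile x = tile y"
proof -
  have "connected_component_of (top_of_set (kk - walls)) x y"
    using assms by (auto simp: connected_component_of_def connectedin_subtopology intro!: exI[of _ X])
  then have "y \<in> tile x" by (simp add: tile_def)
  then show ?thesis using assms mem_tile_iff[of x y] by auto
qed

lemma pact_tile_homeo:
  assumes A: "A \<in> \<Lambda>"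
  shows "homeomorphic_map (top_of_set (kk - walls)) (top_of_set (kk - walls)) (pact A)"
proof -
  have c: "continuous_map (top_of_set (kk - walls)) (top_of_set (kk - walls)) (pact B)" if "B \<in> \<Lambda>" for B
    using continuous_on_subset[OF continuous_on_pact[OF SO[OF that]], of "kk - walls"]
      pact_walls_iff[OF that] SO[OF that] by auto
  have "homeomorphic_maps (top_of_set (kk - walls)) (top_of_set (kk - walls)) (pact A) (pact (matrix_inv A))"
    unfolding homeomorphic_maps_def using c[OF A] c[OF inv[OF A]] pact_inv_left[OF A] pact_inv_right[OF A] by auto
  then show ?thesis using homeomorphic_map_maps by blast
qed

lemma tile_pact: "A \<in> \<Lambda> \<Longrightarrow> x \<in> kk - walls \<Longrightarrow> tile (pact A x) = pact A ` tile x"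
  unfolding tile_def using homeomorphic_map_connected_component_of[OF pact_tile_homeo] by auto

lemma tiling_homeo:
  "homeomorphic_map (top_of_set (kk - walls))
     (subtopology proj_space (Omega0 - (\<Union>A\<in>\<Lambda>. act A ` Hyp))) (\<lambda>x :: 'n rvec. span {x})"
proof -
  have sp: "topspace (subtopology proj_space Omega0) = (\<lambda>x :: 'n rvec. span {x}) ` kk"
    using homeomorphic_imp_surjective_map[OF span_homeomorphic] by (metis topspace_euclidean_subtopology)
  have im: "(\<Union>A\<in>\<Lambda>. act A ` Hyp) = (\<lambda>x. span {x}) ` walls"
    unfolding walls_def wall_def Hyp_eq image_UN image_image
    using act_span_pact SO hh_in_kk by (intro SUP_cong refl image_cong) auto
  have mem: "span {x} \<in> (\<lambda>x. span {x}) ` walls \<longleftrightarrow> x \<in> walls" if "x \<in> kk" for x :: "'n rvec"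
    using that walls_kk span_eq_iff_kk by blast
  have "homeomorphic_map (subtopology (top_of_set kk) (kk - walls))
     (subtopology (subtopology proj_space Omega0) (Omega0 - (\<Union>A\<in>\<Lambda>. act A ` Hyp))) (\<lambda>x :: 'n rvec. span {x})"
  proof (rule homeomorphic_map_subtopologies[OF span_homeomorphic])
    show "(\<lambda>x. span {x}) ` (topspace (top_of_set kk) \<inter> (kk - walls)) =
        topspace (subtopology proj_space Omega0) \<inter> (Omega0 - (\<Union>A\<in>\<Lambda>. act A ` Hyp))"
      unfolding im sp unfolding Omega0_eq using mem by auto
  qed
  moreover have "kk \<inter> (kk - walls) = kk - walls" "Omega0 \<inter> (Omega0 - X) = Omega0 - X" for X :: "'n rvec set set"
    by auto
  ultimately show ?thesis by (simp add: subtopology_subtopology)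
qed

lemma tile_components:
  "components_of_tiling \<Lambda> = (\<lambda>x. (\<lambda>y. span {y}) ` tile x) ` (kk - walls)"
  unfolding components_of_tiling_def homeomorphic_map_connected_components_of[OF tiling_homeo]
  by (simp add: connected_components_of_def tile_def image_image)

lemma tile_subset: "x \<in> kk - walls \<Longrightarrow> tile x \<subseteq> kk - walls"
  using mem_tile_iff by blast

lemma borders_tile:
  assumes "x \<in> kk - walls" "borders_Hyp ((\<lambda>y. span {y}) ` tile x)" "u \<in> hh"
  shows "u \<in> top_of_set kk closure_of tile x"
proof -
  have sub: "tile x \<subseteq> topspace (top_of_set kk)" using tile_subset[OF assms(1)] by auto
  have "span {u} \<in> (\<lambda>y. span {y}) ` (top_of_set kk closure_of tile x)"
    using assms homeomorphic_map_closure_of[OF span_homeomorphic sub] by (auto simp: borders_Hyp_def Hyp_eq)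
  then obtain v where v: "v \<in> top_of_set kk closure_of tile x" "span {u} = span {v}" by blast
  moreover have "v \<in> kk" using v(1) closure_of_subset_topspace by fastforce
  ultimately show ?thesis using span_eq_iff_kk[of u v] assms hh_in_kk by auto
qed

text \<open>Each half of W off the hyperplane is convex and misses every wall, so it is contained in
  one tile.\<close>

lemma tile_same_side:
  assumes W: "convex W" "W \<subseteq> kk" "W \<inter> walls \<subseteq> hh"
    and xy: "x \<in> W - walls" "y \<in> W - walls" "x $ ifirst > 0 \<longleftrightarrow> y $ ifirst > 0"
  shows "tile x = tile y"
proof -
  have nz: "z $ ifirst \<noteq> 0" if "z \<in> W - walls" for z
  proof
    assume "z $ ifirst = 0"
    then have "z \<in> wall (mat 1)" using that W wall_one by (auto simp: hh_def)
    then show False using that one by (auto simp: walls_def)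
  qed
  have conv: "convex {z :: 'n rvec. z $ ifirst > 0}" "convex {z :: 'n rvec. z $ ifirst < 0}"
    using convex_halfspace_gt[of 0 "axis (ifirst :: 'n) (1 :: real)"]
      convex_halfspace_lt[of "axis (ifirst :: 'n) (1 :: real)" 0]
    by (simp_all add: inner_axis')
  show ?thesis
  proof (cases "x $ ifirst > 0")
    case True
    then show ?thesis
      using W xy conv by (intro tile_eqI[of "W \<inter> {z. z $ ifirst > 0}"] convex_connected convex_Int)
        (auto simp: hh_def)
  next
    case False
    then show ?thesis
      using W xy conv nz[of x] nz[of y] by (intro tile_eqI[of "W \<inter> {z. z $ ifirst < 0}"] convex_connected convex_Int)
        (auto simp: hh_def)
  qed
qed

text \<open>Near a point of \<open>hh\<close> there are only two sides, hence at most two tiles. Two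
  distinct tiles bordering \<open>hh\<close> exhaust them, and A^{-1} carries a tile adherent to
  \<open>wall A\<close> to a tile adherent to \<open>hh\<close>.\<close>

lemma two_tiles:
  assumes c: "c \<in> kk - walls" "c' \<in> kk - walls" "tile c \<noteq> tile c'"
    and b: "borders_Hyp ((\<lambda>y. span {y}) ` tile c)" "borders_Hyp ((\<lambda>y. span {y}) ` tile c')"
    and m: "m \<in> kk - walls" "A \<in> \<Lambda>" "u \<in> wall A" "u \<in> top_of_set kk closure_of tile m"
  shows "tile (pact (matrix_inv A) m) = tile c \<or> tile (pact (matrix_inv A) m) = tile c'"
proof -
  let ?B = "matrix_inv A"
  have B: "?B \<in> \<Lambda>" using m inv by blast
  have u: "u \<in> kk" using m wall_kk by auto
  have Bu: "pact ?B u \<in> hh" using in_wall_iff m u by blast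
  obtain W where W: "openin (top_of_set kk) W" "convex W" "pact ?B u \<in> W" "W \<inter> walls \<subseteq> hh"
    using locally_one_wall[OF Bu] by metis
  have Wkk: "W \<subseteq> kk" using openin_imp_subset[OF W(1)] .
  have pt: "\<exists>x \<in> W - walls. tile x = tile d" if "d \<in> kk - walls" "borders_Hyp ((\<lambda>y. span {y}) ` tile d)" for d
    using borders_tile[OF that Bu] W that unfolding in_closure_of by (metis DiffE DiffI mem_tile_iff)
  obtain x where x: "x \<in> W - walls" "tile x = tile c" using pt c b by blast
  obtain x' where x': "x' \<in> W - walls" "tile x' = tile c'" using pt c b by blast
  have "openin (top_of_set kk) {z \<in> kk. pact ?B z \<in> W}" (is "openin _ ?O")
    using openin_continuous_map_preimage[of "top_of_set kk" "top_of_set kk" "pact ?B" W]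
      continuous_on_pact[OF SO[OF B]] SO[OF B] W by auto
  moreover have "u \<in> ?O" using u W(3) by simp
  ultimately obtain z where "z \<in> tile m" "z \<in> ?O"
    using m(4) unfolding in_closure_of by metis
  then have z: "z \<in> kk" "pact ?B z \<in> W" "z \<in> tile m" by auto
  have z': "z \<in> kk - walls" "tile z = tile m" using z m mem_tile_iff by auto
  then have "tile (pact ?B z) = tile (pact ?B m)" using tile_pact B m by metis
  moreover have "pact ?B z \<in> W - walls" using z z' pact_walls_iff B by auto
  ultimately have y: "pact ?B z \<in> W - walls" "tile (pact ?B z) = tile (pact ?B m)" by auto
  have "(pact ?B z $ ifirst > 0 \<longleftrightarrow> x $ ifirst > 0) \<or> (pact ?B z $ ifirst > 0 \<longleftrightarrow> x' $ ifirst > 0)"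
    using tile_same_side[OF W(2) Wkk W(4) x(1) x'(1)] x x' c by auto
  then show ?thesis
    using tile_same_side[OF W(2) Wkk W(4) y(1) x(1)] tile_same_side[OF W(2) Wkk W(4) y(1) x'(1)] x x' y by auto
qed

end

section \<open>Nested hyperplanes\<close>

text \<open>A vector with q \<le> 0 lies in the future cone or in its negative; the pairing with a
  single point of the ball tells which.\<close>

lemma futI_bil:
  assumes "\<tau> \<in> kk" "qform w \<le> 0" "bil \<tau> w \<le> 0"
  shows "w \<in> fut"
proof (rule ccontr)
  assume w: "w \<notin> fut"
  then have "- w \<in> fut" "w \<noteq> 0" using assms(2) by (auto simp: fut_def qform_eq_bil bil_simps)
  then have "bil \<tau> (- w) < 0" using bil_kk_fut_neg[OF assms(1)] by simp
  then show False using assms(3) by (simp add: bil_simps)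
qed

lemma fut_normalize:
  assumes "z \<in> fut" "qform z < 0"
  shows "z $ ilast > 0" "(1 / z $ ilast) *\<^sub>R z \<in> kk"
proof -
  have "z $ ilast \<noteq> 0" using assms by (auto simp: qform_spatial)
  then show "z $ ilast > 0" using assms by (simp add: fut_def)
  then show "(1 / z $ ilast) *\<^sub>R z \<in> kk" using assms by (simp add: kk_def qform_scaleR mult_pos_neg)
qed

text \<open>Removing the component along v lowers q by (bil v z)^2 and leaves the pairing with x
  unchanged, because x is orthogonal to v.\<close>

lemma bil_project_fut:
  assumes v: "bil v v = 1" and x: "x \<in> kk" "bil v x = 0" and z: "z \<in> fut"
  shows "z - bil v z *\<^sub>R v \<in> fut"
proof (rule futI_bil[OF x(1)])
  have "qform (z - bil v z *\<^sub>R v) = qform z - (bil v z)\<^sup>2"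
    using v by (simp add: qform_eq_bil bil_simps bil_commute[of z v] power2_eq_square)
  then show "qform (z - bil v z *\<^sub>R v) \<le> 0" using z by (simp add: fut_def) (smt (verit) zero_le_power2)
  show "bil x (z - bil v z *\<^sub>R v) \<le> 0"
    using bil_fut_nonpos[of x z] x z kk_subset_fut by (auto simp: bil_simps bil_commute[of x v])
qed

text \<open>The slice of the ball by the hyperplane is convex. If v changed sign on it, v would
  vanish on a segment inside it; s is the zero of that affine function.\<close>

lemma bil_sign_on_hyperplane:
  assumes disj: "\<And>z. z \<in> kk \<Longrightarrow> bil v' z = 0 \<Longrightarrow> bil v z \<noteq> 0"
    and x: "x \<in> kk" "bil v' x = 0" "bil v x > 0" and z: "z \<in> kk" "bil v' z = 0"
  shows "bil v z > 0"
proof (rule ccontr)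
  assume "\<not> bil v z > 0"
  then have neg: "bil v z < 0" using disj[OF z] by simp
  define s where "s = bil v x / (bil v x - bil v z)"
  have s: "0 \<le> s" "s \<le> 1" using x neg by (auto simp: s_def field_simps)
  let ?w = "(1 - s) *\<^sub>R x + s *\<^sub>R z"
  have "?w \<in> kk" by (rule convexD_alt[OF convex_kk x(1) z(1) s])
  moreover have "bil v' ?w = 0" using x z by (simp add: bil_simps)
  moreover have "bil v ?w = 0"
    using x neg by (simp add: bil_simps s_def field_simps)
  ultimately show False using disj by blast
qed

text \<open>Both normals point forward: x on the first wall lies behind the second, and x' on the
  second lies ahead of the first. Disjointness is assumed inside the open ball, while the
  conclusions also cover lightlike vectors, where the walls may be asymptotic; hence the weak
  inequalities.\<close>

lemma nested_hyperplanes: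
  assumes v: "bil v v = 1" and v': "bil v' v' = 1"
    and x: "x \<in> kk" "bil v x = 0" "bil v' x < 0" and x': "x' \<in> kk" "bil v' x' = 0" "bil v x' > 0"
    and disj: "\<And>z. z \<in> kk \<Longrightarrow> bil v z = 0 \<Longrightarrow> bil v' z \<noteq> 0"
  shows "\<And>z. z \<in> fut \<Longrightarrow> bil v' z = 0 \<Longrightarrow> bil v z \<ge> 0"
    and "v' - bil v v' *\<^sub>R v \<in> fut" and "bil v v' \<ge> 0"
proof -
  show *: "bil v z \<ge> 0" if z: "z \<in> fut" "bil v' z = 0" for z
  proof (rule ccontr)
    assume "\<not> bil v z \<ge> 0"
    then have neg: "bil v z < 0" by simp
    \<comment> \<open>Chosen so that y = z + e x' is orthogonal to v. Adding a multiple of the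
      timelike x' makes y timelike, so it represents a point of the ball lying on both
      hyperplanes.\<close>
    define e where "e = - bil v z / bil v x'"
    have e: "e > 0" using neg x' by (simp add: e_def divide_neg_pos)
    define y where "y = z + e *\<^sub>R x'"
    have yf: "y \<in> fut" unfolding y_def using z x' e kk_subset_fut by (intro fut_add fut_scaleR) auto
    have "qform y = qform z + 2 * e * bil x' z + e\<^sup>2 * qform x'"
      by (simp add: y_def qform_eq_bil bil_simps bil_commute[of z x'] power2_eq_square algebra_simps)
    moreover have "qform z \<le> 0" using z by (simp add: fut_def)
    moreover have "e * bil x' z \<le> 0"
      using e bil_fut_nonpos[of x' z] z x' kk_subset_fut by (intro mult_nonneg_nonpos) auto
    moreover have "e\<^sup>2 * qform x' < 0" using e x' by (intro mult_pos_neg) (auto simp: kk_def)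
    ultimately have "qform y < 0" by linarith
    note n = fut_normalize[OF yf this]
    have "bil v' y = 0" using z x' by (simp add: y_def bil_simps)
    then have "bil v' ((1 / y $ ilast) *\<^sub>R y) = 0" by (simp add: bil_simps)
    moreover have "bil v a \<noteq> 0" if "a \<in> kk" "bil v' a = 0" for a
      using disj that by blast
    ultimately have "bil v ((1 / y $ ilast) *\<^sub>R y) > 0"
      using bil_sign_on_hyperplane[OF _ x' n(2)] by blast
    then have "bil v y > 0" using n by (simp add: bil_simps zero_less_divide_iff)
    then show False using x' by (simp add: y_def bil_simps e_def)
  qed
  define c where "c = bil v v'"
  define w where "w = v' - c *\<^sub>R v"
  have vw: "bil v w = 0" using v by (simp add: w_def c_def bil_simps)
  have wneg: "bil w z < 0" if z: "z \<in> kk" "bil v z = 0" for z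
  proof -
    have "bil (- v') z > 0"
    proof (rule bil_sign_on_hyperplane[OF _ x(1,2) _ z])
      show "bil (- v') a \<noteq> 0" if "a \<in> kk" "bil v a = 0" for a
        using disj[OF that] by (simp add: bil_simps)
    qed (use x in \<open>simp add: bil_simps\<close>)
    then show ?thesis using z by (simp add: w_def bil_simps)
  qed
  have qw: "qform w \<le> 0"
  proof (rule ccontr)
    assume "\<not> qform w \<le> 0"
    then have pos: "bil w w > 0" by (simp add: qform_eq_bil)
    \<comment> \<open>If w were spacelike, removing from x its component along w would leave a
      timelike vector orthogonal to both v and w, against \<open>wneg\<close>.\<close>
    define z where "z = x - (bil w x / bil w w) *\<^sub>R w"
    have wz: "bil w z = 0" using pos by (simp add: z_def bil_simps)
    have vz: "bil v z = 0" using vw x by (simp add: z_def bil_simps)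
    have xz: "bil x z = qform x - (bil w x)\<^sup>2 / bil w w"
      by (simp add: z_def bil_simps qform_eq_bil bil_commute[of x w] power2_eq_square)
    have "qform x < 0" using x by (simp add: kk_def)
    moreover have "(bil w x)\<^sup>2 / bil w w \<ge> 0" using pos by simp
    ultimately have xz': "bil x z < 0" unfolding xz by linarith
    have "qform z = bil x z - (bil w x / bil w w) * bil w z"
      unfolding qform_eq_bil by (subst (2) z_def) (simp add: bil_simps bil_commute[of z])
    then have qz: "qform z < 0" using wz xz' by simp
    have "z \<in> fut" using futI_bil[OF x(1)] qz xz' by simp
    note n = fut_normalize[OF this qz]
    have "bil w ((1 / z $ ilast) *\<^sub>R z) < 0" using n vz by (intro wneg) (auto simp: bil_simps)
    then show False using wz by (simp add: bil_simps)
  qed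
  have wf: "w \<in> fut" using futI_bil[OF x(1) qw] wneg[OF x(1,2)] bil_commute[of x w] by simp
  then show "v' - bil v v' *\<^sub>R v \<in> fut" by (simp add: w_def c_def)
  have x'f: "x' \<in> fut" using x' kk_subset_fut by auto
  \<comment> \<open>Pair v' with the decomposition x' = y + (bil v x') v. The total is 0, and on y,
    which is orthogonal to v, pairing with v' agrees with pairing with the future vector w.\<close>
  define y where "y = x' - bil v x' *\<^sub>R v"
  have yf: "y \<in> fut" unfolding y_def by (rule bil_project_fut[OF v x(1,2) x'f])
  have "0 = bil v' y + bil v x' * c"
    using x' by (simp add: y_def bil_simps c_def bil_commute[of v' v])
  moreover have "bil v y = 0" using v by (simp add: y_def bil_simps)
  then have "bil v' y = bil w y" by (simp add: w_def bil_simps)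
  moreover have "bil w y \<le> 0" by (rule bil_fut_nonpos[OF wf yf])
  ultimately have "bil v x' * c \<ge> 0" by linarith
  then show "bil v v' \<ge> 0" using x' by (simp add: c_def zero_le_mult_iff)
qed

section \<open>Bends\<close>

definition diag2 :: "'n \<Rightarrow> real \<Rightarrow> real \<Rightarrow> 'n::finite sqmat" where
  "diag2 k c d = (\<chi> i j. if i \<noteq> j then 0 else if i = k then d else c)"

text \<open>A scalar on the wall and another on its normal, both positive. The determinant is left
  free, so the identity, the bending matrix and its inverse are treated alike.\<close>

definition bends :: "'n::{finite,linorder} sqmat set" where
  "bends = {diag2 ifirst c d | c d. c > 0 \<and> d > 0}"

lemma diag2_nth: "(diag2 k c d *v x) $ i = (if i = k then d else c) * x $ i"
proof -
  have "(diag2 k c d *v x) $ i = (\<Sum>j\<in>UNIV. if j = i then (if i = k then d else c) * x $ i else 0)"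
    unfolding diag2_def matrix_vector_mult_def vec_lambda_beta by (intro sum.cong refl) auto
  then show ?thesis by simp
qed

lemma diag2_apply: "diag2 k c d *v x = c *\<^sub>R x + ((d - c) * x $ k) *\<^sub>R axis k 1"
  by (simp add: vec_eq_iff diag2_nth) (simp add: axis_def algebra_simps)

lemma diag2_mult: "diag2 k c d ** diag2 k c' d' = diag2 k (c * c') (d * d')"
  by (rule matrix_eq[THEN iffD2]) (simp add: vec_eq_iff diag2_nth flip: matrix_vector_mul_assoc)

lemma diag2_one: "diag2 k 1 1 = mat 1"
  by (rule matrix_eq[THEN iffD2]) (simp add: vec_eq_iff diag2_nth)

lemma det_diag2: "det (diag2 k c d :: 'n::finite sqmat) = d * c ^ (CARD('n) - 1)"
proof -
  have "det (diag2 k c d :: 'n sqmat) = (\<Prod>i\<in>UNIV. if i = k then d else c)"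
    by (subst det_diagonal) (auto simp: diag2_def)
  also have "\<dots> = d * (\<Prod>i\<in>UNIV - {k}. if i = k then d else c)"
    by (subst prod.remove[of UNIV k]) auto
  also have "(\<Prod>i\<in>UNIV - {k}. if i = k then d else c) = (\<Prod>i\<in>UNIV - {k}. c)"
    by (intro prod.cong) auto
  finally show ?thesis by (simp add: card_Diff_singleton)
qed

lemma matrix_inv_eqI:
  fixes A B :: "'n::finite sqmat"
  assumes "A ** B = mat 1"
  shows "matrix_inv A = B"
proof -
  have BA: "B ** A = mat 1" using assms matrix_left_right_inverse by blast
  then have "\<exists>B. A ** B = mat 1 \<and> B ** A = mat 1" using assms by blast
  then have "matrix_inv A ** A = mat 1"
    unfolding matrix_inv_def by (rule someI2_ex) simp
  then have "matrix_inv A ** (A ** B) = B" by (simp add: matrix_mul_assoc)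
  then show ?thesis using assms by simp
qed

lemma bends_one: "mat 1 \<in> bends"
  unfolding bends_def diag2_one[of ifirst, symmetric] by force

lemma diag2_inv: "c > 0 \<Longrightarrow> d > 0 \<Longrightarrow> matrix_inv (diag2 k c d) = diag2 k (1 / c) (1 / d)"
  by (rule matrix_inv_eqI) (simp add: diag2_mult diag2_one)

lemma bends_inv:
  assumes "B \<in> bends"
  shows "matrix_inv B \<in> bends" "B ** matrix_inv B = mat 1"
proof -
  obtain c d where B: "B = diag2 ifirst c d" "c > 0" "d > 0" using assms by (auto simp: bends_def)
  moreover have "1 / c > 0" "1 / d > 0" using B by simp_all
  ultimately show "matrix_inv B \<in> bends" by (simp only: diag2_inv bends_def) blast
  show "B ** matrix_inv B = mat 1" using B by (simp add: diag2_inv diag2_mult diag2_one)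
qed

lemma bending_matrix_diag2: "bending_matrix n t = diag2 ifirst (exp (- t)) (exp (real n * t))"
  by (simp add: bending_matrix_def diag2_def)

lemma bending_matrix_bends: "bending_matrix n t \<in> bends"
  unfolding bending_matrix_diag2 bends_def using exp_gt_zero by blast

section \<open>The bent representation\<close>

context tiling begin

text \<open>The relation between consecutive walls met by a segment: equal walls, or walls bordering
  a common tile. On such pairs separating and nonseparating bending give the same shape of r (A^{-1}
  B).\<close>

definition link :: "'n sqmat \<Rightarrow> 'n sqmat \<Rightarrow> bool" where
  "link A B \<longleftrightarrow> matrix_inv A ** B \<in> \<Delta> \<or>
     (\<exists>u\<in>wall A. \<exists>w\<in>wall B. u \<noteq> w \<and> open_segment u w \<inter> walls = {})"

lemma convex_wall:
  assumes "A \<in> \<Lambda>"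
  shows "convex (wall A)"
proof -
  have "wall A = kk \<inter> {x. (matrix_inv A *v x) $ ifirst = 0}"
    using in_wall_iff_linear[OF assms] wall_kk[OF assms] by auto
  moreover have "convex {x. (matrix_inv A *v x) $ ifirst = 0}"
    by (auto simp: convex_def matrix_vector_right_distrib matrix_vector_mult_scaleR)
  ultimately show ?thesis using convex_kk convex_Int by metis
qed

text \<open>A path runs from A p inside \<open>wall A\<close> to u, straight to w, then inside
  \<open>wall B\<close> to B p, and is pulled back by A^{-1}. Off the hypersurface its projection
  stays in the image of one connected set, hence on one side.\<close>

lemma link_loop:
  assumes p: "p \<in> hh" and AB: "A \<in> \<Lambda>" "B \<in> \<Lambda>" and l: "link A B"
  obtains f S where "f \<in> cls p (matrix_inv A ** B)" "f ` {0..1} \<subseteq> N0_image \<Lambda> \<union> P ` S"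
    "S \<subseteq> kk - walls" "connected S"
proof -
  have pk: "p \<in> kk" using p hh_in_kk by blast
  have "\<exists>u\<in>wall A. \<exists>w\<in>wall B. open_segment u w \<inter> walls = {}"
    using l unfolding link_def
  proof
    \<comment> \<open>Equal walls: u = w = \<open>pact A p\<close> works, and the open segment is
      empty.\<close>
    assume D: "matrix_inv A ** B \<in> \<Delta>"
    have "p \<in> pact (matrix_inv A ** B) ` hh" using stab_hh(2)[OF D] p by simp
    then obtain y where y: "y \<in> hh" "pact (matrix_inv A ** B) y = p" by blast
    have "pact A p = pact (A ** (matrix_inv A ** B)) y"
      unfolding y(2)[symmetric] using stab_hh(1)[OF D] y(1) hh_in_kk SO by (intro pact_mult) auto
    also have "A ** (matrix_inv A ** B) = B" using inv_right[OF AB(1)] by (simp add: matrix_mul_assoc)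
    finally have "pact A p = pact B y" .
    then have "pact A p \<in> wall A" "pact A p \<in> wall B" using p y by (auto simp: wall_def intro!: rev_image_eqI)
    then show ?thesis by (intro bexI[of _ "pact A p"]) auto
  qed blast
  then obtain u w where uw: "u \<in> wall A" "w \<in> wall B" "open_segment u w \<inter> walls = {}" by blast
  have kk: "u \<in> kk" "w \<in> kk" using uw wall_kk AB by auto
  let ?a = "pact A p" and ?b = "pact B p"
  have ab: "?a \<in> wall A" "?b \<in> wall B" using p by (auto simp: wall_def)
  define g where "g = linepath ?a u +++ linepath u w +++ linepath w ?b"
  have pi: "path_image g = closed_segment ?a u \<union> (closed_segment u w \<union> closed_segment w ?b)"
    unfolding g_def by (simp add: path_image_join)
  have s1: "closed_segment ?a u \<subseteq> wall A" using ab uw convex_wall[OF AB(1)] by (simp add: closed_segment_subset)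
  have s3: "closed_segment w ?b \<subseteq> wall B" using ab uw convex_wall[OF AB(2)] by (simp add: closed_segment_subset)
  have s2: "open_segment u w \<subseteq> kk"
    using closed_segment_subset[OF kk convex_kk] segment_open_subset_closed by blast
  have "path_image g \<subseteq> wall A \<union> wall B \<union> open_segment u w"
    unfolding pi using s1 s3 uw by (auto simp: closed_segment_eq_open)
  moreover have "wall A \<union> wall B \<subseteq> walls" using AB by (auto simp: walls_def)
  ultimately have g1: "path_image g \<subseteq> walls \<union> open_segment u w" by auto
  then have gk: "path_image g \<subseteq> kk" using walls_kk s2 by auto
  have "path g" by (simp add: g_def path_join_imp)
  then have pg: "pathin (top_of_set kk) g"
    using gk by (auto simp: pathin_canon_iff path_image_def image_subset_iff_funcset)
  have g01: "g 0 = ?a" "g 1 = ?b" by (simp_all add: g_def joinpaths_def linepath_def)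
  let ?i = "matrix_inv A"
  have i: "?i \<in> \<Lambda>" using inv AB by blast
  have "pathin (top_of_set kk) (pact ?i \<circ> g)"
    using pathin_compose[OF pg, of "top_of_set kk" "pact ?i"] continuous_on_pact SO[OF i] by auto
  moreover have "(pact ?i \<circ> g) 0 = p" "(pact ?i \<circ> g) 1 = pact (?i ** B) p"
    using AB pk i SO by (auto simp: g01 pact_mult inv_left)
  ultimately have "(\<lambda>s. P ((pact ?i \<circ> g) s)) \<in> cls p (?i ** B)"
    using projected_path_in_cls[OF pk mult[OF i AB(2)]] by blast
  moreover have "(\<lambda>s. P ((pact ?i \<circ> g) s)) ` {0..1} \<subseteq> N0_image \<Lambda> \<union> P ` open_segment u w"
  proof
    fix z assume "z \<in> (\<lambda>s. P ((pact ?i \<circ> g) s)) ` {0..1}"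
    then obtain s where s: "s \<in> {0..1}" "z = P (pact ?i (g s))" by auto
    then have "g s \<in> path_image g" by (auto simp: path_image_def)
    moreover from this have "z = P (g s)" using s P_pact[OF i] gk by auto
    ultimately show "z \<in> N0_image \<Lambda> \<union> P ` open_segment u w" using g1 by (auto simp: walls_eq)
  qed
  moreover have "open_segment u w \<subseteq> kk - walls" using s2 uw by auto
  moreover have "connected (open_segment u w)" by (simp add: convex_connected)
  ultimately show thesis using that by blast
qed

lemma rho_cls_mult:
  assumes "\<rho> \<in> hom (pi1_M0 \<Lambda> (span {p})) SL" and "p \<in> kk" and "A \<in> \<Lambda>" "B \<in> \<Lambda>"
  shows "\<rho> (cls p (A ** B)) = \<rho> (cls p A) ** \<rho> (cls p B)"
  using assms hom_mult[OF assms(1), of "cls p A" "cls p B"]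
  by (simp add: carrier_pi1 mult_pi1)

text \<open>The loop of \<open>link_loop\<close> lies in one of the two closed sides, where the
  representation is the holonomy or its conjugate by the bending matrix.\<close>

lemma separating_link:
  assumes \<rho>: "separating_bending n t \<Lambda> (span {p}) \<rho>"
    and p: "p \<in> hh" and AB: "A \<in> \<Lambda>" "B \<in> \<Lambda>" and l: "link A B"
  shows "\<exists>a\<in>bends. \<exists>b\<in>bends. \<rho> (cls p (matrix_inv A ** B)) = a ** (matrix_inv A ** B) ** b"
proof -
  let ?D = "matrix_inv A ** B" and ?a = "bending_matrix n t :: 'n sqmat"
  have pk: "p \<in> kk" using p hh_in_kk by blast
  have D: "?D \<in> \<Lambda>" using AB inv mult by blast
  have hol: "holonomy \<Lambda> (span {p}) (cls p ?D) = ?D" by (rule holonomy_cls[OF pk D])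
  obtain Mg Md where M: "connected_components_of (complement_N0 \<Lambda>) = {Mg, Md}"
    and g: "\<And>c. c \<in> pi1_image (M0 \<Lambda>) (orb \<Lambda> (span {p})) (Mg \<union> N0_image \<Lambda>) \<Longrightarrow> \<rho> c = holonomy \<Lambda> (span {p}) c"
    and d: "\<And>c. c \<in> pi1_image (M0 \<Lambda>) (orb \<Lambda> (span {p})) (Md \<union> N0_image \<Lambda>) \<Longrightarrow>
       \<rho> c = ?a ** holonomy \<Lambda> (span {p}) c ** matrix_inv ?a"
    using \<rho> unfolding separating_bending_def by blast
  obtain f S where f: "f \<in> cls p ?D" "f ` {0..1} \<subseteq> N0_image \<Lambda> \<union> P ` S"
    and S: "S \<subseteq> kk - walls" "connected S"
    using link_loop[OF p AB l] by metis
  have "connectedin (M0 \<Lambda>) (P ` S)"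
    using S by (intro connectedin_continuous_map_image[OF P_continuous]) (auto simp: connectedin_subtopology)
  moreover have "P ` S \<subseteq> topspace (M0 \<Lambda>) - N0_image \<Lambda>"
    using S by (auto simp: topspace_M0 walls_eq)
  ultimately have con: "connectedin (complement_N0 \<Lambda>) (P ` S)"
    by (simp add: complement_N0_def connectedin_subtopology)
  have "P ` S \<subseteq> Mg \<or> P ` S \<subseteq> Md"
  proof (cases "S = {}")
    case False
    then obtain x where x: "x \<in> S" by blast
    then have "P x \<in> topspace (complement_N0 \<Lambda>)" using connectedin_subset_topspace[OF con] by blast
    then have "P x \<in> \<Union>(connected_components_of (complement_N0 \<Lambda>))"
      by (simp only: Union_connected_components_of)
    then obtain C where C: "C \<in> connected_components_of (complement_N0 \<Lambda>)" "P x \<in> C" by blast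
    then have "P ` S \<subseteq> C" using connected_components_of_maximal[OF C(1) con] x by (auto simp: disjnt_iff)
    then show ?thesis using C M by auto
  qed auto
  moreover have car: "cls p ?D \<in> carrier (fundamental_group (M0 \<Lambda>) (orb \<Lambda> (span {p})))"
    using carrier_pi1[OF pk] D by (auto simp: pi1_M0_def)
  have "cls p ?D \<in> pi1_image (M0 \<Lambda>) (orb \<Lambda> (span {p})) (M \<union> N0_image \<Lambda>)" if "P ` S \<subseteq> M" for M
    unfolding pi1_image_def using car f that by (intro CollectI conjI bexI[of _ f]) auto
  ultimately have "cls p ?D \<in> pi1_image (M0 \<Lambda>) (orb \<Lambda> (span {p})) (Mg \<union> N0_image \<Lambda>) \<or>
      cls p ?D \<in> pi1_image (M0 \<Lambda>) (orb \<Lambda> (span {p})) (Md \<union> N0_image \<Lambda>)"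
    by (elim disjE) simp_all
  then show ?thesis
  proof
    assume "cls p ?D \<in> pi1_image (M0 \<Lambda>) (orb \<Lambda> (span {p})) (Mg \<union> N0_image \<Lambda>)"
    then have "\<rho> (cls p ?D) = mat 1 ** ?D ** mat 1" using g hol by simp
    then show ?thesis using bends_one by blast
  next
    assume "cls p ?D \<in> pi1_image (M0 \<Lambda>) (orb \<Lambda> (span {p})) (Md \<union> N0_image \<Lambda>)"
    then have "\<rho> (cls p ?D) = ?a ** ?D ** matrix_inv ?a" using d hol by simp
    then show ?thesis using bending_matrix_bends bends_inv by blast
  qed
qed

text \<open>The representation is known on the stabilizer of the base tile and on the stable letter,
  whose holonomy h moves the base tile to the other side of \<open>hh\<close>. A tile m bordering
  both walls is A x and also B z applied to the base tile, with x and z in {1, h}. So (A x)^{-1} (B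
  z) stabilizes the base tile, and the value of r on A^{-1} B is solved from this relation.\<close>

lemma nonseparating_link:
  assumes hom: "\<rho> \<in> hom (pi1_M0 \<Lambda> (span {p})) SL"
    and \<rho>: "nonseparating_bending n t \<Lambda> (span {p}) \<rho>"
    and p: "p \<in> hh" and AB: "A \<in> \<Lambda>" "B \<in> \<Lambda>" and l: "link A B"
  shows "\<exists>a\<in>bends. \<exists>b\<in>bends. \<rho> (cls p (matrix_inv A ** B)) = a ** (matrix_inv A ** B) ** b"
proof -
  let ?D = "matrix_inv A ** B" and ?a = "bending_matrix n t :: 'n sqmat"
  let ?s = "\<lambda>y :: 'n rvec. span {y}"
  have pk: "p \<in> kk" using p hh_in_kk by blast
  have D: "?D \<in> \<Lambda>" using AB inv mult by blast
  note hol = holonomy_cls[OF pk]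
  define r where "r E = \<rho> (cls p E)" for E
  have rm: "r (E ** F) = r E ** r F" if "E \<in> \<Lambda>" "F \<in> \<Lambda>" for E F
    unfolding r_def using rho_cls_mult[OF hom pk that] .
  obtain C \<alpha> where C: "C \<in> components_of_tiling \<Lambda>" and \<alpha>: "\<alpha> \<in> carrier (pi1_M0 \<Lambda> (span {p}))"
    and ne: "act (holonomy \<Lambda> (span {p}) \<alpha>) ` C \<noteq> C"
    and bC: "borders_Hyp C" "borders_Hyp (act (holonomy \<Lambda> (span {p}) \<alpha>) ` C)"
    and st: "\<And>c. c \<in> carrier (pi1_M0 \<Lambda> (span {p})) \<Longrightarrow> act (holonomy \<Lambda> (span {p}) c) ` C = C \<Longrightarrow>
       \<rho> c = holonomy \<Lambda> (span {p}) c"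
    and \<rho>\<alpha>: "\<rho> \<alpha> = ?a ** holonomy \<Lambda> (span {p}) \<alpha>"
    using \<rho> unfolding nonseparating_bending_def by blast
  obtain h where h: "h \<in> \<Lambda>" "\<alpha> = cls p h" using \<alpha> carrier_pi1[OF pk] by auto
  obtain c where c: "c \<in> kk - walls" "C = ?s ` tile c" using C unfolding tile_components by blast
  define c' where "c' = pact h c"
  have c': "c' \<in> kk - walls" using c h SO pact_walls_iff by (auto simp: c'_def)
  have actC: "act E ` C = ?s ` tile (pact E c)" if E: "E \<in> \<Lambda>" for E
  proof -
    have "act E ` C = (\<lambda>y. span {pact E y}) ` tile c"
      unfolding c(2) image_image using tile_subset[OF c(1)] act_span_pact[OF SO[OF E]] by (intro image_cong) auto
    then show ?thesis using tile_pact[OF E c(1)] by (simp add: image_image)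
  qed
  have nec: "tile c \<noteq> tile c'" using ne actC[OF h(1)] c hol[OF h(1)] h by (auto simp: c'_def)
  have bc: "borders_Hyp (?s ` tile c)" "borders_Hyp (?s ` tile c')"
    using bC actC[OF h(1)] c hol[OF h(1)] h by (auto simp: c'_def)
  have stab: "r E = E" if E: "E \<in> \<Lambda>" "tile (pact E c) = tile c" for E
    unfolding r_def using st[of "cls p E"] E actC[OF E(1)] c hol[OF E(1)] carrier_pi1[OF pk] by auto
  have rh: "r h = ?a ** h" using \<rho>\<alpha> h hol by (simp add: r_def)
  have two: "tile (pact (matrix_inv E) m) = tile c \<or> tile (pact (matrix_inv E) m) = tile c'"
    if "m \<in> kk - walls" "E \<in> \<Lambda>" "u \<in> wall E" "u \<in> top_of_set kk closure_of tile m" for E m u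
    using two_tiles[OF c(1) c' nec bc that] .
  have "\<exists>m\<in>kk - walls. (tile (pact (matrix_inv A) m) = tile c \<or> tile (pact (matrix_inv A) m) = tile c')
      \<and> (tile (pact (matrix_inv B) m) = tile c \<or> tile (pact (matrix_inv B) m) = tile c')"
    using l unfolding link_def
  proof
    assume DD: "?D \<in> \<Delta>"
    \<comment> \<open>For equal walls take m = A c: the base tile borders \<open>hh\<close>, which
      A^{-1} B preserves, so its image under the inverse is again one of the two tiles at
      \<open>hh\<close>.\<close>
    have Ac: "pact A c \<in> kk - walls" using c AB SO pact_walls_iff by auto
    have "wall ?D = hh" using stab_hh(2)[OF DD] by (simp add: wall_def)
    then have "tile (pact (matrix_inv ?D) c) = tile c \<or> tile (pact (matrix_inv ?D) c) = tile c'"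
      using two[OF c(1) D, of p] borders_tile[OF c(1) bc(1) p] p by auto
    moreover have "matrix_inv ?D = matrix_inv B ** A"
    proof (rule matrix_inv_eqI)
      have "matrix_inv A ** B ** (matrix_inv B ** A) = matrix_inv A ** (B ** matrix_inv B) ** A"
        by (simp only: matrix_mul_assoc)
      then show "matrix_inv A ** B ** (matrix_inv B ** A) = mat 1"
        using AB by (simp add: inv_right inv_left)
    qed
    moreover have "pact (matrix_inv B ** A) c = pact (matrix_inv B) (pact A c)"
      using c AB SO by (simp add: pact_mult)
    moreover have "pact (matrix_inv A) (pact A c) = c" using pact_inv_left AB c by blast
    ultimately show ?thesis using Ac by (intro bexI[of _ "pact A c"]) auto
  next
    assume "\<exists>u\<in>wall A. \<exists>w\<in>wall B. u \<noteq> w \<and> open_segment u w \<inter> walls = {}"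
    then obtain u w where uw: "u \<in> wall A" "w \<in> wall B" "u \<noteq> w" "open_segment u w \<inter> walls = {}" by blast
    have kk: "u \<in> kk" "w \<in> kk" using uw wall_kk AB by auto
    have os: "open_segment u w \<subseteq> kk - walls"
      using closed_segment_subset[OF kk convex_kk] segment_open_subset_closed uw by blast
    obtain m where m: "m \<in> open_segment u w" using uw(3) by (metis all_not_in_conv open_segment_eq_empty)
    have ot: "open_segment u w \<subseteq> tile m"
    proof
      fix y assume y: "y \<in> open_segment u w"
      have "connected (open_segment u w)" by (simp add: convex_connected)
      from tile_eqI[OF this os m y] show "y \<in> tile m" using mem_tile_iff[of m y] os m y by blast
    qed
    have "closed_segment u w \<subseteq> closure (tile m)"
      using closure_mono[OF ot] uw(3) by simp
    then have "u \<in> closure (tile m)" "w \<in> closure (tile m)" by auto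
    moreover have "kk \<inter> tile m = tile m" using tile_subset[of m] os m by blast
    ultimately have "u \<in> top_of_set kk closure_of tile m" "w \<in> top_of_set kk closure_of tile m"
      using kk by (auto simp: closure_of_subtopology)
    then show ?thesis using two uw AB os m by blast
  qed
  then obtain m where m: "m \<in> kk - walls"
    and mA: "tile (pact (matrix_inv A) m) = tile c \<or> tile (pact (matrix_inv A) m) = tile c'"
    and mB: "tile (pact (matrix_inv B) m) = tile c \<or> tile (pact (matrix_inv B) m) = tile c'" by blast
  \<comment> \<open>The witness is x = 1 with trivial bend, or x = h with the bending matrix,
    according to the side of \<open>wall E\<close> on which m lies.\<close>
  have side: "\<exists>x\<in>\<Lambda>. \<exists>a\<in>bends. r x = a ** x \<and> tile (pact (E ** x) c) = tile m"
    if E: "E \<in> \<Lambda>" and mE: "tile (pact (matrix_inv E) m) = tile c \<or> tile (pact (matrix_inv E) m) = tile c'" for E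
  proof -
    have *: "tile (pact (E ** x) c) = tile m" if x: "x \<in> \<Lambda>" and t: "tile (pact (matrix_inv E) m) = tile (pact x c)" for x
    proof -
      have "pact (E ** x) c = pact E (pact x c)" using E x c SO by (simp add: pact_mult)
      moreover have "pact x c \<in> kk - walls" using c x SO pact_walls_iff by auto
      moreover have "pact (matrix_inv E) m \<in> kk - walls" using m E inv SO pact_walls_iff by auto
      moreover have "pact E (pact (matrix_inv E) m) = m" using pact_inv_right E m by blast
      ultimately show ?thesis using t tile_pact[OF E] by metis
    qed
    from mE show ?thesis
    proof
      assume "tile (pact (matrix_inv E) m) = tile c"
      then have "tile (pact (E ** mat 1) c) = tile m" using *[OF one] c by simp
      moreover have "r (mat 1) = mat 1 ** mat 1" using stab[OF one] c by simp
      ultimately show ?thesis using one bends_one by blast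
    next
      assume "tile (pact (matrix_inv E) m) = tile c'"
      then have "tile (pact (E ** h) c) = tile m" using *[OF h(1)] by (simp add: c'_def)
      then show ?thesis using rh h(1) bending_matrix_bends by blast
    qed
  qed
  obtain x a where x: "x \<in> \<Lambda>" "a \<in> bends" "r x = a ** x" "tile (pact (A ** x) c) = tile m"
    using side[OF AB(1) mA] by blast
  obtain z b where z: "z \<in> \<Lambda>" "b \<in> bends" "r z = b ** z" "tile (pact (B ** z) c) = tile m"
    using side[OF AB(2) mB] by blast
  define E where "E = matrix_inv (A ** x) ** (B ** z)"
  have Ax: "A ** x \<in> \<Lambda>" "B ** z \<in> \<Lambda>" using AB x z mult by auto
  have E: "E \<in> \<Lambda>" unfolding E_def using Ax mult inv by blast
  have "tile (pact E c) = tile c"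
  proof -
    have "(B ** z) = (A ** x) ** E" unfolding E_def using inv_right[OF Ax(1)] by (simp add: matrix_mul_assoc)
    then have "pact (B ** z) c = pact (A ** x) (pact E c)" using c E SO by (simp add: pact_mult)
    moreover have "pact E c \<in> kk - walls" using c E SO pact_walls_iff by auto
    ultimately have "pact (A ** x) ` tile (pact E c) = pact (A ** x) ` tile c"
      using tile_pact[OF Ax(1)] x z c by metis
    moreover have "inj_on (pact (A ** x)) (kk - walls)"
      using pact_inv_left[OF Ax(1)] by (metis DiffD1 inj_onI)
    ultimately show ?thesis
      using tile_subset[OF \<open>pact E c \<in> kk - walls\<close>] tile_subset[OF c(1)] inj_on_image_eq_iff by blast
  qed
  then have rE: "r E = E" using stab E by blast
  have zi: "z ** matrix_inv z = mat 1" "matrix_inv z \<in> \<Lambda>" using inv_right z inv by auto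
  \<comment> \<open>With D = A^{-1} B this reads x E = D z. Applying r, with r E = E, r x = a x and
    r z = b z, gives r D = a D b^{-1}.\<close>
  have xE: "x ** E = ?D ** z"
  proof -
    have "A ** (x ** E) = B ** z"
      unfolding E_def using inv_right[OF Ax(1)] by (simp add: matrix_mul_assoc)
    then have "matrix_inv A ** (A ** (x ** E)) = matrix_inv A ** (B ** z)" by simp
    then show ?thesis using inv_left[OF AB(1)] by (simp add: matrix_mul_assoc)
  qed
  have "r ?D ** r z = r x ** r E" using rm[OF D z(1)] rm[OF x(1) E] xE by simp
  then have "r ?D ** (b ** z) = a ** (?D ** z)"
    using x z rE xE by (simp add: matrix_mul_assoc[symmetric])
  then have "r ?D ** (b ** z) ** matrix_inv z = a ** (?D ** z) ** matrix_inv z" by simp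
  then have "r ?D ** b = a ** ?D"
    by (simp only: matrix_mul_assoc[symmetric] zi(1) matrix_mul_rid)
  then have "r ?D ** (b ** matrix_inv b) = a ** ?D ** matrix_inv b" by (simp add: matrix_mul_assoc)
  then have "r ?D = a ** ?D ** matrix_inv b" using bends_inv(2)[OF z(2)] by simp
  then show ?thesis using x z bends_inv(1) unfolding r_def by blast
qed

end

section \<open>Sign invariance\<close>

context tiling begin

text \<open>A unit normal of \<open>wall A\<close> for the Lorentz form, without a preferred side;
  orientations are supplied by a sign where needed.\<close>

definition nrm :: "'n sqmat \<Rightarrow> 'n rvec" where
  "nrm A = A *v axis ifirst 1"

lemma bil_e1: "(ifirst :: 'n) \<noteq> ilast \<Longrightarrow> bil (axis ifirst 1) x = x $ ifirst" for x :: "'n rvec"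
  by (rule bil_axis)

lemma bil_nrm:
  assumes ne: "(ifirst :: 'n) \<noteq> ilast" and A: "A \<in> \<Lambda>"
  shows "bil (nrm A) x = (matrix_inv A *v x) $ ifirst"
proof -
  have "bil (nrm A) x = bil (A *v axis ifirst 1) (A *v (matrix_inv A *v x))"
    by (simp only: inv_right_v[OF A] nrm_def)
  then show ?thesis using bil_e1[OF ne] SO_q_bil[OF SO[OF A]] by simp
qed

lemma bil_nrm_self:
  assumes ne: "(ifirst :: 'n) \<noteq> ilast" and A: "A \<in> \<Lambda>"
  shows "bil (nrm A) (nrm A) = 1"
  using bil_e1[OF ne, of "axis ifirst 1"] SO_q_bil[OF SO[OF A]] by (simp add: nrm_def)

lemma in_wall_nrm:
  assumes "(ifirst :: 'n) \<noteq> ilast" "A \<in> \<Lambda>"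
  shows "x \<in> wall A \<longleftrightarrow> x \<in> kk \<and> bil (nrm A) x = 0"
  using in_wall_iff_linear[OF assms(2)] wall_kk[OF assms(2)] bil_nrm[OF assms] by auto

text \<open>Elements of \<open>SO_q\<close> preserve the double cone but may exchange its sheets;
  \<sigma> records this and is read off on the axis of the cone.\<close>

lemma SO_q_fut_sign:
  assumes A: "A \<in> \<Lambda>"
  obtains \<sigma> :: real where "\<sigma> = 1 \<or> \<sigma> = -1" "\<And>x. x \<in> fut \<Longrightarrow> \<sigma> *\<^sub>R (A *v x) \<in> fut"
proof -
  define p :: "'n rvec" where "p = axis ilast 1"
  have pk: "p \<in> kk" by (simp add: kk_iff p_def spatial_def)
  define \<sigma> where "\<sigma> = sgn ((A *v p) $ ilast)"
  have n: "(A *v p) $ ilast \<noteq> 0" by (rule SO_q_last_nonzero[OF SO[OF A] pk])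
  have s: "\<sigma> = 1 \<or> \<sigma> = -1" using n by (auto simp: \<sigma>_def sgn_if)
  have "\<sigma> *\<^sub>R (A *v x) \<in> fut" if x: "x \<in> fut" for x
  proof (rule futI_bil[OF pact_in_kk[OF SO[OF A] pk]])
    show "qform (\<sigma> *\<^sub>R (A *v x)) \<le> 0"
      using x SO_q_qform[OF SO[OF A], of x] by (auto simp: qform_scaleR fut_def intro: mult_nonneg_nonpos)
    have "bil (A *v p) (A *v x) \<le> 0"
      using SO_q_bil[OF SO[OF A], of p x] bil_fut_nonpos[of p x] pk x kk_subset_fut by auto
    moreover have "bil (pact A p) (\<sigma> *\<^sub>R (A *v x)) = \<sigma> / (A *v p) $ ilast * bil (A *v p) (A *v x)"
      by (simp add: pact_def bil_simps)
    moreover have "\<sigma> / (A *v p) $ ilast \<ge> 0" using n by (auto simp: \<sigma>_def sgn_if field_simps)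
    ultimately show "bil (pact A p) (\<sigma> *\<^sub>R (A *v x)) \<le> 0" by (metis mult_nonneg_nonpos)
  qed
  then show thesis using that s by blast
qed

text \<open>A segment tangent to a wall it meets lies in the hyperplane of that wall. Then p is on
  the wall, so the wall is \<open>hh\<close>, which does not contain q.\<close>

lemma transversal:
  assumes ne: "(ifirst :: 'n) \<noteq> ilast" and p: "p \<in> hh" and q: "q \<in> kk" "q \<notin> hh"
    and A: "A \<in> \<Lambda>" and s: "(1 - s) *\<^sub>R p + s *\<^sub>R q \<in> wall A"
  shows "bil (nrm A) (q - p) \<noteq> 0"
proof
  assume D: "bil (nrm A) (q - p) = 0"
  have "(1 - s) *\<^sub>R p + s *\<^sub>R q = p + s *\<^sub>R (q - p)" by (simp add: algebra_simps)
  then have "bil (nrm A) p = 0"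
    using s D unfolding in_wall_nrm[OF ne A] by (simp add: bil_simps)
  moreover from this have "bil (nrm A) q = 0" using D by (simp add: bil_simps)
  ultimately have "p \<in> wall A" "q \<in> wall A" using in_wall_nrm[OF ne A] p q hh_in_kk by auto
  then have "wall A = hh" using walls_meet(2)[OF A one, of p] p wall_one by auto
  then show False using \<open>q \<in> wall A\<close> q by simp
qed

text \<open>The crossing times form a compact set. Near an accumulation time s all crossings belong
  to the wall met at s by \<open>locally_one_wall\<close>, so two points of the segment lie on one
  wall, against transversality.\<close>

lemma finite_crossings:
  assumes ne: "(ifirst :: 'n) \<noteq> ilast" and p: "p \<in> hh" and q: "q \<in> kk" "q \<notin> hh"
  shows "finite {s \<in> {0..1}. (1 - s) *\<^sub>R p + s *\<^sub>R q \<in> walls}"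
proof (rule ccontr)
  let ?I = "{0..1::real}"
  define l where "l s = (1 - s) *\<^sub>R p + s *\<^sub>R q" for s
  let ?S = "{s \<in> ?I. l s \<in> walls}"
  have pk: "p \<in> kk" using p hh_in_kk by blast
  have lk: "l s \<in> kk" if "s \<in> ?I" for s
    unfolding l_def using that convexD_alt[OF convex_kk pk q(1)] by auto
  have cl: "continuous_on ?I l" unfolding l_def by (intro continuous_intros)
  then have lc: "continuous_map (top_of_set ?I) (top_of_set kk) l" using lk by auto
  have "closedin (top_of_set ?I) ?S"
    using closedin_continuous_map_preimage[OF lc closed_walls] by simp
  then have "compact ?S" using closedin_compact compact_Icc by blast
  moreover assume "infinite {s \<in> {0..1}. (1 - s) *\<^sub>R p + s *\<^sub>R q \<in> walls}"
  then have "infinite ?S" by (simp add: l_def)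
  ultimately obtain s where s: "s \<in> ?S" "s islimpt ?S"
    unfolding compact_eq_Bolzano_Weierstrass by blast
  then obtain A where A: "A \<in> \<Lambda>" "l s \<in> wall A" by (auto simp: walls_def)
  let ?i = "matrix_inv A"
  have i: "?i \<in> \<Lambda>" using inv A by blast
  have u: "pact ?i (l s) \<in> hh" using in_wall_iff[OF A(1) lk] s A by auto
  obtain W where W: "openin (top_of_set kk) W" "pact ?i (l s) \<in> W" "W \<inter> walls \<subseteq> hh"
    using locally_one_wall[OF u] by metis
  have "continuous_map (top_of_set ?I) (top_of_set kk) (pact ?i \<circ> l)"
    using continuous_map_compose[OF lc, of "top_of_set kk" "pact ?i"] continuous_on_pact SO[OF i] by auto
  from openin_continuous_map_preimage[OF this W(1)]
  have "openin (top_of_set ?I) {r \<in> ?I. pact ?i (l r) \<in> W}" by simp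
  then obtain X where X: "open X" "{r \<in> ?I. pact ?i (l r) \<in> W} = ?I \<inter> X" unfolding openin_open by blast
  have "s \<in> ?I \<inter> X" unfolding X(2)[symmetric] using s W by auto
  then obtain r where r: "r \<in> ?S" "r \<in> X" "r \<noteq> s" using s(2) X(1) unfolding islimpt_def by blast
  then have "r \<in> ?I \<inter> X" by auto
  then have "pact ?i (l r) \<in> W" unfolding X(2)[symmetric] by simp
  moreover have "pact ?i (l r) \<in> walls" using r pact_walls[OF i] by auto
  ultimately have "pact ?i (l r) \<in> hh" using W by auto
  then have "l r \<in> wall A" using in_wall_iff[OF A(1) lk] r by auto
  then have "bil (nrm A) (l r - l s) = 0"
    using A in_wall_nrm[OF ne A(1)] by (simp add: bil_simps)
  moreover have "l r - l s = (r - s) *\<^sub>R (q - p)" by (simp add: l_def algebra_simps)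
  ultimately have "bil (nrm A) (q - p) = 0" using r by (simp add: bil_simps)
  then show False using transversal[OF ne p q A(1), of s] A by (simp add: l_def)
qed

text \<open>Along the segment from \<open>p\<close> to \<open>\<gamma> p\<close> the functional \<open>z \<mapsto> bil y (r A A\<^sup>-\<^sup>1 z)\<close> of a crossed wall
  \<open>A\<close> stays nonpositive on the future cone of the wall and on its forward normal. Only the ratio
  \<open>d / c > 0\<close> of the eigenvalues of the bends matters for this, not whether it exceeds 1.\<close>

lemma bent_pairing_sign:
  fixes r :: "'n sqmat \<Rightarrow> 'n sqmat" and p :: "'n rvec"
  assumes ne: "(ifirst :: 'n) \<noteq> ilast"
    and rm: "\<And>A B. A \<in> \<Lambda> \<Longrightarrow> B \<in> \<Lambda> \<Longrightarrow> r (A ** B) = r A ** r B"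
    and rl: "\<And>A B. A \<in> \<Lambda> \<Longrightarrow> B \<in> \<Lambda> \<Longrightarrow> link A B \<Longrightarrow>
      \<exists>a\<in>bends. \<exists>b\<in>bends. r (matrix_inv A ** B) = a ** (matrix_inv A ** B) ** b"
    and p: "p \<in> hh" and y: "y \<in> hh" and \<gamma>: "\<gamma> \<in> \<Lambda>"
  shows "\<exists>\<sigma>. (\<sigma> = 1 \<or> \<sigma> = -1) \<and> (\<forall>x\<in>fut. x $ ifirst = 0 \<longrightarrow> \<sigma> * bil y (r \<gamma> *v x) \<le> 0)"
proof -
  have pk: "p \<in> kk" and yk: "y \<in> kk" using p y by (simp_all add: hh_in_kk)
  have yf: "y \<in> fut" using yk kk_subset_fut by auto
  obtain \<sigma> :: real where \<sigma>: "\<sigma> = 1 \<or> \<sigma> = -1" "\<And>x. x \<in> fut \<Longrightarrow> \<sigma> *\<^sub>R (\<gamma> *v x) \<in> fut"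
    using SO_q_fut_sign[OF \<gamma>] by metis
  \<comment> \<open>Since y is on the wall, a bend applied last changes the functional
    \<open>bil y\<close> only by its positive scalar on the wall.\<close>
  have by1: "bil y (axis ifirst 1) = 0" using y bil_e1[OF ne, of y] by (simp add: bil_commute hh_def)
  have inv1: "matrix_inv (mat 1) = (mat 1 :: 'n sqmat)" by (rule matrix_inv_eqI) simp
  have stab_link: "\<exists>a\<in>bends. \<exists>b\<in>bends. r A = a ** A ** b" if "A \<in> \<Delta>" for A
    using rl[OF one stab_hh(1)[OF that]] that by (simp add: link_def inv1)
  define q where "q = pact \<gamma> p"
  have q: "q \<in> kk" using pk \<gamma> SO by (simp add: q_def)
  show ?thesis
  proof (cases "q \<in> hh")
    case True
    then have "\<gamma> \<in> \<Delta>" using return_in_stab[OF p \<gamma>] by (simp add: q_def)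
    then obtain a b where ab: "a \<in> bends" "b \<in> bends" "r \<gamma> = a ** \<gamma> ** b" using stab_link by blast
    obtain ca da where a: "a = diag2 ifirst ca da" "ca > 0" "da > 0" using ab by (auto simp: bends_def)
    obtain cb db where b: "b = diag2 ifirst cb db" "cb > 0" "db > 0" using ab by (auto simp: bends_def)
    have "\<sigma> * bil y (r \<gamma> *v x) \<le> 0" if x: "x \<in> fut" "x $ ifirst = 0" for x
    proof -
      have "bil y (r \<gamma> *v x) = ca * cb * bil y (\<gamma> *v x)"
        using x by1 by (simp add: ab a b diag2_apply bil_simps matrix_vector_mult_scaleR flip: matrix_vector_mul_assoc)
      then have "\<sigma> * bil y (r \<gamma> *v x) = ca * cb * bil y (\<sigma> *\<^sub>R (\<gamma> *v x))" by (simp add: bil_simps)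
      moreover have "bil y (\<sigma> *\<^sub>R (\<gamma> *v x)) \<le> 0" by (rule bil_fut_nonpos[OF yf \<sigma>(2)[OF x(1)]])
      ultimately show ?thesis using a b by (simp add: mult_nonneg_nonpos)
    qed
    then show ?thesis using \<sigma>(1) by blast
  next
    case False
    define l where "l s = (1 - s) *\<^sub>R p + s *\<^sub>R q" for s
    define D where "D = q - p"
    have lD: "l s' - l s = (s' - s) *\<^sub>R D" for s s' by (simp add: l_def D_def algebra_simps)
    have lk: "l s \<in> kk" if "0 \<le> s" "s \<le> 1" for s
      unfolding l_def using that convexD_alt[OF convex_kk pk q] by auto
    define S where "S = {s \<in> {0..1}. l s \<in> walls}"
    have finS: "finite S" unfolding S_def l_def by (rule finite_crossings[OF ne p q False])
    \<comment> \<open>The factor A^{-1} undoes the displacement, so the functionals of successive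
      walls can be compared on the same vectors. Without bending, F would be \<open>bil y\<close>
      for every A.\<close>
    define F where "F A z = bil y (r A *v (matrix_inv A *v z))" for A z
    \<comment> \<open>The sign \<tau> orients the normal along the direction D of travel.\<close>
    define good where "good A \<longleftrightarrow> (\<forall>\<tau>. (\<tau> = 1 \<or> \<tau> = -1) \<and> bil (\<tau> *\<^sub>R nrm A) D > 0 \<longrightarrow>
      (\<forall>z\<in>fut. bil (\<tau> *\<^sub>R nrm A) z = 0 \<longrightarrow> F A z \<le> 0) \<and> F A (\<tau> *\<^sub>R nrm A) \<le> 0)" for A
    have inrm: "matrix_inv A *v nrm A = axis ifirst 1" if "A \<in> \<Lambda>" for A
      unfolding nrm_def by (rule inv_left_v[OF that])
    \<comment> \<open>A wall through p is \<open>hh\<close> itself. On it F is a positive multiple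
      of \<open>bil y\<close>, and F vanishes on the normal, which is orthogonal to y.\<close>
    have base: "good A" if A: "A \<in> \<Lambda>" and pA: "p \<in> wall A" for A
    proof -
      have wA: "wall A = hh" "A \<in> \<Delta>"
        using walls_meet[OF one A, of p] p pA wall_one by (auto simp: inv1)
      obtain a b where ab: "a \<in> bends" "b \<in> bends" "r A = a ** A ** b" using stab_link[OF wA(2)] by blast
      obtain ca da where a: "a = diag2 ifirst ca da" "ca > 0" "da > 0" using ab by (auto simp: bends_def)
      obtain cb db where b: "b = diag2 ifirst cb db" "cb > 0" "db > 0" using ab by (auto simp: bends_def)
      have rA: "F A z = ca * bil y (A *v (b *v (matrix_inv A *v z)))" for z
        using by1 by (simp add: F_def ab a diag2_apply bil_simps flip: matrix_vector_mul_assoc)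
      have "F A z \<le> 0" if z: "z \<in> fut" "bil (nrm A) z = 0" for z
      proof -
        have "F A z = ca * cb * bil y z"
          using z bil_nrm[OF ne A, of z]
          by (simp add: rA b diag2_apply matrix_vector_mult_scaleR inv_right_v[OF A] bil_simps)
        then show ?thesis using bil_fut_nonpos[OF yf z(1)] a b by (simp add: mult_nonneg_nonpos)
      qed
      moreover have "F A (\<tau> *\<^sub>R nrm A) = 0" for \<tau>
      proof -
        have "bil y (nrm A) = 0" using y wA in_wall_nrm[OF ne A, of y] by (simp add: bil_commute)
        moreover have "b *v axis ifirst 1 = db *\<^sub>R (axis ifirst 1 :: 'n rvec)"
          by (simp add: b diag2_apply algebra_simps)
        ultimately show ?thesis
          by (simp add: rA inrm[OF A] matrix_vector_mult_scaleR bil_simps) (simp add: nrm_def)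
      qed
      ultimately show ?thesis unfolding good_def by (auto simp: bil_simps)
    qed
    have step: "good B" if A: "A \<in> \<Lambda>" and B: "B \<in> \<Lambda>" and lAB: "link A B" and gA: "good A"
      and s: "0 \<le> s" "s < s'" "s' \<le> 1" "l s \<in> wall A" "l s' \<in> wall B" for A B s s'
      unfolding good_def
    proof (intro allI impI)
      fix \<tau>' :: real assume \<tau>': "(\<tau>' = 1 \<or> \<tau>' = -1) \<and> bil (\<tau>' *\<^sub>R nrm B) D > 0"
      have tA: "bil (nrm A) D \<noteq> 0"
        using transversal[OF ne p q False A, of s] s by (simp add: l_def D_def)
      define \<tau> where "\<tau> = sgn (bil (nrm A) D)"
      have \<tau>: "\<tau> = 1 \<or> \<tau> = -1" "bil (\<tau> *\<^sub>R nrm A) D > 0"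
        using tA by (auto simp: \<tau>_def sgn_if bil_simps)
      define v v' where "v = \<tau> *\<^sub>R nrm A" and "v' = \<tau>' *\<^sub>R nrm B"
      have vv: "bil v v = 1" "bil v' v' = 1"
        using \<tau> \<tau>' bil_nrm_self[OF ne A] bil_nrm_self[OF ne B] by (auto simp: v_def v'_def bil_simps)
      have vD: "bil v D > 0" "bil v' D > 0" using \<tau> \<tau>' by (auto simp: v_def v'_def)
      have v0: "x \<in> wall A \<longleftrightarrow> x \<in> kk \<and> bil v x = 0" "x \<in> wall B \<longleftrightarrow> x \<in> kk \<and> bil v' x = 0" for x
        using \<tau> \<tau>' in_wall_nrm[OF ne A, of x] in_wall_nrm[OF ne B, of x] by (auto simp: v_def v'_def bil_simps)
      have x: "l s \<in> kk" "bil v (l s) = 0" and x': "l s' \<in> kk" "bil v' (l s') = 0"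
        using s v0 by auto
      have "bil v (l s' - l s) > 0" "bil v' (l s' - l s) > 0"
        unfolding lD using vD s by (simp_all add: bil_simps)
      then have pos: "bil v (l s') > 0" "bil v' (l s) < 0" using x x' by (simp_all add: bil_simps)
      have disj: "bil v' z \<noteq> 0" if "z \<in> kk" "bil v z = 0" for z
      proof
        assume "bil v' z = 0"
        then have "z \<in> wall A" "z \<in> wall B" using v0 that by auto
        then have "wall A = wall B" using walls_meet(2)[OF A B] by blast
        then have "bil v (l s') = 0" using v0 s by auto
        then show False using pos by simp
      qed
      have nest: "\<And>z. z \<in> fut \<Longrightarrow> bil v' z = 0 \<Longrightarrow> bil v z \<ge> 0"
        "v' - bil v v' *\<^sub>R v \<in> fut" "bil v v' \<ge> 0"
        using nested_hyperplanes[OF vv x pos(2) x' pos(1)] disj by blast+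
      obtain a b where ab: "a \<in> bends" "b \<in> bends"
        "r (matrix_inv A ** B) = a ** (matrix_inv A ** B) ** b" using rl[OF A B lAB] by blast
      obtain ca da where a: "a = diag2 ifirst ca da" "ca > 0" "da > 0" using ab by (auto simp: bends_def)
      obtain cb db where b: "b = diag2 ifirst cb db" "cb > 0" "db > 0" using ab by (auto simp: bends_def)
      have "A ** (matrix_inv A ** B) = B" using inv_right[OF A] by (simp add: matrix_mul_assoc)
      then have rB: "r B = r A ** (a ** (matrix_inv A ** B) ** b)"
        using rm[OF A mult[OF inv[OF A] B]] ab by simp
      \<comment> \<open>The functional between the two walls: the bend a at A has been applied, the
        bend b at B has not. Both bends only rescale, on a wall and on its normal
        separately.\<close>
      define G where "G z = bil y (r A *v (a *v (matrix_inv A *v z)))" for z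
      have Glin: "G (z + w) = G z + G w" "G (c *\<^sub>R z) = c * G z" for z w c
        by (simp_all add: G_def matrix_vector_right_distrib matrix_vector_mult_scaleR bil_simps)
      have FB: "F B z = bil y (r A *v (a *v (matrix_inv A *v (B *v (b *v (matrix_inv B *v z))))))" for z
        by (simp add: F_def rB matrix_vector_mul_assoc matrix_mul_assoc)
      have FB1: "F B z = cb * G z" if "bil v' z = 0" for z
      proof -
        have "bil (nrm B) z = 0" using that \<tau>' by (auto simp: v'_def bil_simps)
        then have "b *v (matrix_inv B *v z) = cb *\<^sub>R (matrix_inv B *v z)"
          using bil_nrm[OF ne B, of z] by (simp add: b diag2_apply)
        then show ?thesis
          by (simp add: FB G_def matrix_vector_mult_scaleR inv_right_v[OF B] bil_simps)
      qed
      have FB2: "F B v' = db * G v'"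
      proof -
        have "b *v (matrix_inv B *v v') = db *\<^sub>R (matrix_inv B *v v')"
          by (simp add: v'_def b diag2_apply matrix_vector_mult_scaleR inrm[OF B] algebra_simps)
        then show ?thesis
          by (simp add: FB G_def matrix_vector_mult_scaleR inv_right_v[OF B] bil_simps)
      qed
      have GA1: "G z = ca * F A z" if "bil v z = 0" for z
      proof -
        have "bil (nrm A) z = 0" using that \<tau> by (auto simp: v_def bil_simps)
        then have "a *v (matrix_inv A *v z) = ca *\<^sub>R (matrix_inv A *v z)"
          using bil_nrm[OF ne A, of z] by (simp add: a diag2_apply)
        then show ?thesis by (simp add: F_def G_def matrix_vector_mult_scaleR bil_simps)
      qed
      have GA2: "G v = da * F A v"
      proof -
        have "a *v (matrix_inv A *v v) = da *\<^sub>R (matrix_inv A *v v)"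
          by (simp add: v_def a diag2_apply matrix_vector_mult_scaleR inrm[OF A] algebra_simps)
        then show ?thesis by (simp add: F_def G_def matrix_vector_mult_scaleR bil_simps)
      qed
      have FA: "F A z \<le> 0" if "z \<in> fut" "bil v z = 0" for z
        using gA \<tau> that unfolding good_def v_def by blast
      have FAv: "F A v \<le> 0" using gA \<tau> unfolding good_def v_def by blast
      have Gv: "G v \<le> 0" using GA2 FAv a by (simp add: mult_nonneg_nonpos)
      have G1: "G z \<le> 0" if "z \<in> fut" "bil v z = 0" for z
        using GA1[OF that(2)] FA[OF that] a by (simp add: mult_nonneg_nonpos)
      \<comment> \<open>Decompose z into its projection to the hyperplane of A, still a future
        vector, and a nonnegative multiple of v; G is nonpositive on both. The same works for v'
        below.\<close>
      have "F B z \<le> 0" if z: "z \<in> fut" "bil v' z = 0" for z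
      proof -
        let ?z = "z - bil v z *\<^sub>R v"
        have k: "bil v z \<ge> 0" by (rule nest(1)[OF z])
        have "?z \<in> fut" by (rule bil_project_fut[OF vv(1) x z(1)])
        moreover have "bil v ?z = 0" using vv by (simp add: bil_simps)
        ultimately have "G ?z \<le> 0" by (rule G1)
        moreover have "G z = G ?z + bil v z * G v"
          using Glin(1)[of ?z "bil v z *\<^sub>R v"] Glin(2)[of "bil v z" v] by simp
        moreover have "bil v z * G v \<le> 0" using k Gv by (rule mult_nonneg_nonpos)
        ultimately have "G z \<le> 0" by linarith
        then show ?thesis using FB1[OF z(2)] b by (simp add: mult_nonneg_nonpos)
      qed
      moreover have "F B v' \<le> 0"
      proof -
        let ?w = "v' - bil v v' *\<^sub>R v"
        have "bil v ?w = 0" using vv by (simp add: bil_simps)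
        then have "G ?w \<le> 0" using G1 nest(2) by blast
        moreover have "G v' = G ?w + bil v v' * G v"
          using Glin(1)[of ?w "bil v v' *\<^sub>R v"] Glin(2)[of "bil v v'" v] by simp
        moreover have "bil v v' * G v \<le> 0" using nest(3) Gv by (rule mult_nonneg_nonpos)
        ultimately have "G v' \<le> 0" by linarith
        then show ?thesis using FB2 b by (simp add: mult_nonneg_nonpos)
      qed
      ultimately show "(\<forall>z\<in>fut. bil (\<tau>' *\<^sub>R nrm B) z = 0 \<longrightarrow> F B z \<le> 0) \<and> F B (\<tau>' *\<^sub>R nrm B) \<le> 0"
        by (simp add: v'_def)
    qed
    have "good A" if "s \<in> S" "A \<in> \<Lambda>" "l s \<in> wall A" for s A
      using that
    proof (induction "card {r \<in> S. r < s}" arbitrary: s A rule: less_induct)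
      case less
      show ?case
      proof (cases "s = 0")
        case True
        then show ?thesis using base[OF less.prems(2)] less.prems(3) by (simp add: l_def)
      next
        case False
        have s01: "0 < s" "s \<le> 1" using less.prems(1) False by (auto simp: S_def)
        let ?T = "{r \<in> S. r < s}"
        have finT: "finite ?T" using finS by simp
        have "p \<in> walls" using p wall_one one by (auto simp: walls_def)
        then have "0 \<in> ?T" using s01 by (simp add: S_def l_def)
        then have T: "?T \<noteq> {}" by blast
        \<comment> \<open>The last crossing before s: the open segment between the two crossings
          avoids all walls, so their walls are linked.\<close>
        define m where "m = Max ?T"
        have m: "m \<in> ?T" unfolding m_def using finT T by (rule Max_in)
        then obtain B where B: "B \<in> \<Lambda>" "l m \<in> wall B" by (auto simp: S_def walls_def)
        have m01: "0 \<le> m" "m < s" using m by (auto simp: S_def)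
        have "{r \<in> S. r < m} \<subset> ?T" using m by auto
        then have "card {r \<in> S. r < m} < card ?T" using finT by (rule psubset_card_mono[rotated])
        then have gB: "good B" using less.hyps m B by blast
        have "link B A"
        proof -
          have "l m \<noteq> l s"
          proof
            assume "l m = l s"
            then have "(s - m) *\<^sub>R D = 0" using lD[of s m] by simp
            then show False using m01 p \<open>q \<notin> hh\<close> by (simp add: D_def)
          qed
          moreover have "open_segment (l m) (l s) \<inter> walls = {}"
          proof (rule ccontr)
            assume "\<not> ?thesis"
            then obtain x where x: "x \<in> open_segment (l m) (l s)" "x \<in> walls" by blast
            then obtain u where u: "0 < u" "u < 1" "x = (1 - u) *\<^sub>R l m + u *\<^sub>R l s"
              by (auto simp: in_segment)
            define e where "e = m + u * (s - m)"
            have xe: "x = l e" by (simp add: u(3) l_def e_def algebra_simps)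
            have e: "m < e" "e < s"
            proof -
              show "m < e" using u m01 by (simp add: e_def)
              have "u * (s - m) < 1 * (s - m)" using u m01 by (intro mult_strict_right_mono) auto
              then show "e < s" by (simp add: e_def)
            qed
            then have "e \<in> ?T" using x xe m01 s01 by (simp add: S_def)
            then have "e \<le> m" unfolding m_def using finT by (rule Max_ge[rotated])
            then show False using e by simp
          qed
          ultimately show ?thesis using B less.prems unfolding link_def by blast
        qed
        then show ?thesis
          using step[OF B(1) less.prems(2) _ gB m01(1) m01(2) s01(2) B(2) less.prems(3)] by blast
      qed
    qed
    moreover have l1: "l 1 = q" by (simp add: l_def)
    moreover have qw: "q \<in> wall \<gamma>" using p by (simp add: q_def wall_def)
    moreover have "1 \<in> S" using qw l1 \<gamma> by (auto simp: S_def walls_def)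
    ultimately have g: "good \<gamma>" using \<gamma> by metis
    have "bil (nrm \<gamma>) D \<noteq> 0"
      using transversal[OF ne p q False \<gamma>, of 1] qw by (simp add: D_def)
    define \<tau> where "\<tau> = sgn (bil (nrm \<gamma>) D)"
    have \<tau>: "\<tau> = 1 \<or> \<tau> = -1" "bil (\<tau> *\<^sub>R nrm \<gamma>) D > 0"
      using \<open>bil (nrm \<gamma>) D \<noteq> 0\<close> by (auto simp: \<tau>_def sgn_if bil_simps)
    have "\<sigma> * bil y (r \<gamma> *v x) \<le> 0" if x: "x \<in> fut" "x $ ifirst = 0" for x
    proof -
      \<comment> \<open>The vector \<sigma> \<gamma> x is a future vector over the wall of \<gamma>,
        and evaluating F on it cancels \<gamma>, which leaves the pairing of y with r \<gamma>
        applied to x.\<close>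
      have "bil (\<tau> *\<^sub>R nrm \<gamma>) (\<sigma> *\<^sub>R (\<gamma> *v x)) = 0"
        using bil_nrm[OF ne \<gamma>, of "\<gamma> *v x"] x inv_left_v[OF \<gamma>, of x] by (simp add: bil_simps)
      then have "F \<gamma> (\<sigma> *\<^sub>R (\<gamma> *v x)) \<le> 0" using g \<tau> \<sigma>(2)[OF x(1)] unfolding good_def by blast
      then show ?thesis
        by (simp add: F_def matrix_vector_mult_scaleR inv_left_v[OF \<gamma>] bil_simps)
    qed
    then show ?thesis using \<sigma>(1) by blast
  qed
qed

end

section \<open>The bent group is not a lattice\<close>

text \<open>With J the Gram matrix of the form, A^T J A = J gives the inverse as J A^T J, whose
  entries are visibly integers.\<close>

lemma SO_q_matrix_inv:
  fixes A :: "'n::{finite,linorder} sqmat"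
  assumes "A \<in> SO_q" "A \<in> SL_int"
  shows "matrix_inv A \<in> SO_q" "matrix_inv A \<in> SL_int"
proof -
  let ?J = "diag2 ilast 1 (- 1) :: 'n sqmat"
  have d: "det A = 1" using assms by (simp add: SL_int_def)
  have J: "(?J *v x) \<bullet> y = bil x y" for x y
    by (simp add: diag2_apply bil_def inner_add_left inner_axis' algebra_simps)
  have JJ: "?J ** ?J = mat 1" by (simp add: diag2_mult diag2_one)
  have "transpose A ** ?J ** A *v x = ?J *v x" for x
  proof (rule vector_eq_rdot[THEN iffD1], intro allI)
    fix y
    have "(transpose A ** ?J ** A *v x) \<bullet> y = (?J *v (A *v x)) \<bullet> (A *v y)"
      by (simp only: matrix_vector_mul_assoc[symmetric] transpose_matrix_vector dot_lmul_matrix)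
    then show "(transpose A ** ?J ** A *v x) \<bullet> y = (?J *v x) \<bullet> y"
      by (simp only: J SO_q_bil[OF assms(1)])
  qed
  then have "transpose A ** ?J ** A = ?J" by (simp add: matrix_eq)
  then have "?J ** transpose A ** ?J ** A = mat 1"
    using JJ by (metis matrix_mul_assoc)
  then have inv: "matrix_inv A = ?J ** transpose A ** ?J"
    using matrix_left_right_inverse matrix_inv_eqI by blast
  have i: "A *v (matrix_inv A *v x) = x" for x
    by (simp add: matrix_vector_mul_assoc SL_matrix_inv d)
  show "matrix_inv A \<in> SO_q"
  proof -
    have "qform (matrix_inv A *v x) = qform x" for x
      using SO_q_qform[OF assms(1), of "matrix_inv A *v x"] by (simp add: i)
    then show ?thesis using SL_matrix_inv(3)[OF d] by (simp add: SO_q_def)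
  qed
  have ints: "\<forall>i j. (X ** Y) $ i $ j \<in> \<int>"
    if "\<forall>i j. X $ i $ j \<in> \<int>" "\<forall>i j. Y $ i $ j \<in> \<int>" for X Y :: "'n sqmat"
    using that by (auto simp: matrix_matrix_mult_def intro!: Ints_sum Ints_mult)
  have "\<forall>i j. ?J $ i $ j \<in> \<int>" by (simp add: diag2_def)
  moreover have "\<forall>i j. transpose A $ i $ j \<in> \<int>" using assms(2) by (simp add: SL_int_def transpose_def)
  ultimately have "\<forall>i j. (?J ** transpose A ** ?J) $ i $ j \<in> \<int>" by (intro ints)
  then show "matrix_inv A \<in> SL_int"
    using SL_matrix_inv(3)[OF d] by (simp add: SL_int_def inv[symmetric])
qed

lemma finite_index_hyp_group:
  fixes \<Lambda> :: "'n::{finite,linorder} sqmat set"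
  assumes fi: "finite_index \<Lambda> arithmetic_group" and tf: "torsion_free SL \<Lambda>"
  shows "hyp_group \<Lambda>"
proof
  have sub: "subgroup \<Lambda> arithmetic_group" using fi by (simp add: finite_index_def)
  show s: "\<Lambda> \<subseteq> SL_int \<inter> SO_q"
    using subgroup.subset[OF sub] by (simp add: arithmetic_group_def)
  show "mat 1 \<in> \<Lambda>" using subgroup.one_closed[OF sub] by (simp add: arithmetic_group_def)
  show "A ** B \<in> \<Lambda>" if "A \<in> \<Lambda>" "B \<in> \<Lambda>" for A B
    using subgroup.m_closed[OF sub that] by (simp add: arithmetic_group_def)
  show "matrix_inv A \<in> \<Lambda>" if A: "A \<in> \<Lambda>" for A
  proof -
    have AS: "A \<in> SO_q" "A \<in> SL_int" "det A = 1" using s A by (auto simp: SL_int_def)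
    have "inv\<^bsub>arithmetic_group\<^esub> A = matrix_inv A"
      unfolding m_inv_def
    proof (rule the_equality)
      show "matrix_inv A \<in> carrier arithmetic_group \<and> A \<otimes>\<^bsub>arithmetic_group\<^esub> matrix_inv A = \<one>\<^bsub>arithmetic_group\<^esub>
          \<and> matrix_inv A \<otimes>\<^bsub>arithmetic_group\<^esub> A = \<one>\<^bsub>arithmetic_group\<^esub>"
        using SO_q_matrix_inv[OF AS(1,2)] SL_matrix_inv[OF AS(3)] by (simp add: arithmetic_group_def)
    next
      fix B assume "B \<in> carrier arithmetic_group \<and> A \<otimes>\<^bsub>arithmetic_group\<^esub> B = \<one>\<^bsub>arithmetic_group\<^esub>
          \<and> B \<otimes>\<^bsub>arithmetic_group\<^esub> A = \<one>\<^bsub>arithmetic_group\<^esub>"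
      then show "B = matrix_inv A" using matrix_inv_eqI[of A B] by (auto simp: arithmetic_group_def)
    qed
    then show ?thesis using subgroup.m_inv_closed[OF sub A] by simp
  qed
qed (rule tf)

text \<open>The vector u^{-1} b written by Cramer's rule, a formula whose continuity in u and b is
  apparent.\<close>

definition solve :: "'n::finite sqmat \<Rightarrow> 'n rvec \<Rightarrow> 'n rvec" where
  "solve u b = (\<chi> k. det (\<chi> i j. if j = k then b $ i else u $ i $ j) / det u)"

lemma solve_eqI: "det u \<noteq> 0 \<Longrightarrow> u *v x = b \<Longrightarrow> x = solve u b"
  using cramer[of u x b] by (simp add: solve_def)

lemma continuous_on_det [continuous_intros]:
  fixes f :: "'a::topological_space \<Rightarrow> 'n::finite sqmat"
  assumes "\<And>i j. continuous_on S (\<lambda>x. f x $ i $ j)"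
  shows "continuous_on S (\<lambda>x. det (f x))"
  unfolding det_def by (intro continuous_intros assms)

lemma continuous_on_solve:
  fixes f :: "'a::topological_space \<Rightarrow> 'n::finite sqmat"
  assumes f: "continuous_on S f" and g: "continuous_on S g" and d: "\<And>x. x \<in> S \<Longrightarrow> det (f x) \<noteq> 0"
  shows "continuous_on S (\<lambda>x. solve (f x) (g x))"
  unfolding solve_def
proof (intro continuous_on_vec_lambda continuous_on_divide continuous_on_det)
  show "continuous_on S (\<lambda>x. (\<chi> i j. if j = k then g x $ i else f x $ i $ j) $ i $ j)" for i j k
    by (cases "j = k") (auto intro!: continuous_intros f g)
  show "continuous_on S (\<lambda>x. f x $ i $ j)" for i j by (intro continuous_intros f)
qed (use d in auto)

text \<open>The powers of \<open>diag2 k b a\<close> with \<open>b < 1 < a\<close> approach, up to scaling, the projection to the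
  \<open>k\<close>-th axis, which maps \<open>x\<close> and \<open>x'\<close> to opposite rays.\<close>

lemma sign_invariant_not_lattice:
  fixes \<Gamma> :: "'n::{finite,linorder} sqmat set" and x x' y :: "'n rvec"
  assumes nonneg: "\<And>M. M \<in> \<Gamma> \<Longrightarrow> bil y (M *v x) * bil y (M *v x') \<ge> 0"
    and xx': "x $ k * x' $ k < 0" and y: "bil y (axis k 1) \<noteq> 0"
  shows "\<not> lattice_in_SL \<Gamma>"
proof
  assume lat: "lattice_in_SL \<Gamma>"
  define n where "n = CARD('n) - 1"
  \<comment> \<open>The sign product for u^{-1} \<open>diag2 k s 1\<close> v. At u = v = 1 and s = 0
    the matrix is the projection to the axis k and the product is negative, so it stays negative
    nearby.\<close>
  define \<Phi> where "\<Phi> = (\<lambda>(u :: 'n sqmat, s :: real, v :: 'n sqmat).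
    bil y (solve u (diag2 k s 1 *v (v *v x))) * bil y (solve u (diag2 k s 1 *v (v *v x'))))"
  let ?S = "{u :: 'n sqmat. det u = 1} \<times> (UNIV :: (real \<times> 'n sqmat) set)"
  have "continuous_on ?S \<Phi>"
    unfolding \<Phi>_def case_prod_unfold diag2_apply
    by (intro continuous_intros continuous_on_solve) auto
  then have "openin (top_of_set ?S) (?S \<inter> \<Phi> -` {..<0})"
    by (intro continuous_openin_preimage_gen open_lessThan)
  then obtain W where W: "open W" "?S \<inter> \<Phi> -` {..<0} = ?S \<inter> W" unfolding openin_open by blast
  have sol1: "solve (mat 1) b = b" for b :: "'n rvec"
    using solve_eqI[of "mat 1" b b] by simp
  have "diag2 k 0 1 *v z = (z $ k) *\<^sub>R axis k 1" for z :: "'n rvec"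
    by (simp add: diag2_apply)
  then have "\<Phi> (mat 1, 0, mat 1) = (x $ k * x' $ k) * (bil y (axis k 1))\<^sup>2"
    by (simp add: \<Phi>_def sol1 bil_simps power2_eq_square)
  also have "\<dots> < 0" using mult_neg_pos[OF xx', of "(bil y (axis k 1))\<^sup>2"] y by simp
  finally have "(mat 1, 0, mat 1) \<in> ?S \<inter> \<Phi> -` {..<0}" by simp
  then have "(mat 1, 0, mat 1) \<in> W" unfolding W(2) by blast
  then obtain U T where UT: "open U" "mat 1 \<in> U" "open T" "(0, mat 1) \<in> T" "U \<times> T \<subseteq> W"
    using W(1) open_prod_elim[of W "(mat 1, 0, mat 1)"] by (metis mem_Sigma_iff)
  then obtain I V where IV: "open I" "0 \<in> I" "open V" "mat 1 \<in> V" "I \<times> V \<subseteq> T"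
    using open_prod_elim[of T "(0, mat 1)"] by (metis mem_Sigma_iff)
  obtain e where e: "e > 0" "ball 0 e \<subseteq> I" using IV open_contains_ball by blast
  have neg: "\<Phi> (u, s, v) < 0" if "det u = 1" "u \<in> U" "\<bar>s\<bar> < e" "v \<in> V" for u s v
  proof -
    have "s \<in> I" using e that by (auto simp: dist_real_def)
    then have "(u, s, v) \<in> ?S \<inter> W" using UT IV that by auto
    then show ?thesis unfolding W(2)[symmetric] by simp
  qed
  \<comment> \<open>Small enough that the ratio s of the eigenvalues of a positive power of g is
    below e, and less than 1; the exponent n in g normalizes the determinant.\<close>
  define b where "b = min (e / 2) (1 / 2)"
  have b: "0 < b" "b < 1" "b < e" using e by (auto simp: b_def)
  define g :: "'n sqmat" where "g = diag2 k b ((1 / b) ^ n)"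
  have det_g: "det g = 1"
    using b by (simp add: g_def det_diag2 n_def power_divide)
  \<comment> \<open>Recurrence takes u and v from a single neighbourhood, hence the intersection of
    U and V.\<close>
  let ?U = "{u \<in> carrier SL. u \<in> U \<inter> V}"
  have "?U = carrier SL \<inter> (U \<inter> V)" by auto
  then have "openin (top_of_set (carrier SL)) ?U" using UT IV by (metis openin_open_Int open_Int)
  then obtain j u v \<gamma> where j: "j > 0" "u \<in> ?U" "v \<in> ?U" "\<gamma> \<in> \<Gamma>" "u ** \<gamma> = (g [^]\<^bsub>SL\<^esub> (j::nat)) ** v"
  proof (rule lattice_recurrence[OF lat _ _ det_g])
    show "mat 1 \<in> ?U" using UT IV by simp
  qed
  have gj: "g [^]\<^bsub>SL\<^esub> i = diag2 k (b ^ i) (((1 / b) ^ n) ^ i)" for i :: nat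
  proof (induction i)
    case 0
    then show ?case by (simp add: diag2_one)
  next
    case (Suc i)
    then show ?case by (simp add: g_def diag2_mult mult.commute)
  qed
  define c where "c = ((1 / b) ^ n) ^ j"
  have c: "c \<ge> 1" using b by (simp add: c_def)
  \<comment> \<open>After division by the dominant eigenvalue c, the j-th power of g is
    \<open>diag2 k s 1\<close>.\<close>
  define s where "s = b ^ j / c"
  have "b ^ j \<le> b ^ 1" using b j by (intro power_decreasing) auto
  moreover have "s \<le> b ^ j / 1" unfolding s_def using b c by (intro divide_left_mono) auto
  moreover have "s \<ge> 0" using b c by (simp add: s_def)
  ultimately have s: "\<bar>s\<bar> < e" using b by auto
  have gs: "(g [^]\<^bsub>SL\<^esub> j) *v z = c *\<^sub>R (diag2 k s 1 *v z)" for z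
    using c by (simp add: gj c_def[symmetric] vec_eq_iff diag2_nth s_def)
  have du: "det u = 1" using j by simp
  have sol: "solve u (diag2 k s 1 *v (v *v z)) = (1 / c) *\<^sub>R (\<gamma> *v z)" for z
  proof (rule solve_eqI[symmetric])
    have "u *v (\<gamma> *v z) = c *\<^sub>R (diag2 k s 1 *v (v *v z))"
      using j(5) gs by (metis matrix_vector_mul_assoc)
    then show "u *v ((1 / c) *\<^sub>R (\<gamma> *v z)) = diag2 k s 1 *v (v *v z)"
      using c by (simp add: matrix_vector_mult_scaleR)
  qed (use du in simp)
  have "\<Phi> (u, s, v) = (1 / c)\<^sup>2 * (bil y (\<gamma> *v x) * bil y (\<gamma> *v x'))"
    by (simp add: \<Phi>_def sol bil_simps power2_eq_square)
  also have "\<dots> \<ge> 0" using nonneg[OF j(4)] by simp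
  finally show False using neg[OF du _ s, of v] j by auto
qed

theorem mainTheorem2:
  fixes n :: nat and t :: real
    and \<Lambda>\<^sub>0 :: "'n::{finite,linorder} sqmat set"
    and p :: "'n rvec set"
    and \<rho>\<^sub>t :: "(real \<Rightarrow> 'n rvec set set) set \<Rightarrow> 'n sqmat"
  assumes "n \<ge> 2" and "CARD('n) = n + 1" and "t > 0"
    and "finite_index \<Lambda>\<^sub>0 arithmetic_group" and "torsion_free SL \<Lambda>\<^sub>0"
    and "M0_finite_volume \<Lambda>\<^sub>0" and "\<not> compact_space (M0 \<Lambda>\<^sub>0)"
    and "N0_finite_volume \<Lambda>\<^sub>0" and "N0_two_sided \<Lambda>\<^sub>0" and "N0_properly_embedded \<Lambda>\<^sub>0"
    and "p \<in> Hyp"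
    and "bent_representation n t \<Lambda>\<^sub>0 p \<rho>\<^sub>t"
  shows "\<not> lattice_in_SL (\<rho>\<^sub>t ` carrier (pi1_M0 \<Lambda>\<^sub>0 p))"
proof -
  interpret hyp_group \<Lambda>\<^sub>0 by (rule finite_index_hyp_group) fact+
  interpret tiling \<Lambda>\<^sub>0 by unfold_locales fact
  obtain o' where o': "o' \<in> hh" "p = span {o'}" using \<open>p \<in> Hyp\<close> by (auto simp: Hyp_eq)
  have ok: "o' \<in> kk" using o' hh_in_kk by blast
  have card3: "card (UNIV :: 'n set) \<ge> 3" using assms(1,2) by simp
  have "card {ifirst, ilast :: 'n} \<le> 2" by (simp add: card_insert_if)
  then have "{ifirst, ilast :: 'n} \<noteq> UNIV" using card3 by (metis Suc_n_not_le_n eval_nat_numeral(3) le_trans)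
  then obtain k :: 'n where k: "k \<noteq> ifirst" "k \<noteq> ilast" by blast
  have ne: "(ifirst :: 'n) \<noteq> ilast"
  proof
    assume "(ifirst :: 'n) = ilast"
    then have "i = ilast" for i :: 'n
      unfolding ifirst_def ilast_def using Min_le[of UNIV i] Max_ge[of UNIV i] by (metis antisym finite UNIV_I)
    then show False using k by blast
  qed
  \<comment> \<open>Two points of the ball on the wall with opposite k-th coordinates; x also serves
    as the vector y defining the functional.\<close>
  define x x' where "x = axis ilast 1 + (1 / 2) *\<^sub>R (axis k 1 :: 'n rvec)"
    and "x' = axis ilast 1 - (1 / 2) *\<^sub>R (axis k 1 :: 'n rvec)"
  have "spatial x = (1 / 2) *\<^sub>R axis k 1" "spatial x' = - (1 / 2) *\<^sub>R axis k 1"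
    "x $ ilast = 1" "x' $ ilast = 1"
    using k by (simp_all add: x_def x'_def spatial_def axis_def vec_eq_iff)
  then have "x \<in> kk" "x' \<in> kk" by (simp_all add: kk_iff norm_axis_1)
  moreover have x1: "x $ ifirst = 0" "x' $ ifirst = 0"
    using k ne by (simp_all add: x_def x'_def axis_def)
  ultimately have xh: "x \<in> hh" and xf: "x \<in> fut" "x' \<in> fut"
    using kk_subset_fut by (auto simp: hh_def)
  define r where "r A = \<rho>\<^sub>t (cls o' A)" for A
  have hom: "\<rho>\<^sub>t \<in> hom (pi1_M0 \<Lambda>\<^sub>0 (span {o'})) SL"
    and bent: "separating_bending n t \<Lambda>\<^sub>0 (span {o'}) \<rho>\<^sub>t \<or> nonseparating_bending n t \<Lambda>\<^sub>0 (span {o'}) \<rho>\<^sub>t"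
    using assms(12) o' by (auto simp: bent_representation_def)
  have rm: "r (A ** B) = r A ** r B" if "A \<in> \<Lambda>\<^sub>0" "B \<in> \<Lambda>\<^sub>0" for A B
    unfolding r_def by (rule rho_cls_mult[OF hom ok that])
  have rl: "\<exists>a\<in>bends. \<exists>b\<in>bends. r (matrix_inv A ** B) = a ** (matrix_inv A ** B) ** b"
    if "A \<in> \<Lambda>\<^sub>0" "B \<in> \<Lambda>\<^sub>0" "link A B" for A B
    unfolding r_def using bent separating_link[OF _ o'(1) that] nonseparating_link[OF hom _ o'(1) that] by blast
  have "\<rho>\<^sub>t ` carrier (pi1_M0 \<Lambda>\<^sub>0 p) = r ` \<Lambda>\<^sub>0"
    using carrier_pi1[OF ok] o' by (simp add: r_def image_image)
  moreover have "\<not> lattice_in_SL (r ` \<Lambda>\<^sub>0)"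
  proof (rule sign_invariant_not_lattice[of _ x x x' k])
    show "x $ k * x' $ k < 0" using k by (simp add: x_def x'_def axis_def)
    show "bil x (axis k 1) \<noteq> 0"
      using k bil_axis[of k x] by (simp add: bil_commute[of x]) (simp add: x_def axis_def)
    fix M assume "M \<in> r ` \<Lambda>\<^sub>0"
    then obtain \<gamma> where \<gamma>: "\<gamma> \<in> \<Lambda>\<^sub>0" "M = r \<gamma>" by blast
    obtain \<sigma> where \<sigma>: "\<sigma> = 1 \<or> \<sigma> = -1" "\<And>z. z \<in> fut \<Longrightarrow> z $ ifirst = 0 \<Longrightarrow> \<sigma> * bil x (M *v z) \<le> 0"
      using bent_pairing_sign[OF ne rm rl o'(1) xh \<gamma>(1)] \<gamma>(2) by auto
    \<comment> \<open>The sign \<sigma> is the same for both vectors, so it cancels in the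
      product.\<close>
    have "(\<sigma> * bil x (M *v x)) * (\<sigma> * bil x (M *v x')) \<ge> 0"
      using \<sigma>(2)[OF xf(1) x1(1)] \<sigma>(2)[OF xf(2) x1(2)] by (rule mult_nonpos_nonpos)
    then show "bil x (M *v x) * bil x (M *v x') \<ge> 0" using \<sigma>(1) by auto
  qed
  ultimately show ?thesis by simp
qed

end
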